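(* For any $t_0>0$, integers $J\ge0$ and $K_1\ge2$, and all $x\in\mathbb Z$ and $t\ge t_0$, we have $$\frac{d^J\nabla\mathbf u(x,t)}{dt^J}=\frac{1}{t^{J+1}}h^{(2J+1)}\!\left(\frac{x}{\sqrt t}\right)+\frac{1}{2t^{J+1}\sqrt t}h^{(2J+2)}\!\left(\frac{x}{\sqrt t}\right)+\sum_{n=2}^{K_1}\frac{1}{t^{J+1+n/2}}\,g_{Jn}\!\left(\frac{x}{\sqrt t}\right)+\hat{\mathbf r}_{\mathbf u}(J,K_1;x,t)\quad\text{for }x\ge0,$$ $$\frac{d^J\nabla\mathbf u(x,t)}{dt^J}=-\frac{d^J\nabla\mathbf u(-(x+1),t)}{dt^J}\quad\text{for }x<0,$$ where $$|\hat{\mathbf r}_{\mathbf u}(J,K_1;x,t)|\le\frac{\hat R_{\mathbf u}(J,K_1,t_0)}{t^{J+1+(K_1+1)/2}},$$ and $\hat R_{\mathbf u}(J,K_1,t_0)\ge0$ does not depend on $t\ge t_0$ and $x\ge0$.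
   Context: Fix $N\in\mathbb N$. Let $a_1,\dots,a_N\in\mathbb R$ be the unique solution of $\sum_{\nu=1}^Na_\nu\nu^2=1$, $\sum_{\nu=1}^Na_\nu\nu^{2m}=0$ for $m=2,\dots,N$. For functions $\mathbf u$ on $\mathbb Z$ let $\boldsymbol\Delta_1\mathbf u(x)=\sum_{\nu=1}^Na_\nu(\mathbf u(x-\nu)-2\mathbf u(x)+\mathbf u(x+\nu))$, and let $A(\theta)=2\sum_{\nu=1}^Na_\nu(1-\cos\nu\theta)$ be the symbol of $-\boldsymbol\Delta_1$. The gradient is $\nabla\mathbf u(x,t)=\mathbf u(x+1,t)-\mathbf u(x,t)$. First discrete Green function: $\mathbf u(x,t)$, $x\in\mathbb Z$, $t\ge0$, is the function that is rapidly decreasing in $x$, $C^1$ in $t\in[0,\infty)$, and satisfies $\dot{\mathbf u}-\boldsymbol\Delta_1\mathbf u=0$ for $t>0$, $\mathbf u(0,0)=1$, $\mathbf u(x,0)=0$ for $x\ne0$. It is given by $\mathbf u(x,t)=\frac1{2\pi}\int_{-\pi}^\pi e^{-tA(\theta)}e^{ix\theta}\,d\theta$. Let $h(y)=\frac{1}{2\sqrt\pi}e^{-y^2/4}$. For integer $J\ge0$ and $n\ge N$ (empty sums are zero) set $$b_n=\frac{2(-1)^{n+1}}{(2(n+1))!}\sum_{\nu=1}^Na_\nu\nu^{2(n+1)},\qquad c_{nm}=\sum_{\substack{l_1,\dots,l_m\ge N\\l_1+\dots+l_m=n}}b_{l_1}\cdots b_{l_m}\ (m\ge1),$$ $$\mathcal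 P_n(\xi)=\sum_{1\le m\le n/N}\frac{c_{nm}\xi^{2(n+m)}}{m!},\qquad d_{Jn}=\sum_{1\le m\le\min(n/N,J)}(-1)^m\binom Jm c_{nm},$$ $$\mathcal Q_{Jn}(\xi)=0\ (N\le n\le2N-1),\qquad \mathcal Q_{Jn}(\xi)=\sum_{\substack{l_1,l_2\ge N\\l_1+l_2=n}}d_{Jl_1}\xi^{2l_1}\mathcal P_{l_2}(\xi)\ (n\ge2N),$$ $$\mathcal R_{Jn}(\xi)=(-1)^J\xi^{2J}\bigl(d_{Jn}\xi^{2n}+\mathcal P_n(\xi)+\mathcal Q_{Jn}(\xi)\bigr).$$ Set $h_{J0}=h^{(2J)}$, $h_{Jn}=\mathcal R_{Jn}(-i\,d/dx)h$ for $n\ge N$, and for $n\ge2$ $$g_{Jn}(y)=\frac{1}{(n+1)!}h_{J0}^{(n+1)}(y)+\sum_{\substack{s\ge N,\ j\ge1\\2s+j-1=n}}\frac{1}{j!}h_{Js}^{(j)}(y),\quad y\ge0.$$ *)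

theory Defs
  imports "HOL-Analysis.Analysis" "HOL-Computational_Algebra.Polynomial"
begin

text \<open>Functions on \<open>\<int>\<close>, and the functions \<open>h\<close>, \<open>h\<^sub>J\<^sub>n\<close>, \<open>g\<^sub>J\<^sub>n\<close>, are complex-valued throughout, so that
  the symbol \<open>-i d/dx\<close> can be used literally.  The parameters \<open>N\<close> and \<open>a\<close> are the order of the
  scheme and its coefficients; only the values \<open>a 1, \<dots>, a N\<close> matter.\<close>

definition scheme_coeffs :: "nat \<Rightarrow> (nat \<Rightarrow> real) \<Rightarrow> bool" where
  "scheme_coeffs N a \<longleftrightarrow>
     (\<Sum>\<nu>=1..N. a \<nu> * real \<nu> ^ 2) = 1 \<and>
     (\<forall>m\<in>{2..N}. (\<Sum>\<nu>=1..N. a \<nu> * real \<nu> ^ (2 * m)) = 0)"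

definition Laplace1 :: "nat \<Rightarrow> (nat \<Rightarrow> real) \<Rightarrow> (int \<Rightarrow> complex) \<Rightarrow> int \<Rightarrow> complex" where
  "Laplace1 N a u x =
     (\<Sum>\<nu>=1..N. complex_of_real (a \<nu>) * (u (x - int \<nu>) - 2 * u x + u (x + int \<nu>)))"

definition grad :: "(int \<Rightarrow> real \<Rightarrow> complex) \<Rightarrow> int \<Rightarrow> real \<Rightarrow> complex" where
  "grad u x t = u (x + 1) t - u x t"

definition rapidly_decreasing :: "(int \<Rightarrow> complex) \<Rightarrow> bool" where
  "rapidly_decreasing f \<longleftrightarrow>
     (\<forall>k::nat. \<exists>C. \<forall>x. (1 + \<bar>real_of_int x\<bar>) ^ k * norm (f x) \<le> C)"

text \<open>Continuous differentiability on \<open>[0, \<infinity>)\<close>, with the one-sided derivative at \<open>0\<close>.\<close>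

definition C1_halfline :: "(real \<Rightarrow> complex) \<Rightarrow> bool" where
  "C1_halfline f \<longleftrightarrow>
     (\<exists>f'. continuous_on {0..} f' \<and>
           (\<forall>t\<ge>0. (f has_vector_derivative f' t) (at t within {0..})))"

text \<open>The values \<open>u x t\<close> with \<open>t < 0\<close> are irrelevant.\<close>

definition first_discrete_Green ::
    "nat \<Rightarrow> (nat \<Rightarrow> real) \<Rightarrow> (int \<Rightarrow> real \<Rightarrow> complex) \<Rightarrow> bool" where
  "first_discrete_Green N a u \<longleftrightarrow>
     (\<forall>t\<ge>0. rapidly_decreasing (\<lambda>x. u x t)) \<and>
     (\<forall>x. C1_halfline (u x)) \<and>
     (\<forall>x. \<forall>t>0. vector_derivative (u x) (at t) - Laplace1 N a (\<lambda>y. u y t) x = 0) \<and>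
     u 0 0 = 1 \<and> (\<forall>x. x \<noteq> 0 \<longrightarrow> u x 0 = 0)"

text \<open>The iterated derivative \<open>f\<^bsup>(k)\<^esup>(t)\<close> of a complex-valued function of a real variable.\<close>

definition nth_deriv :: "nat \<Rightarrow> (real \<Rightarrow> complex) \<Rightarrow> real \<Rightarrow> complex" where
  "nth_deriv k = (\<lambda>f t. vector_derivative f (at t)) ^^ k"

definition times_differentiable_at :: "nat \<Rightarrow> (real \<Rightarrow> complex) \<Rightarrow> real \<Rightarrow> bool" where
  "times_differentiable_at J f t \<longleftrightarrow> (\<forall>k<J. nth_deriv k f differentiable at t)"

definition h :: "real \<Rightarrow> complex" where
  "h y = complex_of_real (1 / (2 * sqrt pi) * exp (- (y\<^sup>2) / 4))"

definition b_coeff :: "nat \<Rightarrow> (nat \<Rightarrow> real) \<Rightarrow> nat \<Rightarrow> real" where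
  "b_coeff N a n =
     2 * (-1) ^ (n + 1) / fact (2 * (n + 1)) * (\<Sum>\<nu>=1..N. a \<nu> * real \<nu> ^ (2 * (n + 1)))"

text \<open>The tuples \<open>(l\<^sub>1, \<dots>, l\<^sub>m)\<close> are lists of length \<open>m\<close>.\<close>

definition c_coeff :: "nat \<Rightarrow> (nat \<Rightarrow> real) \<Rightarrow> nat \<Rightarrow> nat \<Rightarrow> real" where
  "c_coeff N a n m =
     (\<Sum>ls | length ls = m \<and> (\<forall>l\<in>set ls. N \<le> l) \<and> sum_list ls = n.
        prod_list (map (b_coeff N a) ls))"

definition P_poly :: "nat \<Rightarrow> (nat \<Rightarrow> real) \<Rightarrow> nat \<Rightarrow> real poly" where
  "P_poly N a n = (\<Sum>m=1..n div N. monom (c_coeff N a n m / fact m) (2 * (n + m)))"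

definition d_coeff :: "nat \<Rightarrow> (nat \<Rightarrow> real) \<Rightarrow> nat \<Rightarrow> nat \<Rightarrow> real" where
  "d_coeff N a J n =
     (\<Sum>m=1..min (n div N) J. (-1) ^ m * real (J choose m) * c_coeff N a n m)"

definition Q_poly :: "nat \<Rightarrow> (nat \<Rightarrow> real) \<Rightarrow> nat \<Rightarrow> nat \<Rightarrow> real poly" where
  "Q_poly N a J n =
     (if n < 2 * N then 0
      else (\<Sum>(l1, l2) | N \<le> l1 \<and> N \<le> l2 \<and> l1 + l2 = n.
              monom (d_coeff N a J l1) (2 * l1) * P_poly N a l2))"

definition R_poly :: "nat \<Rightarrow> (nat \<Rightarrow> real) \<Rightarrow> nat \<Rightarrow> nat \<Rightarrow> real poly" where
  "R_poly N a J n =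
     monom ((-1) ^ J) (2 * J) *
     (monom (d_coeff N a J n) (2 * n) + P_poly N a n + Q_poly N a J n)"

text \<open>The constant-coefficient operator \<open>p(-i d/dx)\<close> applied to \<open>f\<close>.\<close>

definition poly_diff_op :: "real poly \<Rightarrow> (real \<Rightarrow> complex) \<Rightarrow> real \<Rightarrow> complex" where
  "poly_diff_op p f y =
     (\<Sum>k\<le>degree p. complex_of_real (coeff p k) * ((- \<i>) ^ k * nth_deriv k f y))"

text \<open>Only used for \<open>n = 0\<close> and for \<open>n \<ge> N\<close>, where \<open>N \<ge> 1\<close>.\<close>

definition h_fun :: "nat \<Rightarrow> (nat \<Rightarrow> real) \<Rightarrow> nat \<Rightarrow> nat \<Rightarrow> real \<Rightarrow> complex" where
  "h_fun N a J n = (if n = 0 then nth_deriv (2 * J) h else poly_diff_op (R_poly N a J n) h)"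

definition g_fun :: "nat \<Rightarrow> (nat \<Rightarrow> real) \<Rightarrow> nat \<Rightarrow> nat \<Rightarrow> real \<Rightarrow> complex" where
  "g_fun N a J n y =
     1 / fact (n + 1) * nth_deriv (n + 1) (h_fun N a J 0) y +
     (\<Sum>(s, j) | N \<le> s \<and> 1 \<le> j \<and> 2 * s + j - 1 = n.
        1 / fact j * nth_deriv j (h_fun N a J s) y)"

end

theory Submission
  imports Defs "HOL-Probability.Characteristic_Functions"
begin

text \<open>The bounded generator makes the lattice equation reversible, so a Baire category argument
  upgrades the pointwise-in-time decay of a Green function to local boundedness; hence the Green
  function is the Fourier integral of \<open>exp (- t A(\<theta>))\<close>.  The order conditions force
  \<open>A'' = 2 + K (1 - cos \<theta>)\<^sup>N\<close> with \<open>K < 0\<close>; therefore \<open>A'\<close> is concave on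
  \<open>[0, \<pi>]\<close> and vanishes at both ends, so \<open>A\<close> increases there and \<open>A(\<theta>) \<ge> c \<theta>\<^sup>2\<close>.
  Write \<open>A(\<theta>) = \<theta>\<^sup>2 (1 - B(\<theta>))\<close> and \<open>\<theta> = \<xi> / \<surd>t\<close>.  The integrand of the \<open>J\<close>-th derivative of the
  gradient becomes \<open>exp (- \<xi>\<^sup>2) (- \<xi>\<^sup>2)\<^sup>J (1 - B)\<^sup>J exp (\<xi>\<^sup>2 B) (exp (i \<theta>) - 1)\<close> up to a power of \<open>t\<close>,
  and Taylor expansion in \<open>\<theta>\<close> with \<open>\<xi>\<close> frozen produces polynomials in \<open>\<xi>\<close> whose Gaussian Fourier
  transforms are the functions \<open>g\<^sub>J\<^sub>n\<close>.  The remainder is dominated by a power of \<open>t\<close> times a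
  polynomial times a Gaussian; for \<open>\<theta>\<close> away from \<open>0\<close> the powers of \<open>t\<close> come
  from \<open>1 \<le> (\<bar>\<xi>\<bar> / (\<delta> \<surd>t))\<^sup>M\<close>.\<close>

section \<open>Uniqueness for flows with bounded generator\<close>

text \<open>Rapid decrease is assumed for each time slice separately, with no uniformity in
  \<open>t\<close>. So neither differentiation of a Fourier series under the sum nor a Gronwall
  estimate in the supremum norm is available until a bound holds uniformly near some time; producing
  that bound is the task of the Baire argument. For \<open>N \<ge> 2\<close> the order conditions
  force coefficients of both signs, so positivity of the symbol on all of [-pi, pi] cannot be read
  off term by term. The sign of \<open>K\<close> comes from the two zeros of A': with
  \<open>K \<ge> 0\<close> the function A'' would be positive and A' strictly increasing from 0 to
  pi. With \<xi> frozen, the weight \<xi>^2 is an independent parameter that can be as large as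
  \<open>t\<close> times a constant. Errors must therefore be explicit in it: on a small interval
  |B| \<le> 1/2, so exp (\<xi>^2 B) costs only half of the Gaussian exp (- \<xi>^2). The factor exp
  (i \<theta>) - 1 vanishes at 0, which shifts all orders by one: the term of order k in \<theta>
  belongs to \<open>g_fun\<close> with index k - 1.\<close>

locale pointwise_bounded_flow =
  fixes w :: "'i \<Rightarrow> real \<Rightarrow> 'b::real_normed_vector"
    and \<Lambda> :: "('i \<Rightarrow> 'b) \<Rightarrow> 'i \<Rightarrow> 'b"
    and L :: real
  assumes deriv: "\<And>x t. (w x has_vector_derivative \<Lambda> (\<lambda>y. w y t) x) (at t)"
    and gen_bound: "\<And>f D x. (\<And>y. norm (f y) \<le> D) \<Longrightarrow> norm (\<Lambda> f x) \<le> L * D"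
    and L_pos: "L > 0"
    and slice_bounded: "\<And>t. \<exists>C. \<forall>x. norm (w x t) \<le> C"
begin

lemma isCont_w: "isCont (w x) t"
  using deriv has_vector_derivative_continuous by blast

text \<open>A bound D on the segment limits the change away from \<open>s\<close> to L * D * |t - s|
  \<le> D / 2, so D may be replaced by m + D / 2. Iterating drives any initial bound to the fixed
  point 2 * m, and the a priori constant \<open>C\<close> disappears from the conclusion.\<close>

lemma bound_near_improves:
  assumes len: "\<bar>t - s\<bar> * L \<le> 1/2"
    and m: "\<And>x. norm (w x s) \<le> m"
    and C: "\<And>x r. r \<in> closed_segment s t \<Longrightarrow> norm (w x r) \<le> C"
    and r: "r \<in> closed_segment s t"
  shows "norm (w x r) \<le> 2 * m"
proof -
  have C0: "C \<ge> 0" by (rule order_trans[OF norm_ge_zero C[OF r]])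
  have m0: "m \<ge> 0" by (rule order_trans[OF norm_ge_zero m])
  \<comment> \<open>The k-th iterate of D -> m + D / 2, up to an initial enlargement from C to 2 * m
    + C.\<close>
  have "\<forall>x. \<forall>r\<in>closed_segment s t. norm (w x r) \<le> 2 * m + C / 2 ^ k" for k
  proof (induction k)
    case 0
    then show ?case using C m0 by (fastforce simp: add_increasing)
  next
    case (Suc k)
    define D where "D = 2 * m + C / 2 ^ k"
    have D0: "D \<ge> 0" using m0 C0 by (simp add: D_def)
    show ?case
    proof (intro allI ballI)
      fix x r assume r: "r \<in> closed_segment s t"
      have "norm (w x r - w x s) \<le> L * D * norm (r - s)"
      proof (rule differentiable_bound[where S = "closed_segment s t" and f' = "\<lambda>q h. h *\<^sub>R \<Lambda> (\<lambda>y. w y q) x"])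
        fix q assume q: "q \<in> closed_segment s t"
        show "(w x has_derivative (\<lambda>h. h *\<^sub>R \<Lambda> (\<lambda>y. w y q) x)) (at q within closed_segment s t)"
          using deriv has_vector_derivative_def has_derivative_at_withinI by blast
        have "norm (\<Lambda> (\<lambda>y. w y q) x) \<le> L * D"
          by (rule gen_bound) (use Suc.IH q in \<open>auto simp: D_def\<close>)
        then show "onorm (\<lambda>h. h *\<^sub>R \<Lambda> (\<lambda>y. w y q) x) \<le> L * D"
          by (intro onorm_bound) (auto simp: D0 less_imp_le[OF L_pos] mult.commute[of "L * D"] mult_left_mono)
      qed (use r in auto)
      also have "\<dots> \<le> L * D * \<bar>t - s\<bar>"
        using r D0 L_pos by (intro mult_left_mono)
          (auto simp: closed_segment_eq_real_ivl split: if_splits)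
      also have "\<dots> = D * (\<bar>t - s\<bar> * L)" by (simp add: mult_ac)
      also have "\<dots> \<le> D * (1/2)" using len D0 by (intro mult_left_mono) auto
      finally have "norm (w x r) \<le> norm (w x s) + D / 2"
        using norm_triangle_sub[of "w x r" "w x s"] by simp
      then show "norm (w x r) \<le> 2 * m + C / 2 ^ Suc k"
        using m[of x] unfolding D_def by (simp add: add_divide_distrib mult.commute)
    qed
  qed
  then have *: "norm (w x r) \<le> 2 * m + C / 2 ^ k" for k using r by simp
  have "(\<lambda>k. 2 * m + C * (1/2) ^ k) \<longlonglongrightarrow> 2 * m + C * 0"
    by (intro tendsto_intros LIMSEQ_power_zero) auto
  then show ?thesis
    by (intro LIMSEQ_le_const[where X = "\<lambda>k. 2 * m + C * (1/2) ^ k"])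
       (use * in \<open>auto simp: power_divide\<close>)
qed

definition loc_bounded :: "real \<Rightarrow> bool" where
  "loc_bounded t \<longleftrightarrow> (\<exists>e>0. \<exists>C. \<forall>r\<in>ball t e. \<forall>x. norm (w x r) \<le> C)"

lemma open_loc_bounded: "open {t. loc_bounded t}"
proof (subst open_dist, intro ballI)
  fix t assume "t \<in> {t. loc_bounded t}"
  then obtain e C where e: "e > 0" "\<And>r x. r \<in> ball t e \<Longrightarrow> norm (w x r) \<le> C"
    unfolding loc_bounded_def by blast
  have "loc_bounded s" if "dist s t < e" for s
    unfolding loc_bounded_def
  proof (intro exI conjI)
    show "e - dist s t > 0" using that by simp
    show "\<forall>r\<in>ball s (e - dist s t). \<forall>x. norm (w x r) \<le> C"
    proof (intro ballI allI)
      fix r x assume "r \<in> ball s (e - dist s t)"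
      then have "r \<in> ball t e" by (auto simp: dist_real_def)
      then show "norm (w x r) \<le> C" by (rule e(2))
    qed
  qed
  then show "\<exists>e>0. \<forall>y. dist y t < e \<longrightarrow> y \<in> {t. loc_bounded t}"
    using e(1) by blast
qed

lemma bounded_on_compact:
  assumes "compact S" "\<And>t. t \<in> S \<Longrightarrow> loc_bounded t"
  obtains C where "\<And>x r. r \<in> S \<Longrightarrow> norm (w x r) \<le> C"
proof -
  obtain e C where e: "\<And>t. t \<in> S \<Longrightarrow> e t > 0"
    "\<And>t r x. t \<in> S \<Longrightarrow> r \<in> ball t (e t) \<Longrightarrow> norm (w x r) \<le> C t"
    using assms(2) unfolding loc_bounded_def by metis
  obtain T where T: "T \<subseteq> S" "finite T" "S \<subseteq> (\<Union>t\<in>T. ball t (e t))"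
    by (rule compactE_image[OF assms(1), of S "\<lambda>t. ball t (e t)"]) (use e(1) in force)+
  have "norm (w x r) \<le> Max (insert 0 (C ` T))" if r: "r \<in> S" for x r
  proof -
    obtain t where t: "t \<in> T" "r \<in> ball t (e t)" using T(3) r by blast
    then have "norm (w x r) \<le> C t" using e(2) T(1) by blast
    also have "\<dots> \<le> Max (insert 0 (C ` T))" using t T(2) by auto
    finally show ?thesis .
  qed
  then show ?thesis by (rule that)
qed

text \<open>No uniform bound near \<open>p\<close> is given. Compact pieces of the segment that
  avoid \<open>p\<close> do have one, and running the flow backwards from \<open>t\<close> over such
  a piece makes it 2 * M, with M a bound of the slice at \<open>t\<close>; this does not degenerate
  as the piece approaches \<open>p\<close>. With the resulting bound on the whole segment, the flow
  can be run forwards from \<open>p\<close>.\<close>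

lemma bound_propagates:
  assumes len: "\<bar>t - p\<bar> * L \<le> 1/2"
    and p: "\<And>x. norm (w x p) \<le> m"
    and lb: "\<And>q. q \<in> closed_segment p t \<Longrightarrow> q \<noteq> p \<Longrightarrow> loc_bounded q"
  shows "norm (w x t) \<le> 2 * m"
proof -
  obtain M where M: "\<And>x. norm (w x t) \<le> M" using slice_bounded by blast
  have seg: "norm (w x q) \<le> max m (2 * M)" if q: "q \<in> closed_segment p t" for x q
  proof (cases "q = p")
    case True
    then show ?thesis using p by (simp add: le_max_iff_disj)
  next
    case False
    have sub: "closed_segment t q \<subseteq> closed_segment p t - {p}"
      using q False by (auto simp: closed_segment_eq_real_ivl split: if_splits)
    obtain C where C: "\<And>x r. r \<in> closed_segment t q \<Longrightarrow> norm (w x r) \<le> C"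
      by (rule bounded_on_compact[of "closed_segment t q"]) (use sub lb in auto)
    have "\<bar>q - t\<bar> * L \<le> \<bar>t - p\<bar> * L"
      using q L_pos by (intro mult_right_mono)
        (auto simp: closed_segment_eq_real_ivl split: if_splits)
    then have "norm (w x q) \<le> 2 * M"
      by (intro bound_near_improves[of q t M C]) (use len M C in auto)
    then show ?thesis by simp
  qed
  show ?thesis
    by (rule bound_near_improves[OF len p seg]) auto
qed

text \<open>Osgood-type argument: by Baire, the slices are uniformly bounded on a relatively open piece of
  the set \<open>F\<close> of bad times; boundedness then spreads into the gaps of \<open>F\<close> from their endpoints,
  because the generator is bounded and hence the flow reversible.\<close>

lemma loc_bounded_everywhere: "loc_bounded t"
proof (rule ccontr)
  assume nb: "\<not> loc_bounded t"
  define F where "F = {t. \<not> loc_bounded t}"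
  have clF: "closed F" using open_loc_bounded unfolding F_def closed_def
    by (simp add: Collect_neg_eq)
  have tF: "t \<in> F" using nb by (simp add: F_def)
  \<comment> \<open>These sets are relatively open in \<open>F\<close> by continuity of each
    \<open>w x\<close>, and their intersection is empty because every slice is bounded. Baire then
    forbids all of them to be dense in \<open>F\<close>.\<close>
  define G where "G = (\<lambda>n. F - {t. \<forall>x. norm (w x t) \<le> real n})"
  have "\<Inter>(range G) = {}"
  proof -
    have "\<exists>n::nat. \<forall>x. norm (w x s) \<le> real n" for s
    proof -
      obtain C where C: "\<And>x. norm (w x s) \<le> C" using slice_bounded by blast
      obtain n :: nat where "C \<le> real n" using real_arch_simple by blast
      then have "\<forall>x. norm (w x s) \<le> real n" using order_trans[OF C] by blast
      then show ?thesis ..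
    qed
    then show ?thesis by (auto simp: G_def)
  qed
  then have "\<not> F \<subseteq> closure (\<Inter>(range G))" using tF by auto
  moreover have "openin (top_of_set F) (G n)" for n
  proof -
    have "closed {t. norm (w x t) \<le> real n}" for x
      by (intro closed_Collect_le) (auto intro!: continuous_intros continuous_at_imp_continuous_on isCont_w)
    then have "closed (\<Inter>x. {t. norm (w x t) \<le> real n})" by blast
    moreover have "G n = F \<inter> - (\<Inter>x. {t. norm (w x t) \<le> real n})" by (auto simp: G_def)
    ultimately show ?thesis using openin_open_Int[OF open_Compl] by metis
  qed
  ultimately have "\<not> (\<forall>n. F \<subseteq> closure (G n))"
    using Baire[OF clF, of "range G"] by blast
  then obtain n where n: "\<not> F \<subseteq> closure (G n)" by blast
  then obtain f where f: "f \<in> F" "f \<notin> closure (G n)" by blast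
  then have "open (- closure (G n))" "f \<in> - closure (G n)" by auto
  then obtain e where e: "e > 0" "ball f e \<subseteq> - closure (G n)"
    by (rule openE)
  have Fb: "norm (w x q) \<le> real n" if "q \<in> F" "q \<in> ball f e" for q x
    proof -
    have "q \<notin> G n" using e(2) that(2) closure_subset by blast
    then show ?thesis using that(1) by (simp add: G_def)
  qed
  \<comment> \<open>Small enough for the bound n to hold at the bad times of the ball, and for one
    step of \<open>bound_propagates\<close> to reach every point of it.\<close>
  define e' where "e' = min e (1 / (2 * L))"
  have e': "e' > 0" using e L_pos by (simp add: e'_def)
  have "norm (w x s) \<le> 2 * real n" if s: "s \<in> ball f e'" for s x
  proof -
    have ne: "F \<inter> closed_segment f s \<noteq> {}" using f by auto
    have cl: "closed (F \<inter> closed_segment f s)" using clF by (intro closed_Int) auto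
    \<comment> \<open>The bad time nearest to \<open>s\<close>: it still lies in the ball around
      \<open>f\<close>, where bad slices are bounded by n, and every other time between it and
      \<open>s\<close> is good.\<close>
    have "\<exists>p\<in>F \<inter> closed_segment f s. \<forall>q\<in>F \<inter> closed_segment f s. dist s p \<le> dist s q"
      by (rule distance_attains_inf[OF cl ne, of s]) blast
    then obtain p where "p \<in> F \<inter> closed_segment f s"
      "\<forall>q\<in>F \<inter> closed_segment f s. dist s p \<le> dist s q" by blast
    then have p: "p \<in> F" "p \<in> closed_segment f s"
      "\<And>q. q \<in> F \<Longrightarrow> q \<in> closed_segment f s \<Longrightarrow> dist s p \<le> dist s q"
      by auto
    have ps: "\<bar>s - p\<bar> \<le> \<bar>s - f\<bar>" "\<bar>p - f\<bar> \<le> \<bar>s - f\<bar>"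
      using p(2) by (auto simp: closed_segment_eq_real_ivl split: if_splits)
    show ?thesis
    proof (rule bound_propagates)
      have "\<bar>s - p\<bar> \<le> 1 / (2 * L)" using s ps by (auto simp: e'_def dist_real_def)
      then show "\<bar>s - p\<bar> * L \<le> 1 / 2" using L_pos by (simp add: field_simps)
      show "norm (w x p) \<le> real n" for x
        by (rule Fb) (use p ps s in \<open>auto simp: dist_real_def e'_def\<close>)
      fix q assume q: "q \<in> closed_segment p s" "q \<noteq> p"
      have "q \<in> closed_segment f s" "dist s q < dist s p"
        using q p(2) by (auto simp: closed_segment_eq_real_ivl dist_real_def split: if_splits)
      then show "loc_bounded q" using p(3)[of q] by (force simp: F_def)
    qed
  qed
  then have "loc_bounded f" unfolding loc_bounded_def using e' by fast
  then show False using f(1) unfolding F_def by simp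
qed

text \<open>The set of times with zero slice is closed by continuity and open because propagation
  with m = 0 gives the bound 0 at distance below 1 / (2 * L). The real line is connected.\<close>

lemma flow_unique:
  assumes "\<And>x. w x t\<^sub>0 = 0"
  shows "w x t = 0"
proof -
  define Z where "Z = {t. \<forall>x. w x t = 0}"
  have "closed Z"
  proof -
    have "closed {t. w x t = 0}" for x
      by (intro closed_Collect_eq) (auto intro!: continuous_intros continuous_at_imp_continuous_on isCont_w)
    then have "closed (\<Inter>x. {t. w x t = 0})" by blast
    also have "(\<Inter>x. {t. w x t = 0}) = Z" by (auto simp: Z_def)
    finally show ?thesis .
  qed
  moreover have "open Z"
  proof (subst open_dist, intro ballI exI conjI allI impI)
    show "1 / (2 * L) > 0" using L_pos by simp
    fix s q assume s: "s \<in> Z" and q: "dist q s < 1 / (2 * L)"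
    have "norm (w x q) \<le> 2 * 0" for x
      using q L_pos s
      by (intro bound_propagates[of q s 0] loc_bounded_everywhere)
         (auto simp: field_simps dist_real_def Z_def)
    then show "q \<in> Z" by (simp add: Z_def)
  qed
  ultimately have "Z = {} \<or> Z = UNIV" using clopen[of Z] by simp
  moreover have "t\<^sub>0 \<in> Z" using assms by (simp add: Z_def)
  ultimately have "t \<in> Z" by auto
  then show ?thesis by (simp add: Z_def)
qed

end

section \<open>Gaussian Fourier transforms\<close>

lemma nth_deriv_0 [simp]: "nth_deriv 0 f = f"
  by (simp add: nth_deriv_def)

lemma nth_deriv_Suc: "nth_deriv (Suc k) f t = vector_derivative (nth_deriv k f) (at t)"
  by (simp add: nth_deriv_def)

text \<open>An equality of iterated derivatives at the single point \<open>t\<close> could not be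
  differentiated again; the induction needs it on a whole open set, from which the derivative of
  \<open>D k\<close> is transferred.\<close>

lemma nth_deriv_eqI:
  assumes S: "open S" and 0: "\<And>t. t \<in> S \<Longrightarrow> f t = D 0 t"
    and D: "\<And>k t. t \<in> S \<Longrightarrow> (D k has_vector_derivative D (Suc k) t) (at t)"
    and t: "t \<in> S"
  shows "nth_deriv k f t = D k t"
    and "(nth_deriv k f has_vector_derivative D (Suc k) t) (at t)"
proof -
  have deriv: "(nth_deriv k f has_vector_derivative D (Suc k) t) (at t)"
    if eq: "\<And>t. t \<in> S \<Longrightarrow> nth_deriv k f t = D k t" and t: "t \<in> S" for k t
    by (rule has_vector_derivative_transform_within_open[OF D[OF t] S t]) (simp add: eq)
  have eq: "nth_deriv k f t = D k t" if "t \<in> S" for k t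
    using that
  proof (induction k arbitrary: t)
    case (Suc k)
    then show ?case
      by (simp add: nth_deriv_Suc vector_derivative_at[OF deriv])
  qed (simp add: 0)
  show "nth_deriv k f t = D k t" by (rule eq[OF t])
  show "(nth_deriv k f has_vector_derivative D (Suc k) t) (at t)" by (rule deriv[OF eq t])
qed

lemma nth_deriv_add: "nth_deriv j (nth_deriv k f) = nth_deriv (j + k) f"
  by (simp add: nth_deriv_def funpow_add)

text \<open>Suited to parameter integrals: a second-order pointwise estimate of the integrand can
  simply be integrated. The threshold e / (C + 1) also covers C = 0.\<close>

lemma has_vector_derivative_quadratic_remainder:
  fixes f :: "real \<Rightarrow> 'a::real_normed_vector"
  assumes "\<And>z. norm (f z - f y - (z - y) *\<^sub>R D) \<le> C * (z - y)\<^sup>2"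
  shows "(f has_vector_derivative D) (at y)"
  unfolding has_vector_derivative_def has_derivative_at_alt
proof (intro conjI allI impI)
  show "bounded_linear (\<lambda>x. x *\<^sub>R D)" by (rule bounded_linear_scaleR_left)
  fix e :: real assume e: "e > 0"
  have C: "C \<ge> 0" using order_trans[OF norm_ge_zero assms[of "y + 1"]] by simp
  show "\<exists>d>0. \<forall>z. norm (z - y) < d \<longrightarrow> norm (f z - f y - (z - y) *\<^sub>R D) \<le> e * norm (z - y)"
  proof (intro exI[of _ "e / (C + 1)"] conjI allI impI)
    show "e / (C + 1) > 0" using e C by simp
    fix z assume z: "norm (z - y) < e / (C + 1)"
    have "norm (f z - f y - (z - y) *\<^sub>R D) \<le> C * (z - y)\<^sup>2" by (rule assms)
    also have "\<dots> = (C * \<bar>z - y\<bar>) * \<bar>z - y\<bar>" by (simp add: power2_eq_square)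
    also have "\<dots> \<le> e * \<bar>z - y\<bar>"
    proof (rule mult_right_mono)
      have "C * \<bar>z - y\<bar> \<le> (C + 1) * (e / (C + 1))"
        using z C by (intro mult_mono) auto
      also have "\<dots> = e" using C by simp
      finally show "C * \<bar>z - y\<bar> \<le> e" .
    qed simp
    finally show "norm (f z - f y - (z - y) *\<^sub>R D) \<le> e * norm (z - y)" by simp
  qed
qed

lemma integrable_abs_power_gaussian:
  assumes "c > 0"
  shows "integrable lborel (\<lambda>\<xi>::real. \<bar>\<xi>\<bar> ^ k * exp (- (c * \<xi>\<^sup>2)))"
proof -
  \<comment> \<open>The standard deviation for which the normal density is proportional to exp (- c
    \<xi>^2), so that the known absolute moments apply.\<close>
  define \<sigma> where "\<sigma> = 1 / sqrt (2 * c)"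
  have s: "\<sigma> > 0" "2 * \<sigma>\<^sup>2 = 1 / c" using assms by (auto simp: \<sigma>_def power_divide)
  have "integrable lborel (\<lambda>\<xi>. sqrt (2 * pi * \<sigma>\<^sup>2) * (normal_density 0 \<sigma> \<xi> * \<bar>\<xi> - 0\<bar> ^ k))"
    by (intro integrable_mult_right integrable_normal_moment_abs s)
  also have "(\<lambda>\<xi>. sqrt (2 * pi * \<sigma>\<^sup>2) * (normal_density 0 \<sigma> \<xi> * \<bar>\<xi> - 0\<bar> ^ k))
      = (\<lambda>\<xi>. \<bar>\<xi>\<bar> ^ k * exp (- (c * \<xi>\<^sup>2)))"
    using s by (auto simp: normal_density_def fun_eq_iff mult_ac)
  finally show ?thesis .
qed

lemma norm_poly_of_real_le:
  "norm (poly p (complex_of_real \<xi>)) \<le> (\<Sum>i\<le>degree p. norm (coeff p i) * \<bar>\<xi>\<bar> ^ i)"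
  unfolding poly_altdef by (rule order_trans[OF norm_sum]) (simp add: norm_mult norm_power)

lemma integrable_norm_poly_gaussian:
  assumes "c > 0"
  shows "integrable lborel (\<lambda>\<xi>. norm (poly p (complex_of_real \<xi>)) * exp (- (c * \<xi>\<^sup>2)))"
proof (rule Bochner_Integration.integrable_bound)
  show "integrable lborel (\<lambda>\<xi>. \<Sum>i\<le>degree p. norm (coeff p i) * (\<bar>\<xi>\<bar> ^ i * exp (- (c * \<xi>\<^sup>2))))"
    by (intro Bochner_Integration.integrable_sum integrable_mult_right integrable_abs_power_gaussian assms)
  show "(\<lambda>\<xi>. norm (poly p (complex_of_real \<xi>)) * exp (- (c * \<xi>\<^sup>2))) \<in> borel_measurable lborel"
    by (simp, rule borel_measurable_continuous_onI) (auto intro!: continuous_intros)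
  show "AE \<xi> in lborel. norm (norm (poly p (complex_of_real \<xi>)) * exp (- (c * \<xi>\<^sup>2)))
    \<le> norm (\<Sum>i\<le>degree p. norm (coeff p i) * (\<bar>\<xi>\<bar> ^ i * exp (- (c * \<xi>\<^sup>2))))"
  proof (intro AE_I2)
    fix \<xi>
    have "norm (poly p (complex_of_real \<xi>)) * exp (- (c * \<xi>\<^sup>2))
      \<le> (\<Sum>i\<le>degree p. norm (coeff p i) * \<bar>\<xi>\<bar> ^ i) * exp (- (c * \<xi>\<^sup>2))"
      by (intro mult_right_mono norm_poly_of_real_le) auto
    also have "\<dots> = (\<Sum>i\<le>degree p. norm (coeff p i) * (\<bar>\<xi>\<bar> ^ i * exp (- (c * \<xi>\<^sup>2))))"
      by (simp add: sum_distrib_right mult.assoc)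
    finally show "norm (norm (poly p (complex_of_real \<xi>)) * exp (- (c * \<xi>\<^sup>2)))
      \<le> norm (\<Sum>i\<le>degree p. norm (coeff p i) * (\<bar>\<xi>\<bar> ^ i * exp (- (c * \<xi>\<^sup>2))))"
      by (simp add: order_trans[OF _ abs_ge_self])
  qed
qed

text \<open>Every function of the expansion is an inverse Fourier transform of a polynomial times
  exp (- \<xi>^2). Complex coefficients are taken so that differentiation in y becomes
  multiplication of the polynomial by i \<xi>.\<close>

definition gauss_integrand :: "complex poly \<Rightarrow> real \<Rightarrow> real \<Rightarrow> complex" where
  "gauss_integrand p y \<xi> =
     complex_of_real (exp (- \<xi>\<^sup>2)) * poly p (complex_of_real \<xi>) * iexp (y * \<xi>)"

definition gauss_transform :: "complex poly \<Rightarrow> real \<Rightarrow> complex" where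
  "gauss_transform p y = complex_of_real (1 / (2 * pi)) * (LINT \<xi>|lborel. gauss_integrand p y \<xi>)"

lemma norm_gauss_integrand:
  "norm (gauss_integrand p y \<xi>) = norm (poly p (complex_of_real \<xi>)) * exp (- (1 * \<xi>\<^sup>2))"
  by (simp add: gauss_integrand_def norm_mult mult.commute)

lemma integrable_gauss_integrand [intro, simp]: "integrable lborel (gauss_integrand p y)"
proof (rule Bochner_Integration.integrable_bound[OF integrable_norm_poly_gaussian[of 1 p]])
  show "gauss_integrand p y \<in> borel_measurable lborel"
    unfolding gauss_integrand_def
    by (simp, rule borel_measurable_continuous_onI) (auto intro!: continuous_intros)
qed (simp_all add: norm_gauss_integrand)

lemma gauss_transform_add: "gauss_transform (p + q) y = gauss_transform p y + gauss_transform q y"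
proof -
  have "gauss_integrand (p + q) y \<xi> = gauss_integrand p y \<xi> + gauss_integrand q y \<xi>" for \<xi>
    by (simp add: gauss_integrand_def algebra_simps)
  then show ?thesis by (simp add: gauss_transform_def algebra_simps)
qed

lemma gauss_transform_smult: "gauss_transform (smult c p) y = c * gauss_transform p y"
proof -
  have "gauss_integrand (smult c p) y \<xi> = c * gauss_integrand p y \<xi>" for \<xi>
    by (simp add: gauss_integrand_def algebra_simps)
  then show ?thesis by (simp add: gauss_transform_def algebra_simps)
qed

lemma gauss_transform_0 [simp]: "gauss_transform 0 y = 0"
  using gauss_transform_smult[of 0 0] by simp

lemma gauss_transform_sum: "gauss_transform (sum p A) y = (\<Sum>i\<in>A. gauss_transform (p i) y)"
  by (induction A rule: infinite_finite_induct) (simp_all add: gauss_transform_add)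

lemma has_vector_derivative_gauss_transform:
  "(gauss_transform p has_vector_derivative gauss_transform ([:0, \<i>:] * p) y) (at y)"
proof (rule has_vector_derivative_quadratic_remainder)
  define C where "C = (LINT \<xi>|lborel. norm (poly (monom 1 2 * p) (complex_of_real \<xi>)) * exp (- (1 * \<xi>\<^sup>2)))"
  fix z
  have pt: "norm (gauss_integrand p z \<xi> - gauss_integrand p y \<xi>
        - (z - y) *\<^sub>R gauss_integrand ([:0, \<i>:] * p) y \<xi>)
      \<le> (z - y)\<^sup>2 * (norm (poly (monom 1 2 * p) (complex_of_real \<xi>)) * exp (- (1 * \<xi>\<^sup>2)))" for \<xi>
  proof -
    \<comment> \<open>The first-order Taylor remainder of the oscillating factor. Its quadratic
      bound contributes \<xi>^2, hence the factor \<open>monom 1 2\<close> in the dominating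
      integral.\<close>
    define E where "E = iexp ((z - y) * \<xi>) - (\<Sum>k\<le>1. (\<i> * complex_of_real ((z - y) * \<xi>)) ^ k / fact k)"
    have "iexp (z * \<xi>) = iexp (y * \<xi>) * iexp ((z - y) * \<xi>)"
      by (simp add: exp_add[symmetric] algebra_simps)
    then have "gauss_integrand p z \<xi> - gauss_integrand p y \<xi>
        - (z - y) *\<^sub>R gauss_integrand ([:0, \<i>:] * p) y \<xi> = gauss_integrand p y \<xi> * E"
      by (simp add: gauss_integrand_def E_def scaleR_conv_of_real algebra_simps)
    then have "norm (gauss_integrand p z \<xi> - gauss_integrand p y \<xi>
        - (z - y) *\<^sub>R gauss_integrand ([:0, \<i>:] * p) y \<xi>)
      = norm (poly p (complex_of_real \<xi>)) * exp (- (1 * \<xi>\<^sup>2)) * norm E"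
      by (simp only: norm_mult norm_gauss_integrand)
    also have "\<dots> \<le> norm (poly p (complex_of_real \<xi>)) * exp (- (1 * \<xi>\<^sup>2)) * ((z - y)\<^sup>2 * \<xi>\<^sup>2)"
    proof (rule mult_left_mono)
      have "norm E \<le> \<bar>(z - y) * \<xi>\<bar> ^ Suc 1 / fact (Suc 1)"
        unfolding E_def by (rule iexp_approx1)
      also have "\<dots> = ((z - y)\<^sup>2 * \<xi>\<^sup>2) / 2"
        by (simp add: power_mult_distrib abs_mult flip: power2_eq_square)
      also have "\<dots> \<le> (z - y)\<^sup>2 * \<xi>\<^sup>2" by simp
      finally show "norm E \<le> (z - y)\<^sup>2 * \<xi>\<^sup>2" .
    qed simp
    also have "\<dots> = (z - y)\<^sup>2 * (norm (poly (monom 1 2 * p) (complex_of_real \<xi>)) * exp (- (1 * \<xi>\<^sup>2)))"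
      by (simp add: poly_monom norm_mult norm_power mult_ac)
    finally show ?thesis .
  qed
  have "gauss_transform p z - gauss_transform p y - (z - y) *\<^sub>R gauss_transform ([:0, \<i>:] * p) y
     = complex_of_real (1 / (2 * pi)) * (LINT \<xi>|lborel. gauss_integrand p z \<xi> - gauss_integrand p y \<xi>
        - (z - y) *\<^sub>R gauss_integrand ([:0, \<i>:] * p) y \<xi>)"
    by (simp add: gauss_transform_def algebra_simps del: mult_pCons_left)
  also have "norm \<dots> \<le> 1 / (2 * pi) * ((z - y)\<^sup>2 * C)"
  proof -
    have "norm (LINT \<xi>|lborel. gauss_integrand p z \<xi> - gauss_integrand p y \<xi>
        - (z - y) *\<^sub>R gauss_integrand ([:0, \<i>:] * p) y \<xi>)
      \<le> (LINT \<xi>|lborel. (z - y)\<^sup>2 * (norm (poly (monom 1 2 * p) (complex_of_real \<xi>)) * exp (- (1 * \<xi>\<^sup>2))))"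
      by (rule order_trans[OF integral_norm_bound integral_mono])
         (intro Bochner_Integration.integrable_diff integrable_norm integrable_scaleR_right
            integrable_gauss_integrand integrable_mult_right integrable_norm_poly_gaussian pt zero_less_one)+
    also have "\<dots> = (z - y)\<^sup>2 * C" by (simp add: C_def)
    finally show ?thesis by (simp add: norm_mult norm_divide divide_right_mono)
  qed
  finally show "norm (gauss_transform p z - gauss_transform p y - (z - y) *\<^sub>R gauss_transform ([:0, \<i>:] * p) y)
     \<le> C / (2 * pi) * (z - y)\<^sup>2"
    by (simp add: mult_ac)
qed

text \<open>This is the characteristic function of the standard normal law at y / sqrt 2; the
  substitution x = sqrt 2 * \<xi> turns its density into a multiple of exp (- \<xi>^2).\<close>

lemma gauss_transform_1: "gauss_transform 1 y = h y"
proof -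
  have "complex_of_real (exp (- (y / sqrt 2)\<^sup>2 / 2)) = char std_normal_distribution (y / sqrt 2)"
    by (simp add: char_std_normal_distribution)
  also have "\<dots> = (LINT x|lborel. std_normal_density x *\<^sub>R iexp (y / sqrt 2 * x))"
    unfolding char_def by (rule integral_density) (auto intro!: AE_I2)
  also have "\<dots> = \<bar>sqrt 2\<bar> *\<^sub>R (LINT \<xi>|lborel. std_normal_density (0 + sqrt 2 * \<xi>) *\<^sub>R iexp (y / sqrt 2 * (0 + sqrt 2 * \<xi>)))"
    by (rule lborel_integral_real_affine) simp
  also have "(\<lambda>\<xi>. std_normal_density (0 + sqrt 2 * \<xi>) *\<^sub>R iexp (y / sqrt 2 * (0 + sqrt 2 * \<xi>)))
     = (\<lambda>\<xi>. (1 / sqrt (2 * pi)) *\<^sub>R gauss_integrand 1 y \<xi>)"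
    by (simp add: fun_eq_iff std_normal_density_def gauss_integrand_def scaleR_conv_of_real power_mult_distrib)
  also have "\<bar>sqrt 2\<bar> *\<^sub>R (LINT \<xi>|lborel. (1 / sqrt (2 * pi)) *\<^sub>R gauss_integrand 1 y \<xi>)
     = complex_of_real (1 / sqrt pi) * (LINT \<xi>|lborel. gauss_integrand 1 y \<xi>)"
    by (simp add: scaleR_conv_of_real real_sqrt_mult)
  finally have *: "complex_of_real (exp (- (y / sqrt 2)\<^sup>2 / 2)) = \<dots>" .
  have "h y = complex_of_real (1 / (2 * sqrt pi)) * complex_of_real (exp (- (y / sqrt 2)\<^sup>2 / 2))"
    by (simp add: h_def power_divide)
  also have "\<dots> = complex_of_real (1 / (2 * sqrt pi) * (1 / sqrt pi)) * (LINT \<xi>|lborel. gauss_integrand 1 y \<xi>)"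
    unfolding * by simp
  also have "1 / (2 * sqrt pi) * (1 / sqrt pi) = 1 / (2 * pi)" by simp
  finally show ?thesis by (simp add: gauss_transform_def)
qed

lemma nth_deriv_gauss_transform:
  "nth_deriv k (gauss_transform p) = gauss_transform ([:0, \<i>:] ^ k * p)"
proof
  fix y
  show "nth_deriv k (gauss_transform p) y = gauss_transform ([:0, \<i>:] ^ k * p) y"
    by (rule nth_deriv_eqI(1)[where S = UNIV and D = "\<lambda>k. gauss_transform ([:0, \<i>:] ^ k * p)"])
       (use has_vector_derivative_gauss_transform[of "[:0, \<i>:] ^ k * p" for k] in
         \<open>simp_all add: mult.assoc del: mult_pCons_left\<close>)
qed

lemma nth_deriv_h: "nth_deriv k h = gauss_transform ([:0, \<i>:] ^ k)"
proof -
  have "h = gauss_transform 1" by (rule ext) (simp add: gauss_transform_1)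
  then have "nth_deriv k h = nth_deriv k (gauss_transform 1)" by (rule arg_cong)
  also have "\<dots> = gauss_transform ([:0, \<i>:] ^ k)"
    using nth_deriv_gauss_transform[of k 1] by (simp only: mult_1_right)
  finally show ?thesis .
qed

lemma map_poly_of_real_eq_sum_monom:
  "map_poly complex_of_real p = (\<Sum>k\<le>degree p. monom (complex_of_real (coeff p k)) k)"
  by (subst poly_as_sum_of_monoms[symmetric]) (simp add: coeff_map_poly degree_map_poly)

text \<open>The factor (-i)^k of the operator cancels the i^k produced by k
  differentiations.\<close>

lemma poly_diff_op_h: "poly_diff_op p h = gauss_transform (map_poly complex_of_real p)"
proof
  fix y
  have *: "(- \<i>) ^ k * gauss_transform ([:0, \<i>:] ^ k) y = gauss_transform (monom 1 k) y" for k
  proof -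
    have "[:0, \<i>:] ^ k = smult (\<i> ^ k) (monom 1 k)"
      by (induction k) (simp_all add: monom_Suc smult_monom)
    moreover have "(- \<i>) ^ k * \<i> ^ k = 1" by (simp flip: power_mult_distrib)
    ultimately show ?thesis by (simp add: gauss_transform_smult flip: mult.assoc)
  qed
  show "poly_diff_op p h y = gauss_transform (map_poly complex_of_real p) y"
    unfolding poly_diff_op_def nth_deriv_h * map_poly_of_real_eq_sum_monom gauss_transform_sum
    by (simp add: gauss_transform_smult[symmetric] smult_monom)
qed

section \<open>Positivity of the symbol\<close>

text \<open>These are the Chebyshev polynomials of the first kind, obtained from their three-term
  recurrence.\<close>

lemma cos_multiple_poly:
  "\<exists>p :: real poly. degree p \<le> n \<and> (\<forall>\<theta>. cos (real n * \<theta>) = poly p (cos \<theta>))"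
proof (induction n rule: induct_nat_012)
  case 0
  then show ?case by (intro exI[of _ 1]) auto
next
  case 1
  then show ?case by (intro exI[of _ "[:0, 1:]"]) auto
next
  case (ge2 n)
  then obtain p q :: "real poly" where
    p: "degree p \<le> n" "\<And>\<theta>. cos (real n * \<theta>) = poly p (cos \<theta>)" and
    q: "degree q \<le> Suc n" "\<And>\<theta>. cos (real (Suc n) * \<theta>) = poly q (cos \<theta>)" by blast
  have "cos (real (Suc (Suc n)) * \<theta>) = poly ([:0, 2:] * q - p) (cos \<theta>)" for \<theta>
  proof -
    have "cos (real (Suc n) * \<theta> + \<theta>) + cos (real (Suc n) * \<theta> - \<theta>) = 2 * cos (real (Suc n) * \<theta>) * cos \<theta>"
      by (simp add: cos_add cos_diff)
    then show ?thesis using p(2)[of \<theta>] q(2)[of \<theta>] by (simp add: algebra_simps)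
  qed
  moreover have "degree ([:0, 2:] * q - p) \<le> Suc (Suc n)"
    using p(1) q(1) by (intro degree_diff_le order_trans[OF degree_mult_le]) auto
  ultimately show ?case by blast
qed

text \<open>Converts orders of vanishing: a zero of order k in 1 - cos \<theta> is a zero of order 2
  * k in \<theta>.\<close>

lemma one_minus_cos_over_square: "((\<lambda>\<theta>. (1 - cos \<theta>) / \<theta>\<^sup>2) \<longlongrightarrow> 1 / 2) (at (0::real))"
proof -
  have "((\<lambda>x. sin x / x) \<longlongrightarrow> 1) (at (0::real))"
    using DERIV_sin[of "0::real"] by (simp add: DERIV_def)
  moreover have "filterlim (\<lambda>\<theta>::real. \<theta> / 2) (at 0) (at 0)"
    by (auto simp: filterlim_at eventually_at_filter intro!: tendsto_eq_intros)
  ultimately have "((\<lambda>\<theta>. sin (\<theta> / 2) / (\<theta> / 2)) \<longlongrightarrow> 1) (at (0::real))"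
    by (rule filterlim_compose)
  then have "((\<lambda>\<theta>. (sin (\<theta> / 2) / (\<theta> / 2))\<^sup>2 / 2) \<longlongrightarrow> 1\<^sup>2 / 2) (at (0::real))"
    by (intro tendsto_intros) auto
  moreover have "(\<lambda>\<theta>::real. (sin (\<theta> / 2) / (\<theta> / 2))\<^sup>2 / 2) = (\<lambda>\<theta>. (1 - cos \<theta>) / \<theta>\<^sup>2)"
  proof
    fix \<theta> :: real
    show "(sin (\<theta> / 2) / (\<theta> / 2))\<^sup>2 / 2 = (1 - cos \<theta>) / \<theta>\<^sup>2"
      using cos_double_sin[of "\<theta> / 2"] by (simp add: power_divide)
  qed
  ultimately show ?thesis by (simp only: power_one)
qed

section \<open>The symbol, its derivatives and its quadratic lower bound\<close>

definition symbol :: "nat \<Rightarrow> (nat \<Rightarrow> real) \<Rightarrow> real \<Rightarrow> real" where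
  "symbol N a \<theta> = 2 * (\<Sum>\<nu>=1..N. a \<nu> * (1 - cos (real \<nu> * \<theta>)))"

definition symbol' :: "nat \<Rightarrow> (nat \<Rightarrow> real) \<Rightarrow> real \<Rightarrow> real" where
  "symbol' N a \<theta> = 2 * (\<Sum>\<nu>=1..N. a \<nu> * (real \<nu> * sin (real \<nu> * \<theta>)))"

definition symbol'' :: "nat \<Rightarrow> (nat \<Rightarrow> real) \<Rightarrow> real \<Rightarrow> real" where
  "symbol'' N a \<theta> = 2 * (\<Sum>\<nu>=1..N. a \<nu> * (real \<nu> ^ 2 * cos (real \<nu> * \<theta>)))"

lemma DERIV_symbol: "(symbol N a has_real_derivative symbol' N a \<theta>) (at \<theta>)"
  unfolding symbol_def symbol'_def
  by (auto intro!: derivative_eq_intros simp: sum_negf mult_ac intro: sum.cong)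

lemma DERIV_symbol': "(symbol' N a has_real_derivative symbol'' N a \<theta>) (at \<theta>)"
  unfolding symbol'_def symbol''_def
  by (auto intro!: derivative_eq_intros sum.cong simp: power2_eq_square mult_ac)

lemma symbol_minus: "symbol N a (- \<theta>) = symbol N a \<theta>"
  by (simp add: symbol_def)

text \<open>All Taylor coefficients of \<open>A''\<close> of orders \<open>1, \<dots>, 2N - 1\<close> vanish.\<close>

lemma symbol''_near_2:
  assumes "scheme_coeffs N a" "N \<ge> 1"
  obtains C where "\<And>\<theta>. \<bar>symbol'' N a \<theta> - 2\<bar> \<le> C * \<theta> ^ (2 * N)"
proof -
  define C where "C = (\<Sum>\<nu>=1..N. 2 * \<bar>a \<nu>\<bar> * real \<nu> ^ (2 * N + 2) / fact (2 * N))"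
  \<comment> \<open>Two differentiations supply the extra factor \<nu>^2: k = 0 is the
    normalisation, and k = 1, ..., N - 1 are the order conditions for m = 2, ..., N.\<close>
  have mom: "(\<Sum>\<nu>=1..N. a \<nu> * real \<nu> ^ (2 * k + 2)) = (if k = 0 then 1 else 0)" if "k < N" for k
    using assms(1) that
    by (auto simp: scheme_coeffs_def numeral_2_eq_2 dest!: bspec[where x = "Suc k"])
  have "\<bar>symbol'' N a \<theta> - 2\<bar> \<le> C * \<theta> ^ (2 * N)" for \<theta>
  proof -
    define R where "R = (\<lambda>x. cos x - (\<Sum>m<2*N. cos_coeff m * x ^ m))"
    have R: "\<bar>R x\<bar> \<le> x ^ (2 * N) / fact (2 * N)" for x
    proof -
      obtain t where "cos x = (\<Sum>m<2*N. cos_coeff m * x ^ m) + (cos (t + 1/2 * real (2*N) * pi) / fact (2*N)) * x ^ (2*N)"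
        using Maclaurin_cos_expansion by blast
      then have "\<bar>R x\<bar> = \<bar>cos (t + 1/2 * real (2*N) * pi)\<bar> * (x ^ (2 * N) / fact (2 * N))"
        by (simp add: R_def abs_mult power_even_abs)
      also have "\<dots> \<le> 1 * (x ^ (2 * N) / fact (2 * N))"
        by (intro mult_right_mono abs_cos_le_one) (auto simp: zero_le_even_power)
      finally show ?thesis by simp
    qed
    have "(\<Sum>\<nu>=1..N. a \<nu> * (real \<nu> ^ 2 * (\<Sum>m<2*N. cos_coeff m * (real \<nu> * \<theta>) ^ m)))
       = (\<Sum>m<2*N. cos_coeff m * \<theta> ^ m * (\<Sum>\<nu>=1..N. a \<nu> * real \<nu> ^ (m + 2)))"
      unfolding sum_distrib_left by (subst sum.swap)
        (simp add: power_mult_distrib power_add power2_eq_square mult_ac)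
    also have "\<dots> = (\<Sum>m<2*N. if m = 0 then 1 else 0)"
    proof (rule sum.cong)
      fix m assume m: "m \<in> {..<2 * N}"
      show "cos_coeff m * \<theta> ^ m * (\<Sum>\<nu>=1..N. a \<nu> * real \<nu> ^ (m + 2)) = (if m = 0 then 1 else 0)"
      proof (cases "even m")
        case True
        then obtain k where k: "m = 2 * k" by (elim evenE)
        then show ?thesis using mom[of k] m by (cases "k = 0") (simp_all add: cos_coeff_def)
      qed (auto simp: cos_coeff_def elim: oddE)
    qed simp
    also have "\<dots> = 1" using assms(2) by simp
    finally have main: "(\<Sum>\<nu>=1..N. a \<nu> * (real \<nu> ^ 2 * (\<Sum>m<2*N. cos_coeff m * (real \<nu> * \<theta>) ^ m))) = 1" .
    have "symbol'' N a \<theta> - 2 = 2 * (\<Sum>\<nu>=1..N. a \<nu> * (real \<nu> ^ 2 * R (real \<nu> * \<theta>)))"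
      using main by (simp add: symbol''_def R_def algebra_simps sum_subtractf)
    also have "\<bar>\<dots>\<bar> \<le> 2 * (\<Sum>\<nu>=1..N. \<bar>a \<nu> * (real \<nu> ^ 2 * R (real \<nu> * \<theta>))\<bar>)"
      unfolding abs_mult[of 2] abs_numeral by (intro mult_left_mono sum_abs) simp
    also have "\<dots> \<le> 2 * (\<Sum>\<nu>=1..N. \<bar>a \<nu>\<bar> * (real \<nu> ^ 2 * ((real \<nu> * \<theta>) ^ (2 * N) / fact (2 * N))))"
      unfolding abs_mult abs_power2 by (intro mult_left_mono sum_mono R) auto
    also have "\<dots> = C * \<theta> ^ (2 * N)"
      by (simp add: C_def sum_distrib_left sum_distrib_right power_mult_distrib power_add power2_eq_square mult_ac)
    finally show ?thesis .
  qed
  then show ?thesis by (rule that)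
qed

text \<open>\<open>A''\<close> is a polynomial of degree at most \<open>N\<close> in \<open>1 - cos \<theta>\<close>, so the previous lemma leaves
  only its constant and its leading term.\<close>

lemma symbol''_eq:
  assumes "scheme_coeffs N a" "N \<ge> 1"
  obtains K where "\<And>\<theta>. symbol'' N a \<theta> = 2 + K * (1 - cos \<theta>) ^ N"
proof -
  obtain T :: "nat \<Rightarrow> real poly" where T: "\<And>n. degree (T n) \<le> n" "\<And>n \<theta>. cos (real n * \<theta>) = poly (T n) (cos \<theta>)"
    using cos_multiple_poly by metis
  \<comment> \<open>Composition with 1 - X re-expresses the Chebyshev polynomials in the variable 1
    - cos \<theta>, so that \<theta> = 0 corresponds to the point 0.\<close>
  define q where "q = (\<Sum>\<nu>=1..N. smult (2 * a \<nu> * real \<nu> ^ 2) (pcompose (T \<nu>) [:1, -1:])) - [:2:]"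
  have q: "poly q (1 - cos \<theta>) = symbol'' N a \<theta> - 2" for \<theta>
    by (simp add: q_def symbol''_def poly_sum poly_pcompose T(2) sum_distrib_left) (simp add: mult_ac)
  have "degree (smult c (pcompose (T \<nu>) [:1, -1:])) \<le> N" if nu: "\<nu> \<le> N" for c \<nu>
  proof -
    have "degree (smult c (pcompose (T \<nu>) [:1, -1:])) \<le> degree (T \<nu>) * degree [:1, -1 :: real:]"
      by (rule order_trans[OF degree_smult_le degree_pcompose_le])
    also have "\<dots> \<le> N" using T(1)[of \<nu>] nu by simp
    finally show ?thesis .
  qed
  then have deg: "degree q \<le> N"
    unfolding q_def by (intro degree_diff_le degree_sum_le) auto
  obtain C where C: "\<And>\<theta>. \<bar>symbol'' N a \<theta> - 2\<bar> \<le> C * \<theta> ^ (2 * N)"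
    using symbol''_near_2[OF assms] by blast
  have "[:0, 1:] ^ N dvd q"
  proof (cases "q = 0")
    case False
    define k where "k = order 0 q"
    obtain r where r: "q = [:0, 1:] ^ k * r" "\<not> [:0, 1:] dvd r"
      using order_decomp[OF False, of 0] by (auto simp: k_def)
    have r0: "poly r 0 \<noteq> 0" using r(2) by (simp add: poly_eq_0_iff_dvd)
    have "N \<le> k"
    proof (rule ccontr)
      assume "\<not> N \<le> k"
      then have kN: "k < N" by simp
      \<comment> \<open>This is (A'' - 2) / \<theta>^(2k). If k < N it would tend both to the
        nonzero value r(0) / 2^k and, by the Taylor bound, to 0.\<close>
      define f where "f = (\<lambda>\<theta>. ((1 - cos \<theta>) / \<theta>\<^sup>2) ^ k * poly r (1 - cos \<theta>))"
      have "(f \<longlongrightarrow> (1 / 2) ^ k * poly r (1 - cos 0)) (at 0)"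
        unfolding f_def by (intro tendsto_intros one_minus_cos_over_square)
      moreover have "(f \<longlongrightarrow> 0) (at 0)"
      proof (rule Lim_null_comparison)
        have "((\<lambda>\<theta>::real. C * \<theta> ^ (2 * (N - k))) \<longlongrightarrow> C * 0 ^ (2 * (N - k))) (at 0)"
          by (intro tendsto_intros)
        then show "((\<lambda>\<theta>::real. C * \<theta> ^ (2 * (N - k))) \<longlongrightarrow> 0) (at 0)"
          using kN by (simp add: zero_power)
        show "\<forall>\<^sub>F \<theta> in at 0. norm (f \<theta>) \<le> C * \<theta> ^ (2 * (N - k))"
        proof (rule eventually_at_filter[THEN iffD2], intro always_eventually allI impI)
          fix \<theta> :: real assume nz: "\<theta> \<noteq> 0"
          have pos: "\<theta> ^ (2 * k) > 0" using nz by (simp add: power_mult)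
          have "f \<theta> = poly q (1 - cos \<theta>) / \<theta> ^ (2 * k)"
            by (simp add: f_def r(1) power_divide power_mult)
          then have "norm (f \<theta>) = \<bar>symbol'' N a \<theta> - 2\<bar> / \<theta> ^ (2 * k)"
            using pos by (simp add: q abs_divide)
          also have "\<dots> \<le> C * \<theta> ^ (2 * N) / \<theta> ^ (2 * k)"
            using C pos by (intro divide_right_mono) auto
          also have "\<dots> = C * \<theta> ^ (2 * (N - k))"
          proof -
            have "2 * N = 2 * (N - k) + 2 * k" using kN by simp
            then have "\<theta> ^ (2 * N) = \<theta> ^ (2 * (N - k)) * \<theta> ^ (2 * k)" by (metis power_add)
            then show ?thesis using nz by simp
          qed
          finally show "norm (f \<theta>) \<le> C * \<theta> ^ (2 * (N - k))" .
        qed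
      qed
      ultimately have "(1 / 2) ^ k * poly r (1 - cos 0) = 0"
        by (rule tendsto_unique[rotated]) simp
      then show False using r0 by simp
    qed
    then show ?thesis unfolding r(1) by (intro dvd_mult2 le_imp_power_dvd)
  qed simp
  then obtain s where s: "q = [:0, 1:] ^ N * s" by (elim dvdE)
  \<comment> \<open>The degree of \<open>q\<close> is at most \<open>N\<close>, and the factor X^N
    already uses all of it.\<close>
  have "degree s = 0"
  proof (cases "s = 0")
    case False
    then have "degree q = N + degree s"
      unfolding s by (subst degree_mult_eq) (auto simp: degree_power_eq)
    then show ?thesis using deg by simp
  qed simp
  then obtain K where "s = [:K:]" by (rule degree_eq_zeroE)
  then have "symbol'' N a \<theta> = 2 + K * (1 - cos \<theta>) ^ N" for \<theta>
    using q[of \<theta>] s by (simp add: mult.commute)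
  then show ?thesis by (rule that)
qed

lemma symbol_lower_bound:
  assumes "scheme_coeffs N a" "N \<ge> 1"
  obtains c where "c > 0" "\<And>\<theta>. \<bar>\<theta>\<bar> \<le> pi \<Longrightarrow> c * \<theta>\<^sup>2 \<le> symbol N a \<theta>"
proof -
  obtain K where K: "\<And>\<theta>. symbol'' N a \<theta> = 2 + K * (1 - cos \<theta>) ^ N"
    using symbol''_eq[OF assms] by blast
  have end0: "symbol' N a 0 = 0" "symbol' N a pi = 0" "symbol N a 0 = 0"
    by (simp_all add: symbol'_def symbol_def)
  \<comment> \<open>Otherwise A'' \<ge> 2 everywhere, and A' could not vanish at both 0 and
    pi.\<close>
  have K_neg: "K < 0"
  proof (rule ccontr)
    assume "\<not> K < 0"
    then have pos: "symbol'' N a \<theta> > 0" for \<theta>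
      unfolding K by (intro add_pos_nonneg mult_nonneg_nonneg zero_le_power) auto
    have "\<exists>y. (symbol' N a has_real_derivative y) (at x) \<and> y > 0" for x
      by (rule exI[of _ "symbol'' N a x"], rule conjI[OF DERIV_symbol' pos])
    then have "symbol' N a 0 < symbol' N a pi"
      by (rule DERIV_pos_imp_increasing[OF pi_gt_zero])
    then show False by (simp add: end0)
  qed
  have decr: "symbol'' N a y \<le> symbol'' N a x" if "0 \<le> x" "x \<le> y" "y \<le> pi" for x y
  proof -
    have "(1 - cos x) ^ N \<le> (1 - cos y) ^ N"
      using that by (intro power_mono diff_left_mono) (auto simp: cos_mono_le_eq)
    then show ?thesis unfolding K using K_neg by (simp add: mult_left_mono_neg)
  qed
  \<comment> \<open>Concavity via the mean value theorem on both sides of x: a negative value would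
    need A'' < 0 at some u < x and A'' > 0 at some v > x, against the monotonicity of A''.\<close>
  have sym'_nonneg: "symbol' N a x \<ge> 0" if x: "0 \<le> x" "x \<le> pi" for x
  proof (cases "x = 0 \<or> x = pi")
    case False
    then have x': "0 < x" "x < pi" using x by auto
    obtain u where u: "0 < u" "u < x" "symbol' N a x - symbol' N a 0 = (x - 0) * symbol'' N a u"
      using MVT2[OF x'(1), of "symbol' N a" "symbol'' N a"] DERIV_symbol' by blast
    obtain v where v: "x < v" "v < pi" "symbol' N a pi - symbol' N a x = (pi - x) * symbol'' N a v"
      using MVT2[OF x'(2), of "symbol' N a" "symbol'' N a"] DERIV_symbol' by blast
    show ?thesis
    proof (rule ccontr)
      assume "\<not> symbol' N a x \<ge> 0"
      then have "x * symbol'' N a u < 0" "(pi - x) * symbol'' N a v > 0"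
        using u v by (simp_all add: end0)
      then have "symbol'' N a u < 0" "symbol'' N a v > 0"
        using x' by (simp_all add: mult_less_0_iff zero_less_mult_iff)
      then show False using decr[of u v] u v by simp
    qed
  qed (auto simp: end0)
  have mono: "symbol N a x \<le> symbol N a y" if "0 \<le> x" "x \<le> y" "y \<le> pi" for x y
  proof (rule DERIV_nonneg_imp_nondecreasing[OF that(2)])
    fix z assume "x \<le> z" "z \<le> y"
    then show "\<exists>d. (symbol N a has_real_derivative d) (at z) \<and> 0 \<le> d"
      using that by (intro exI[of _ "symbol' N a z"] conjI DERIV_symbol sym'_nonneg) auto
  qed
  have "((\<lambda>\<theta>. 2 + K * (1 - cos \<theta>) ^ N) \<longlongrightarrow> 2 + K * (1 - cos 0) ^ N) (at 0)"
    by (intro tendsto_intros)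
  then have "(symbol'' N a \<longlongrightarrow> 2) (at 0)"
    using assms(2) by (simp add: K[abs_def] zero_power)
  then have "\<forall>\<^sub>F \<theta> in at 0. symbol'' N a \<theta> > 1"
    by (rule order_tendstoD(1)) simp
  then obtain d where d: "d > 0" "\<And>\<theta>. \<theta> \<noteq> 0 \<Longrightarrow> \<bar>\<theta>\<bar> < d \<Longrightarrow> symbol'' N a \<theta> > 1"
    by (auto simp: eventually_at dist_real_def)
  define \<delta> where "\<delta> = min (d / 2) pi"
  have \<delta>: "\<delta> > 0" "\<delta> \<le> pi" using d by (auto simp: \<delta>_def)
  have s1: "symbol'' N a \<theta> \<ge> 1" if "0 \<le> \<theta>" "\<theta> \<le> \<delta>" for \<theta>
    using d(2)[of \<theta>] that d(1) assms(2) by (cases "\<theta> = 0") (auto simp: \<delta>_def K)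
  have s2: "symbol' N a \<theta> \<ge> \<theta>" if "0 \<le> \<theta>" "\<theta> \<le> \<delta>" for \<theta>
  proof -
    have "symbol' N a 0 - 0 \<le> symbol' N a \<theta> - \<theta>"
    proof (rule DERIV_nonneg_imp_nondecreasing[OF that(1)])
      fix x assume "0 \<le> x" "x \<le> \<theta>"
      then show "\<exists>y. ((\<lambda>x. symbol' N a x - x) has_real_derivative y) (at x) \<and> 0 \<le> y"
        using s1[of x] that by (intro exI[of _ "symbol'' N a x - 1"] conjI DERIV_diff DERIV_symbol' DERIV_ident) auto
    qed
    then show ?thesis by (simp add: end0)
  qed
  have s3: "symbol N a \<theta> \<ge> \<theta>\<^sup>2 / 2" if "0 \<le> \<theta>" "\<theta> \<le> \<delta>" for \<theta>
  proof -
    have "symbol N a 0 - 0\<^sup>2 / 2 \<le> symbol N a \<theta> - \<theta>\<^sup>2 / 2"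
    proof (rule DERIV_nonneg_imp_nondecreasing[OF that(1)])
      fix x assume "0 \<le> x" "x \<le> \<theta>"
      then show "\<exists>y. ((\<lambda>x. symbol N a x - x\<^sup>2 / 2) has_real_derivative y) (at x) \<and> 0 \<le> y"
        using s2[of x] that by (intro exI[of _ "symbol' N a x - x"] conjI DERIV_diff DERIV_symbol)
          (auto intro!: derivative_eq_intros)
    qed
    then show ?thesis by (simp add: end0)
  qed
  \<comment> \<open>The first entry serves |\<theta>| \<le> \<delta>. Beyond \<delta>, monotonicity
    only gives A(\<theta>) \<ge> A(\<delta>) \<ge> \<delta>^2 / 2, and the second entry makes c *
    pi^2 no larger than that.\<close>
  define c where "c = min (1 / 2) (\<delta>\<^sup>2 / (2 * pi\<^sup>2))"
  have "c > 0" using \<delta> by (simp add: c_def)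
  moreover have "c * \<theta>\<^sup>2 \<le> symbol N a \<theta>" if "\<bar>\<theta>\<bar> \<le> pi" for \<theta>
  proof -
    have "c * \<bar>\<theta>\<bar>\<^sup>2 \<le> symbol N a \<bar>\<theta>\<bar>"
    proof (cases "\<bar>\<theta>\<bar> \<le> \<delta>")
      case True
      have "c * \<bar>\<theta>\<bar>\<^sup>2 \<le> 1 / 2 * \<bar>\<theta>\<bar>\<^sup>2" by (intro mult_right_mono) (auto simp: c_def)
      then show ?thesis using s3[of "\<bar>\<theta>\<bar>"] True by simp
    next
      case False
      have "c * \<bar>\<theta>\<bar>\<^sup>2 \<le> \<delta>\<^sup>2 / (2 * pi\<^sup>2) * pi\<^sup>2"
        using that by (intro mult_mono power_mono) (auto simp: c_def)
      also have "\<dots> = \<delta>\<^sup>2 / 2" by simp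
      also have "\<dots> \<le> symbol N a \<delta>" using s3[of \<delta>] \<delta> by simp
      also have "\<dots> \<le> symbol N a \<bar>\<theta>\<bar>" using mono[of \<delta> "\<bar>\<theta>\<bar>"] \<delta> False that by simp
      finally show ?thesis .
    qed
    then show ?thesis by (cases "\<theta> \<ge> 0") (simp_all add: symbol_minus)
  qed
  ultimately show ?thesis by (rule that)
qed

section \<open>The Green function as a Fourier integral\<close>

text \<open>The index J counts factors -A(\<theta>). Both a time derivative and an application of
  \<open>Laplace1\<close> raise it by one, which is the lattice equation at every order.\<close>

definition green_integrand :: "nat \<Rightarrow> (nat \<Rightarrow> real) \<Rightarrow> nat \<Rightarrow> int \<Rightarrow> real \<Rightarrow> real \<Rightarrow> complex" where
  "green_integrand N a J x t \<theta> =
     complex_of_real ((- symbol N a \<theta>) ^ J * exp (- (t * symbol N a \<theta>))) * iexp (real_of_int x * \<theta>)"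

definition green :: "nat \<Rightarrow> (nat \<Rightarrow> real) \<Rightarrow> nat \<Rightarrow> int \<Rightarrow> real \<Rightarrow> complex" where
  "green N a J x t = complex_of_real (1 / (2 * pi)) * integral {-pi..pi} (green_integrand N a J x t)"

lemma continuous_on_symbol [continuous_intros]:
  fixes f :: "'a::t2_space \<Rightarrow> real"
  assumes "continuous_on S f"
  shows "continuous_on S (\<lambda>x. symbol N a (f x))"
  unfolding symbol_def by (intro continuous_intros assms)

lemma continuous_green_integrand: "continuous_on S (green_integrand N a J x t)"
proof -
  have "continuous_on S (\<lambda>\<theta>. symbol N a \<theta>)" by (rule continuous_on_symbol) (rule continuous_on_id)
  then show ?thesis unfolding green_integrand_def by (intro continuous_intros)
qed

lemma green_integrand_integrable: "green_integrand N a J x t integrable_on {-pi..pi}"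
  by (rule integrable_continuous_interval[OF continuous_green_integrand])

lemma green_has_vector_derivative:
  "(green N a J x has_vector_derivative green N a (Suc J) x t) (at t)"
proof -
  have "((\<lambda>t. integral (cbox (-pi) pi) (green_integrand N a J x t)) has_vector_derivative
      integral (cbox (-pi) pi) (green_integrand N a (Suc J) x t)) (at t within UNIV)"
  proof (rule leibniz_rule_vector_derivative)
    fix s \<theta>
    show "((\<lambda>s. green_integrand N a J x s \<theta>) has_vector_derivative green_integrand N a (Suc J) x s \<theta>)
        (at s within UNIV)"
    proof -
      have "((\<lambda>s. (- symbol N a \<theta>) ^ J * exp (- (s * symbol N a \<theta>))) has_real_derivative
          (- symbol N a \<theta>) ^ Suc J * exp (- (s * symbol N a \<theta>))) (at s)"
        by (auto intro!: derivative_eq_intros)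
      then have "((\<lambda>s. complex_of_real ((- symbol N a \<theta>) ^ J * exp (- (s * symbol N a \<theta>)))) has_vector_derivative
          complex_of_real ((- symbol N a \<theta>) ^ Suc J * exp (- (s * symbol N a \<theta>)))) (at s)"
        by (intro has_vector_derivative_of_real) (simp add: has_real_derivative_iff_has_vector_derivative)
      then show ?thesis
        unfolding green_integrand_def by (rule has_vector_derivative_mult_left)
    qed
  next
    fix s show "green_integrand N a J x s integrable_on cbox (- pi) pi"
      using green_integrand_integrable by simp
  next
    show "continuous_on (UNIV \<times> cbox (- pi) pi) (\<lambda>(s, \<theta>). green_integrand N a (Suc J) x s \<theta>)"
      unfolding green_integrand_def split_def by (intro continuous_intros)
  qed auto
  then show ?thesis
    unfolding green_def[abs_def] by (intro has_vector_derivative_mult_right) simp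
qed

text \<open>The symbol is even, so reflecting \<theta> reflects x. This symmetry yields the
  antisymmetry of the gradient about x = -1/2.\<close>

lemma green_minus: "green N a J (- x) t = green N a J x t"
proof -
  have refl: "(\<lambda>\<theta>. green_integrand N a J x t (- \<theta>)) = green_integrand N a J (- x) t"
    by (simp add: fun_eq_iff green_integrand_def symbol_minus)
  have "(green_integrand N a J x t has_integral integral {-pi..pi} (green_integrand N a J x t)) {-pi..pi}"
    by (rule integrable_integral[OF green_integrand_integrable])
  then have "((\<lambda>\<theta>. green_integrand N a J x t (- \<theta>)) has_integral integral {-pi..pi} (green_integrand N a J x t)) {-pi..-(-pi)}"
    by (simp only: has_integral_reflect_real)
  then have "integral {-pi..pi} (green_integrand N a J (- x) t) = integral {-pi..pi} (green_integrand N a J x t)"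
    unfolding refl by (simp add: integral_unique)
  then show ?thesis by (simp add: green_def)
qed

lemma norm_green_le:
  "norm (green N a J x t) \<le> 1 / (2 * pi) * integral {-pi..pi} (\<lambda>\<theta>. \<bar>(- symbol N a \<theta>) ^ J * exp (- (t * symbol N a \<theta>))\<bar>)"
proof -
  have "norm (integral {-pi..pi} (green_integrand N a J x t))
     \<le> integral {-pi..pi} (\<lambda>\<theta>. \<bar>(- symbol N a \<theta>) ^ J * exp (- (t * symbol N a \<theta>))\<bar>)"
    by (rule integral_norm_bound_integral[OF green_integrand_integrable])
       (simp_all add: integrable_continuous_interval continuous_intros
          green_integrand_def norm_mult[of _ "iexp _"] del: of_real_mult of_real_power)
  then show ?thesis unfolding green_def norm_mult norm_of_real by (simp add: divide_right_mono)
qed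

lemma green_0_0: "green N a 0 x 0 = (if x = 0 then 1 else 0)"
proof (cases "x = 0")
  case True
  then have "green_integrand N a 0 x 0 = (\<lambda>_. 1)" by (simp add: fun_eq_iff green_integrand_def)
  then show ?thesis using True by (simp add: green_def scaleR_conv_of_real)
next
  case False
  define F where "F = (\<lambda>\<theta>. iexp (real_of_int x * \<theta>) / (\<i> * of_int x))"
  have "(green_integrand N a 0 x 0 has_integral F pi - F (-pi)) {-pi..pi}"
  proof (rule fundamental_theorem_of_calculus)
    fix \<theta>
    have "((\<lambda>z. exp (\<i> * (of_int x * z)) / (\<i> * of_int x)) has_field_derivative
        exp (\<i> * (of_int x * complex_of_real \<theta>))) (at (complex_of_real \<theta>))"
      using False by (auto intro!: derivative_eq_intros simp: mult.left_commute[of \<i> "exp _"])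
    then have "((\<lambda>\<theta>. exp (\<i> * (of_int x * complex_of_real \<theta>)) / (\<i> * of_int x)) has_vector_derivative
        exp (\<i> * (of_int x * complex_of_real \<theta>))) (at \<theta> within {-pi..pi})"
      by (rule has_vector_derivative_real_field)
    then show "(F has_vector_derivative green_integrand N a 0 x 0 \<theta>) (at \<theta> within {-pi..pi})"
      by (simp add: F_def green_integrand_def)
  qed simp
  moreover have "F pi - F (-pi) = 0"
  proof -
    have "iexp (real_of_int x * pi) = iexp (real_of_int x * (-pi))"
    proof -
      have "sin (real_of_int x * pi) = 0" by (subst sin_zero_iff_int2) blast
      then show ?thesis by (simp add: complex_eq_iff Re_exp Im_exp)
    qed
    then show ?thesis by (simp add: F_def)
  qed
  ultimately have "integral {-pi..pi} (green_integrand N a 0 x 0) = 0"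
    by (simp add: integral_unique)
  then show ?thesis using False by (simp add: green_def)
qed

lemma Laplace1_green: "Laplace1 N a (\<lambda>y. green N a J y t) x = green N a (Suc J) x t"
proof -
  have int: "green_integrand N a J y t integrable_on {-pi..pi}" for y
    by (rule green_integrand_integrable)
  have "green_integrand N a (Suc J) x t \<theta> = (\<Sum>\<nu>=1..N. complex_of_real (a \<nu>) *
      (green_integrand N a J (x - int \<nu>) t \<theta> - 2 * green_integrand N a J x t \<theta> + green_integrand N a J (x + int \<nu>) t \<theta>))" for \<theta>
  proof -
    define E where "E = complex_of_real ((- symbol N a \<theta>) ^ J * exp (- (t * symbol N a \<theta>))) * iexp (real_of_int x * \<theta>)"
    have step: "green_integrand N a J (x - int \<nu>) t \<theta> - 2 * green_integrand N a J x t \<theta> + green_integrand N a J (x + int \<nu>) t \<theta>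
       = - 2 * complex_of_real (1 - cos (real \<nu> * \<theta>)) * E" for \<nu>
    proof -
      \<comment> \<open>A shift by \<nu> multiplies the integrand by one of these, so the second
        difference multiplies it by p + q - 2 = - 2 (1 - cos (\<nu> \<theta>)).\<close>
      define p q where "p = iexp (- (real \<nu> * \<theta>))" and "q = iexp (real \<nu> * \<theta>)"
      have "iexp (real_of_int (x - int \<nu>) * \<theta>) = iexp (real_of_int x * \<theta>) * p"
        "iexp (real_of_int (x + int \<nu>) * \<theta>) = iexp (real_of_int x * \<theta>) * q"
        by (simp_all add: p_def q_def exp_add[symmetric] algebra_simps)
      then have "green_integrand N a J (x - int \<nu>) t \<theta> - 2 * green_integrand N a J x t \<theta> + green_integrand N a J (x + int \<nu>) t \<theta>
         = E * p - 2 * E + E * q"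
        unfolding green_integrand_def E_def by (simp only: mult.assoc)
      moreover have "p + q = 2 * complex_of_real (cos (real \<nu> * \<theta>))"
        by (simp add: p_def q_def complex_eq_iff Re_exp Im_exp)
      then have "E * p - 2 * E + E * q = E * (2 * complex_of_real (cos (real \<nu> * \<theta>)) - 2)"
        by (simp flip: distrib_left add: algebra_simps)
      ultimately show ?thesis by (simp add: algebra_simps)
    qed
    have "green_integrand N a (Suc J) x t \<theta> = - complex_of_real (symbol N a \<theta>) * E"
      by (simp add: green_integrand_def E_def)
    also have "\<dots> = (\<Sum>\<nu>=1..N. complex_of_real (a \<nu>) * (- 2 * complex_of_real (1 - cos (real \<nu> * \<theta>)) * E))"
    proof -
      have "complex_of_real (symbol N a \<theta>) = (\<Sum>\<nu>=1..N. 2 * (complex_of_real (a \<nu>) * complex_of_real (1 - cos (real \<nu> * \<theta>))))"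
        by (simp add: symbol_def sum_distrib_left)
      then show ?thesis
        unfolding sum_distrib_right sum_negf[symmetric]
        by (simp only: sum_negf[symmetric] sum_distrib_right) (rule sum.cong; simp add: algebra_simps)
    qed
    finally show ?thesis by (simp only: step)
  qed
  then have "integral {-pi..pi} (green_integrand N a (Suc J) x t) = integral {-pi..pi} (\<lambda>\<theta>. \<Sum>\<nu>=1..N. complex_of_real (a \<nu>) *
      (green_integrand N a J (x - int \<nu>) t \<theta> - 2 * green_integrand N a J x t \<theta> + green_integrand N a J (x + int \<nu>) t \<theta>))"
    by presburger
  also have "\<dots> = (\<Sum>\<nu>=1..N. complex_of_real (a \<nu>) * (integral {-pi..pi} (green_integrand N a J (x - int \<nu>) t)
      - 2 * integral {-pi..pi} (green_integrand N a J x t) + integral {-pi..pi} (green_integrand N a J (x + int \<nu>) t)))"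
    by (subst integral_sum) (auto intro!: integrable_on_mult_right integrable_add integrable_diff int
        simp: integral_add integral_diff int integrable_diff)
  finally show ?thesis
    by (simp add: Laplace1_def green_def sum_distrib_left algebra_simps)
qed

text \<open>The summand 1 only makes the constant strictly positive, as the generator bound of
  \<open>pointwise_bounded_flow\<close> has to be.\<close>

lemma norm_Laplace1_le:
  assumes "\<And>y. norm (f y) \<le> D"
  shows "norm (Laplace1 N a f x) \<le> (1 + 4 * (\<Sum>\<nu>=1..N. \<bar>a \<nu>\<bar>)) * D"
proof -
  have D: "D \<ge> 0" by (rule order_trans[OF norm_ge_zero assms])
  have "norm (Laplace1 N a f x) \<le> (\<Sum>\<nu>=1..N. norm (complex_of_real (a \<nu>) * (f (x - int \<nu>) - 2 * f x + f (x + int \<nu>))))"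
    unfolding Laplace1_def by (rule norm_sum)
  also have "\<dots> \<le> (\<Sum>\<nu>=1..N. \<bar>a \<nu>\<bar> * (4 * D))"
  proof (rule sum_mono)
    fix \<nu>
    have "norm (f (x - int \<nu>) - 2 * f x + f (x + int \<nu>)) \<le> norm (f (x - int \<nu>)) + 2 * norm (f x) + norm (f (x + int \<nu>))"
      by (rule order_trans[OF norm_triangle_ineq add_right_mono], rule order_trans[OF norm_triangle_ineq4])
         (simp add: norm_mult)
    also have "\<dots> \<le> 4 * D" using assms[of "x - int \<nu>"] assms[of x] assms[of "x + int \<nu>"] by linarith
    finally show "norm (complex_of_real (a \<nu>) * (f (x - int \<nu>) - 2 * f x + f (x + int \<nu>))) \<le> \<bar>a \<nu>\<bar> * (4 * D)"
      by (simp add: norm_mult mult_left_mono)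
  qed
  also have "\<dots> \<le> (1 + 4 * (\<Sum>\<nu>=1..N. \<bar>a \<nu>\<bar>)) * D"
    using D unfolding sum_distrib_right[symmetric] by (simp add: algebra_simps)
  finally show ?thesis .
qed

section \<open>Identification of the Green function with the Fourier integral\<close>

lemma rapidly_decreasing_bounded:
  assumes "rapidly_decreasing f"
  shows "\<exists>C. \<forall>x. norm (f x) \<le> C"
  using assms[unfolded rapidly_decreasing_def, rule_format, of 0] by auto

lemma has_vector_derivative_within_Un:
  assumes "(f has_vector_derivative D) (at x within S)" "(f has_vector_derivative D) (at x within T)"
  shows "(f has_vector_derivative D) (at x within (S \<union> T))"
  using assms unfolding has_vector_derivative_def has_derivative_within by (auto intro: Lim_Un)

lemma Laplace1_diff: "Laplace1 N a (\<lambda>y. f y - g y) x = Laplace1 N a f x - Laplace1 N a g x"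
  by (simp add: Laplace1_def algebra_simps sum_subtractf sum.distrib)

text \<open>The equation is given only for t > 0. At t = 0 both the derivative and the right-hand
  side are limits from the right, the latter because \<open>Laplace1\<close> is a finite sum of
  continuous functions.\<close>

lemma first_discrete_Green_derivative:
  assumes u: "first_discrete_Green N a u" and t: "t \<ge> 0"
  shows "(u x has_vector_derivative Laplace1 N a (\<lambda>y. u y t) x) (at t within {0..})"
proof -
  have "C1_halfline (u x)" using u by (simp add: first_discrete_Green_def)
  then obtain f' where f': "continuous_on {0..} f'"
    "\<And>t. t \<ge> 0 \<Longrightarrow> (u x has_vector_derivative f' t) (at t within {0..})"
    unfolding C1_halfline_def by blast
  have pos: "f' s = Laplace1 N a (\<lambda>y. u y s) x" if s: "s > 0" for s
  proof -
    have "(u x has_vector_derivative f' s) (at s within {0<..})"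
      using f'(2)[of s] s by (auto intro: has_vector_derivative_within_subset)
    then have "vector_derivative (u x) (at s) = f' s"
      using s by (intro vector_derivative_at) (simp add: at_within_open[of s "{0<..}"])
    then show ?thesis using u s by (simp add: first_discrete_Green_def)
  qed
  have cont: "continuous_on {0..} (u y)" for y
  proof -
    have "C1_halfline (u y)" using u by (simp add: first_discrete_Green_def)
    then obtain g where "\<forall>t\<ge>0. (u y has_vector_derivative g t) (at t within {0..})"
      unfolding C1_halfline_def by blast
    then show ?thesis
      by (auto simp: continuous_on_eq_continuous_within intro: has_vector_derivative_continuous)
  qed
  have "f' t = Laplace1 N a (\<lambda>y. u y t) x"
  proof (cases "t = 0")
    case True
    have nt: "at 0 within {0<..} \<noteq> (bot :: real filter)" by (rule trivial_limit_at_right_real)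
    have sub: "at 0 within {0<..} \<le> at (0::real) within {0..}" by (rule at_le) auto
    have "(f' \<longlongrightarrow> f' 0) (at_right 0)"
      by (rule tendsto_mono[OF sub]) (use f'(1) in \<open>simp add: continuous_on_def\<close>)
    moreover have "((\<lambda>s. Laplace1 N a (\<lambda>y. u y s) x) \<longlongrightarrow> Laplace1 N a (\<lambda>y. u y 0) x) (at_right 0)"
    proof -
      have "(u y \<longlongrightarrow> u y 0) (at_right 0)" for y
        by (rule tendsto_mono[OF sub]) (use cont[of y] in \<open>simp add: continuous_on_def\<close>)
      then show ?thesis unfolding Laplace1_def by (intro tendsto_intros)
    qed
    then have "(f' \<longlongrightarrow> Laplace1 N a (\<lambda>y. u y 0) x) (at_right 0)"
      by (rule Lim_transform_eventually) (simp add: eventually_at_filter pos)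
    ultimately have "f' 0 = Laplace1 N a (\<lambda>y. u y 0) x" by (rule tendsto_unique[OF nt])
    then show ?thesis using True by simp
  qed (use t pos in auto)
  then show ?thesis using f'(2)[OF t] by simp
qed

lemma first_discrete_Green_eq:
  assumes u: "first_discrete_Green N a u" and t: "t \<ge> 0"
  shows "u x t = green N a 0 x t"
proof -
  \<comment> \<open>The uniqueness result needs a flow on the whole real line. Extending the
    difference by 0 to negative times works because its slice at 0 vanishes: the right derivative
    there is the generator applied to 0, and it matches the left one.\<close>
  define w where "w = (\<lambda>x t. if t < 0 then 0 else u x t - green N a 0 x t)"
  define \<Lambda> where "\<Lambda> = Laplace1 N a"
  have init: "w x 0 = 0" for x
    using u by (simp add: w_def green_0_0 first_discrete_Green_def)
  have Lw: "\<Lambda> (\<lambda>y. w y t) x = (if t < 0 then 0 else Laplace1 N a (\<lambda>y. u y t) x - green N a (Suc 0) x t)" for x t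
  proof (cases "t < 0")
    case True
    then show ?thesis by (simp add: \<Lambda>_def w_def Laplace1_def)
  next
    case False
    then show ?thesis by (simp add: \<Lambda>_def w_def Laplace1_diff Laplace1_green)
  qed
  have right: "(w x has_vector_derivative \<Lambda> (\<lambda>y. w y t) x) (at t within {0..})" if t: "t \<ge> 0" for x t
  proof (rule has_vector_derivative_transform[where f = "\<lambda>t. u x t - green N a 0 x t"])
    show "((\<lambda>t. u x t - green N a 0 x t) has_vector_derivative \<Lambda> (\<lambda>y. w y t) x) (at t within {0..})"
      using t unfolding Lw
      by (auto intro!: has_vector_derivative_diff first_discrete_Green_derivative[OF u]
          has_vector_derivative_at_within[OF green_has_vector_derivative])
  qed (use t in \<open>auto simp: w_def\<close>)
  have left: "(w x has_vector_derivative 0) (at t within {..0})" if "t \<le> 0" for x t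
    by (rule has_vector_derivative_transform[where f = "\<lambda>t. 0"])
       (use that init in \<open>auto simp: w_def\<close>)
  interpret pointwise_bounded_flow w \<Lambda> "1 + 4 * (\<Sum>\<nu>=1..N. \<bar>a \<nu>\<bar>)"
  proof
    fix x and t :: real
    consider "t < 0" | "t = 0" | "t > 0" by linarith
    then show "(w x has_vector_derivative \<Lambda> (\<lambda>y. w y t) x) (at t)"
    proof cases
      case 1
      have "(w x has_vector_derivative 0) (at t within {..<0})"
        by (rule has_vector_derivative_within_subset[OF left]) (use 1 in auto)
      then show ?thesis using 1 by (simp add: Lw at_within_open[of t "{..<0}"])
    next
      case 2
      have "\<Lambda> (\<lambda>y. w y 0) x = 0" by (simp add: init \<Lambda>_def Laplace1_def)
      then have "(w x has_vector_derivative \<Lambda> (\<lambda>y. w y 0) x) (at 0 within ({0..} \<union> {..0}))"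
        using right[of 0 x] left[of 0 x] by (intro has_vector_derivative_within_Un) auto
      moreover have "{0..} \<union> {..0::real} = UNIV" by auto
      ultimately show ?thesis using 2 by simp
    next
      case 3
      have "(w x has_vector_derivative \<Lambda> (\<lambda>y. w y t) x) (at t within {0<..})"
        by (rule has_vector_derivative_within_subset[OF right]) (use 3 in auto)
      then show ?thesis using 3 by (simp add: at_within_open[of t "{0<..}"])
    qed
  next
    fix f :: "int \<Rightarrow> complex" and D x assume "\<And>y. norm (f y) \<le> D"
    then show "norm (\<Lambda> f x) \<le> (1 + 4 * (\<Sum>\<nu>=1..N. \<bar>a \<nu>\<bar>)) * D"
      unfolding \<Lambda>_def by (rule norm_Laplace1_le)
  next
    show "0 < 1 + 4 * (\<Sum>\<nu>=1..N. \<bar>a \<nu>\<bar>)" by (intro add_pos_nonneg mult_nonneg_nonneg sum_nonneg) auto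
  next
    fix t :: real
    show "\<exists>C. \<forall>x. norm (w x t) \<le> C"
    proof (cases "t < 0")
      case True
      then show ?thesis by (intro exI[of _ 0]) (simp add: w_def)
    next
      case False
      then have "rapidly_decreasing (\<lambda>x. u x t)" using u by (simp add: first_discrete_Green_def)
      then obtain C where C: "\<And>x. norm (u x t) \<le> C" using rapidly_decreasing_bounded by blast
      have "norm (w x t) \<le> C + 1 / (2 * pi) * integral {-pi..pi} (\<lambda>\<theta>. \<bar>(- symbol N a \<theta>) ^ 0 * exp (- (t * symbol N a \<theta>))\<bar>)" for x
        using False norm_triangle_ineq4[of "u x t" "green N a 0 x t"] C[of x] norm_green_le[of N a 0 x t]
        unfolding w_def by simp
      then show ?thesis by blast
    qed
  qed
  have "w x t = 0" by (rule flow_unique[OF init])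
  then show ?thesis using t by (simp add: w_def)
qed

lemma nth_deriv_grad_Green:
  assumes u: "first_discrete_Green N a u" and t: "t > 0"
  shows "nth_deriv J (grad u x) t = green N a J (x + 1) t - green N a J x t"
    and "(nth_deriv J (grad u x) has_vector_derivative green N a (Suc J) (x + 1) t - green N a (Suc J) x t) (at t)"
proof -
  let ?D = "\<lambda>k t. green N a k (x + 1) t - green N a k x t"
  have 1: "grad u x s = ?D 0 s" if "s \<in> {0<..}" for s
    using that by (simp add: grad_def first_discrete_Green_eq[OF u])
  have 2: "(?D k has_vector_derivative ?D (Suc k) s) (at s)" for k s
    by (intro has_vector_derivative_diff green_has_vector_derivative)
  show "nth_deriv J (grad u x) t = ?D J t"
    by (rule nth_deriv_eqI(1)[where S = "{0<..}" and D = ?D]) (use 1 2 t in auto)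
  show "(nth_deriv J (grad u x) has_vector_derivative ?D (Suc J) t) (at t)"
    by (rule nth_deriv_eqI(2)[where S = "{0<..}" and D = ?D]) (use 1 2 t in auto)
qed

section \<open>The coefficients of the expansion\<close>

unbundle no vec_syntax and fps_syntax

lemma map_poly_of_real_add:
  "map_poly complex_of_real (p + q) = map_poly complex_of_real p + map_poly complex_of_real q"
  by (simp add: poly_eq_iff coeff_map_poly)

lemma map_poly_of_real_mult:
  "map_poly complex_of_real (p * q) = map_poly complex_of_real p * map_poly complex_of_real q"
  by (simp add: poly_eq_iff coeff_map_poly coeff_mult)

lemma map_poly_of_real_sum:
  "map_poly complex_of_real (sum f A) = (\<Sum>i\<in>A. map_poly complex_of_real (f i))"
  by (induction A rule: infinite_finite_induct) (simp_all add: map_poly_of_real_add)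

text \<open>The series of B in the variable z = \<theta>^2, where A(\<theta>) = \<theta>^2 (1 -
  B(\<theta>)). It starts at order \<open>N\<close>, which is the order of the scheme.\<close>

definition beta_fps :: "nat \<Rightarrow> (nat \<Rightarrow> real) \<Rightarrow> complex fps" where
  "beta_fps N a = Abs_fps (\<lambda>n. if N \<le> n then complex_of_real (b_coeff N a n) else 0)"

definition compositions :: "nat \<Rightarrow> nat \<Rightarrow> nat \<Rightarrow> nat list set" where
  "compositions N n m = {ls. length ls = m \<and> (\<forall>l\<in>set ls. N \<le> l) \<and> sum_list ls = n}"

lemma finite_compositions: "finite (compositions N n m)"
proof (rule finite_subset)
  show "compositions N n m \<subseteq> {ls. set ls \<subseteq> {..n} \<and> length ls = m}"
    by (auto simp: compositions_def dest: member_le_sum_list)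
qed (rule finite_lists_length_eq, simp)

lemma compositions_0: "compositions N n 0 = (if n = 0 then {[]} else {})"
  by (auto simp: compositions_def)

lemma compositions_Suc:
  "compositions N n (Suc m) = (\<lambda>(i, ls). i # ls) ` (SIGMA i:{i\<in>{0..n}. N \<le> i}. compositions N (n - i) m)"
proof (rule set_eqI, rule iffI)
  fix ls assume ls: "ls \<in> compositions N n (Suc m)"
  then obtain i ls' where "ls = i # ls'" by (cases ls) (auto simp: compositions_def)
  then show "ls \<in> (\<lambda>(i, ls). i # ls) ` (SIGMA i:{i\<in>{0..n}. N \<le> i}. compositions N (n - i) m)"
    using ls by (intro image_eqI[of _ _ "(i, ls')"]) (auto simp: compositions_def)
qed (auto simp: compositions_def)

text \<open>Splitting off the first entry of a tuple is the Cauchy product with one more factor. The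
  combinatorial sums are thereby replaced by power series algebra.\<close>

lemma beta_fps_power_nth: "(beta_fps N a ^ m) $ n = complex_of_real (c_coeff N a n m)"
proof -
  have c: "c_coeff N a n m = (\<Sum>ls\<in>compositions N n m. prod_list (map (b_coeff N a) ls))" for n m
    by (simp add: c_coeff_def compositions_def)
  show ?thesis
  proof (induction m arbitrary: n)
    case 0
    then show ?case by (simp add: c compositions_0)
  next
    case (Suc m)
    have inj: "inj_on (\<lambda>(i, ls). i # ls) (SIGMA i:{i\<in>{0..n}. N \<le> i}. compositions N (n - i) m)"
      by (auto simp: inj_on_def)
    have "c_coeff N a n (Suc m) = (\<Sum>(i, ls)\<in>(SIGMA i:{i\<in>{0..n}. N \<le> i}. compositions N (n - i) m).
        b_coeff N a i * prod_list (map (b_coeff N a) ls))"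
      unfolding c compositions_Suc by (subst sum.reindex[OF inj]) (auto intro!: sum.cong)
    also have "\<dots> = (\<Sum>i\<in>{i\<in>{0..n}. N \<le> i}. \<Sum>ls\<in>compositions N (n - i) m. b_coeff N a i * prod_list (map (b_coeff N a) ls))"
      by (subst sum.Sigma) (auto simp: finite_compositions)
    also have "\<dots> = (\<Sum>i\<in>{i\<in>{0..n}. N \<le> i}. b_coeff N a i * c_coeff N a (n - i) m)"
      by (simp add: c sum_distrib_left)
    also have "\<dots> = (\<Sum>i=0..n. if N \<le> i then b_coeff N a i * c_coeff N a (n - i) m else 0)"
      by (rule sum.inter_filter) simp
    finally have "complex_of_real (c_coeff N a n (Suc m))
       = (\<Sum>i=0..n. beta_fps N a $ i * complex_of_real (c_coeff N a (n - i) m))"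
      by (auto simp: beta_fps_def intro!: sum.cong)
    then show ?case by (simp add: fps_mult_nth Suc.IH)
  qed
qed

lemma c_coeff_0: "c_coeff N a n 0 = (if n = 0 then 1 else 0)"
  using beta_fps_power_nth[of N a 0 n] by (auto split: if_splits)

lemma c_coeff_eq_0:
  assumes "n < N * m"
  shows "c_coeff N a n m = 0"
proof -
  have "N * length ls \<le> sum_list ls" if "\<forall>l\<in>set ls. N \<le> l" for ls
    using that by (induction ls) auto
  then have "compositions N n m = {}" using assms by (fastforce simp: compositions_def)
  then show ?thesis by (simp add: c_coeff_def flip: compositions_def)
qed

text \<open>A tuple of m entries \<ge> N has sum \<ge> N * m, so a long enough sum over m stops at n
  div N by itself. The term m = 0, absent from the sums defining \<open>P_poly\<close> and
  \<open>d_coeff\<close>, is present only for n = 0.\<close>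

lemma sum_c_coeff:
  fixes f :: "nat \<Rightarrow> 'b::real_vector"
  assumes N: "N \<ge> 1" and M: "M > n"
  shows "(\<Sum>m<M. c_coeff N a n m *\<^sub>R f m)
       = (if n = 0 then f 0 else 0) + (\<Sum>m=1..n div N. c_coeff N a n m *\<^sub>R f m)"
proof -
  have "n div N < M" using M by (meson div_le_dividend le_less_trans)
  then have sub: "{0..n div N} \<subseteq> {..<M}" by auto
  have "(\<Sum>m<M. c_coeff N a n m *\<^sub>R f m) = (\<Sum>m=0..n div N. c_coeff N a n m *\<^sub>R f m)"
  proof (rule sum.mono_neutral_right)
    show "\<forall>m\<in>{..<M} - {0..n div N}. c_coeff N a n m *\<^sub>R f m = 0"
    proof
      fix m assume "m \<in> {..<M} - {0..n div N}"
      then have "n < N * m" using N by (simp add: not_le div_less_iff_less_mult mult.commute)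
      then show "c_coeff N a n m *\<^sub>R f m = 0" by (simp add: c_coeff_eq_0)
    qed
  qed (use sub in auto)
  also have "\<dots> = c_coeff N a n 0 *\<^sub>R f 0 + (\<Sum>m=1..n div N. c_coeff N a n m *\<^sub>R f m)"
    by (simp add: sum.atLeast_Suc_atMost)
  finally show ?thesis by (simp add: c_coeff_0)
qed

lemma one_minus_beta_power_nth:
  assumes N: "N \<ge> 1"
  shows "((1 - beta_fps N a) ^ J) $ s = complex_of_real ((if s = 0 then 1 else 0) + d_coeff N a J s)"
proof -
  define f where "f = (\<lambda>m. (-1) ^ m * real (J choose m))"
  \<comment> \<open>Beyond both cut-offs: the binomial coefficients vanish past J and the
    c-coefficients past s div N, so both sums are restrictions of this one.\<close>
  define M where "M = Suc (max s J)"
  have "(1 - beta_fps N a) ^ J = (\<Sum>m\<le>J. of_nat (J choose m) * (- beta_fps N a) ^ m * 1 ^ (J - m))"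
    using binomial_ring[of "- beta_fps N a" 1 J] by simp
  also have "\<dots> $ s = (\<Sum>m\<le>J. complex_of_real (c_coeff N a s m *\<^sub>R f m))"
    unfolding fps_sum_nth
  proof (rule sum.cong)
    fix m
    have "of_nat (J choose m) * (- beta_fps N a) ^ m * 1 ^ (J - m)
       = fps_const (complex_of_real (f m)) * beta_fps N a ^ m"
    proof -
      have neg: "- beta_fps N a = fps_const (-1) * beta_fps N a" by (simp add: fps_eq_iff)
      have f: "complex_of_real (f m) = of_nat (J choose m) * (-1) ^ m" by (simp add: f_def mult.commute)
      show ?thesis
        unfolding neg power_mult_distrib fps_const_power fps_of_nat[symmetric] power_one f
        by (simp only: mult.assoc[symmetric] fps_const_mult mult_1_right)
    qed
    then show "(of_nat (J choose m) * (- beta_fps N a) ^ m * 1 ^ (J - m)) $ s = complex_of_real (c_coeff N a s m *\<^sub>R f m)"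
      by (simp add: beta_fps_power_nth)
  qed simp
  also have "\<dots> = complex_of_real (\<Sum>m<M. c_coeff N a s m *\<^sub>R f m)"
  proof -
    have "(\<Sum>m\<le>J. c_coeff N a s m *\<^sub>R f m) = (\<Sum>m<M. c_coeff N a s m *\<^sub>R f m)"
      by (rule sum.mono_neutral_left) (auto simp: M_def f_def)
    then show ?thesis by (simp only: of_real_sum[symmetric])
  qed
  also have "(\<Sum>m<M. c_coeff N a s m *\<^sub>R f m) = (if s = 0 then f 0 else 0) + (\<Sum>m=1..s div N. c_coeff N a s m *\<^sub>R f m)"
    by (rule sum_c_coeff[OF N]) (simp add: M_def)
  also have "(\<Sum>m=1..s div N. c_coeff N a s m *\<^sub>R f m) = d_coeff N a J s"
    unfolding d_coeff_def
    by (rule sum.mono_neutral_cong_right) (auto simp: f_def)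
  finally show ?thesis by (simp add: f_def)
qed

lemma poly_P_poly:
  "poly (map_poly complex_of_real (P_poly N a n)) x
     = (\<Sum>m=1..n div N. c_coeff N a n m *\<^sub>R (x ^ (2 * (n + m)) / fact m))"
  by (simp add: P_poly_def map_poly_of_real_sum map_poly_monom poly_sum poly_monom scaleR_conv_of_real)

lemma P_poly_eq_0: "n < N \<Longrightarrow> P_poly N a n = 0"
  by (simp add: P_poly_def)

lemma d_coeff_eq_0: "n < N \<Longrightarrow> d_coeff N a J n = 0"
  by (simp add: d_coeff_def)

text \<open>Since \<open>d_coeff\<close> and \<open>P_poly\<close> vanish below index N, the
  restricted sum is a full Cauchy product; this also accounts for the value 0 when s < 2 *
  N.\<close>

lemma poly_Q_poly:
  "poly (map_poly complex_of_real (Q_poly N a J s)) x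
     = (\<Sum>i=0..s. poly (map_poly complex_of_real (P_poly N a i)) x * (complex_of_real (d_coeff N a J (s - i)) * x ^ (2 * (s - i))))"
proof -
  define T where "T = (\<lambda>(l1, l2). complex_of_real (d_coeff N a J l1) * x ^ (2 * l1) * poly (map_poly complex_of_real (P_poly N a l2)) x)"
  define S where "S = {(l1, l2). N \<le> l1 \<and> N \<le> l2 \<and> l1 + l2 = s}"
  have fin: "finite S" by (rule finite_subset[of _ "{..s} \<times> {..s}"]) (auto simp: S_def)
  have T0: "T (l1, l2) = 0" if "l1 < N \<or> l2 < N" for l1 l2
    using that by (auto simp: T_def P_poly_eq_0 d_coeff_eq_0)
  have "poly (map_poly complex_of_real (Q_poly N a J s)) x = (\<Sum>p\<in>S. T p)"
  proof (cases "s < 2 * N")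
    case True
    then have "S = {}" by (auto simp: S_def)
    then show ?thesis using True by (simp add: Q_poly_def)
  next
    case False
    then show ?thesis
      unfolding Q_poly_def S_def[symmetric]
      by (auto simp: T_def map_poly_of_real_sum map_poly_of_real_mult map_poly_monom poly_sum poly_monom split_def
            intro!: sum.cong)
  qed
  also have "\<dots> = (\<Sum>p\<in>(\<lambda>i. (s - i, i)) ` {0..s}. T p)"
    by (rule sum.mono_neutral_left) (auto simp: S_def image_iff not_le intro!: T0)
  also have "\<dots> = (\<Sum>i=0..s. T (s - i, i))"
    by (subst sum.reindex) (auto simp: inj_on_def)
  finally show ?thesis by (simp add: T_def mult_ac)
qed

text \<open>The coefficient of \<open>t\<^sup>-\<^sup>s\<close> in \<open>(1 - B)\<^sup>J exp (\<xi>\<^sup>2 B)\<close>.\<close>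

lemma expansion_coefficient:
  assumes N: "N \<ge> 1" and M: "M > s"
  shows "x ^ (2 * s) * (\<Sum>m<M. x ^ (2 * m) / fact m * ((beta_fps N a ^ m * (1 - beta_fps N a) ^ J) $ s))
    = (if s = 0 then 1 else 0) + poly (map_poly complex_of_real
        (monom (d_coeff N a J s) (2 * s) + P_poly N a s + Q_poly N a J s)) x"
proof -
  define P where "P = (\<lambda>i. poly (map_poly complex_of_real (P_poly N a i)) x)"
  define D where "D = (\<lambda>i. complex_of_real (d_coeff N a J i) * x ^ (2 * i))"
  define e :: "nat \<Rightarrow> complex" where "e = (\<lambda>i. if i = 0 then 1 else 0)"
  have P: "(\<Sum>m<M. complex_of_real (c_coeff N a i m) * (x ^ (2 * (i + m)) / fact m)) = e i + P i" if "i \<le> s" for i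
    using sum_c_coeff[OF N, of i M a "\<lambda>m. x ^ (2 * (i + m)) / fact m"] that M
    by (auto simp: P_def poly_P_poly e_def scaleR_conv_of_real)
  have D: "x ^ (2 * i) * ((1 - beta_fps N a) ^ J) $ i = e i + D i" for i
    by (auto simp: one_minus_beta_power_nth[OF N] D_def e_def algebra_simps)
  have "x ^ (2 * s) * (\<Sum>m<M. x ^ (2 * m) / fact m * ((beta_fps N a ^ m * (1 - beta_fps N a) ^ J) $ s))
    = (\<Sum>m<M. \<Sum>i=0..s. x ^ (2 * s) * (x ^ (2 * m) / fact m * (complex_of_real (c_coeff N a i m) * ((1 - beta_fps N a) ^ J) $ (s - i))))"
    by (simp add: fps_mult_nth sum_distrib_left beta_fps_power_nth)
  also have "\<dots> = (\<Sum>i=0..s. \<Sum>m<M. (complex_of_real (c_coeff N a i m) * (x ^ (2 * (i + m)) / fact m)) * (x ^ (2 * (s - i)) * ((1 - beta_fps N a) ^ J) $ (s - i)))"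
  proof (subst sum.swap, intro sum.cong refl)
    fix i m assume "i \<in> {0..s}"
    then have "x ^ (2 * s) = x ^ (2 * i) * x ^ (2 * (s - i))"
      by (simp only: power_mult power_add[symmetric] le_add_diff_inverse atLeastAtMost_iff)
    then show "x ^ (2 * s) * (x ^ (2 * m) / fact m * (complex_of_real (c_coeff N a i m) * ((1 - beta_fps N a) ^ J) $ (s - i)))
      = (complex_of_real (c_coeff N a i m) * (x ^ (2 * (i + m)) / fact m)) * (x ^ (2 * (s - i)) * ((1 - beta_fps N a) ^ J) $ (s - i))"
      by (simp add: power_add distrib_left)
  qed
  \<comment> \<open>The first factor comes from the exponential and the second from (1 - B)^J;
    \<open>e\<close> is the unit of convolution. Expanding the product gives the constant 1, the
    d-term, the P-term and, from P times D, the polynomial Q.\<close>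
  also have "\<dots> = (\<Sum>i=0..s. (e i + P i) * (e (s - i) + D (s - i)))"
    unfolding sum_distrib_right[symmetric] D by (intro sum.cong refl arg_cong2[where f = "(*)"] P) simp
  also have "\<dots> = (\<Sum>i=0..s. e i * e (s - i)) + (\<Sum>i=0..s. e i * D (s - i)) + (\<Sum>i=0..s. P i * e (s - i)) + (\<Sum>i=0..s. P i * D (s - i))"
    by (simp add: algebra_simps sum.distrib)
  also have "(\<Sum>i=0..s. e i * e (s - i)) = e s"
    by (simp add: e_def if_distrib[of "\<lambda>c. c * _"] sum.delta cong: if_cong)
  also have "(\<Sum>i=0..s. e i * D (s - i)) = D s"
    by (simp add: e_def if_distrib[of "\<lambda>c. c * _"] sum.delta cong: if_cong)
  also have "(\<Sum>i=0..s. P i * e (s - i)) = P s"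
  proof -
    have "(\<Sum>i=0..s. P i * e (s - i)) = (\<Sum>i=0..s. if i = s then P i else 0)"
      by (intro sum.cong) (auto simp: e_def)
    then show ?thesis by (simp add: sum.delta)
  qed
  also have "(\<Sum>i=0..s. P i * D (s - i)) = poly (map_poly complex_of_real (Q_poly N a J s)) x"
    by (simp add: poly_Q_poly P_def D_def)
  finally show ?thesis
    by (simp add: e_def P_def D_def map_poly_of_real_add map_poly_monom poly_monom add_ac)
qed

section \<open>The joint expansion in \<theta> and \<xi>, and its match with
  \<open>g_fun\<close>\<close>

definition defect_fps :: "nat \<Rightarrow> (nat \<Rightarrow> real) \<Rightarrow> complex fps" where
  "defect_fps N a = beta_fps N a oo fps_X ^ 2"

lemma fps_compose_X_square_nth:
  "(F oo fps_X ^ 2) $ n = (if even n then F $ (n div 2) else (0 :: 'a :: comm_ring_1))"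
proof -
  have "(F oo fps_X ^ 2) $ n = (\<Sum>i=0..n. F $ i * (if n = 2 * i then 1 else 0))"
    by (simp add: fps_compose_nth power_mult[symmetric] fps_X_power_nth)
  also have "\<dots> = (\<Sum>i=0..n. if i = n div 2 then (if even n then F $ i else 0) else 0)"
    by (intro sum.cong) auto
  finally show ?thesis by (simp add: sum.delta)
qed

lemma defect_fps_power:
  "defect_fps N a ^ m * (1 - defect_fps N a) ^ J
     = (beta_fps N a ^ m * (1 - beta_fps N a) ^ J) oo fps_X ^ 2"
proof -
  have X: "fps_nth (fps_X ^ 2 :: complex fps) 0 = 0" by simp
  have "1 - (beta_fps N a oo fps_X ^ 2) = (1 - beta_fps N a) oo fps_X ^ 2"
    by (simp add: fps_compose_sub_distrib)
  then show ?thesis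
    by (simp only: defect_fps_def fps_compose_power[OF X] fps_compose_mult_distrib[OF X])
qed

text \<open>The Taylor series in \<theta> of what multiplies w^m / m! once exp (w B) is expanded
  with w = \<xi>^2 held fixed.\<close>

definition expansion_fps :: "nat \<Rightarrow> (nat \<Rightarrow> real) \<Rightarrow> nat \<Rightarrow> nat \<Rightarrow> complex fps" where
  "expansion_fps N a J m = defect_fps N a ^ m * (1 - defect_fps N a) ^ J * (fps_exp \<i> - 1)"

text \<open>The coefficient of \<tau>^k after substituting \<theta> = \<tau> \<xi> and w = \<xi>^2,
  Gaussian factor excluded. \<open>M\<close> is the cut-off of the exponential series.\<close>

definition expansion_poly :: "nat \<Rightarrow> (nat \<Rightarrow> real) \<Rightarrow> nat \<Rightarrow> nat \<Rightarrow> nat \<Rightarrow> complex poly" where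
  "expansion_poly N a J M k = monom ((-1) ^ J) (2 * J + k) *
     (\<Sum>m<M. monom (expansion_fps N a J m $ k / fact m) (2 * m))"

text \<open>Powers of B contribute even exponents 2 * s only, and exp (i \<theta>) - 1 has no
  constant term, hence the strict inequality 2 * s < k.\<close>

lemma expansion_fps_nth:
  "expansion_fps N a J m $ k = (\<Sum>s | 2 * s < k. (beta_fps N a ^ m * (1 - beta_fps N a) ^ J) $ s * (\<i> ^ (k - 2 * s) / fact (k - 2 * s)))"
proof -
  define W where "W = beta_fps N a ^ m * (1 - beta_fps N a) ^ J"
  have e: "(fps_exp \<i> - 1) $ j = (if j = 0 then 0 else \<i> ^ j / fact j)" for j
    by simp
  have "expansion_fps N a J m $ k = (\<Sum>i=0..k. (if even i then W $ (i div 2) else 0) * (if k - i = 0 then 0 else \<i> ^ (k - i) / fact (k - i)))"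
    unfolding expansion_fps_def defect_fps_power fps_mult_nth[of _ "fps_exp \<i> - 1"] fps_compose_X_square_nth e W_def ..
  also have "\<dots> = (\<Sum>i\<in>(\<lambda>s. 2 * s) ` {s. 2 * s < k}. W $ (i div 2) * (\<i> ^ (k - i) / fact (k - i)))"
  proof (rule sum.mono_neutral_cong_right)
    show "\<forall>i\<in>{0..k} - (\<lambda>s. 2 * s) ` {s. 2 * s < k}. (if even i then W $ (i div 2) else 0) * (if k - i = 0 then 0 else \<i> ^ (k - i) / fact (k - i)) = 0"
      by (auto elim!: evenE)
  qed auto
  also have "\<dots> = (\<Sum>s | 2 * s < k. W $ s * (\<i> ^ (k - 2 * s) / fact (k - 2 * s)))"
    by (subst sum.reindex) (auto simp: inj_on_def)
  finally show ?thesis by (simp add: W_def)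
qed

text \<open>With k \<le> M every s with 2 * s < k lies below M, so cutting the exponential series at
  M does not alter the coefficient.\<close>

lemma poly_expansion_poly:
  assumes N: "N \<ge> 1" and k: "k \<le> M"
  shows "poly (expansion_poly N a J M k) x = (-1) ^ J * x ^ (2 * J) *
    (\<Sum>s | 2 * s < k. (\<i> * x) ^ (k - 2 * s) / fact (k - 2 * s) *
       ((if s = 0 then 1 else 0) + poly (map_poly complex_of_real
        (monom (d_coeff N a J s) (2 * s) + P_poly N a s + Q_poly N a J s)) x))"
proof -
  define W where "W = (\<lambda>m s. (beta_fps N a ^ m * (1 - beta_fps N a) ^ J) $ s)"
  have "poly (expansion_poly N a J M k) x = (-1) ^ J * x ^ (2 * J) *
     (\<Sum>m<M. x ^ k * (x ^ (2 * m) / fact m) * (\<Sum>s | 2 * s < k. W m s * (\<i> ^ (k - 2 * s) / fact (k - 2 * s))))"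
  proof -
    define c where "c = (\<lambda>m. \<Sum>s | 2 * s < k. W m s * (\<i> ^ (k - 2 * s) / fact (k - 2 * s)))"
    have "expansion_fps N a J m $ k = c m" for m by (simp add: expansion_fps_nth c_def W_def)
    then have "poly (expansion_poly N a J M k) x = (-1) ^ J * x ^ (2 * J) * (\<Sum>m<M. x ^ k * (x ^ (2 * m) / fact m) * c m)"
      by (simp add: expansion_poly_def poly_sum poly_monom power_add sum_distrib_left mult_ac)
    then show ?thesis by (simp only: c_def)
  qed
  also have "(\<Sum>m<M. x ^ k * (x ^ (2 * m) / fact m) * (\<Sum>s | 2 * s < k. W m s * (\<i> ^ (k - 2 * s) / fact (k - 2 * s))))
    = (\<Sum>s | 2 * s < k. (\<i> * x) ^ (k - 2 * s) / fact (k - 2 * s) * (x ^ (2 * s) * (\<Sum>m<M. x ^ (2 * m) / fact m * W m s)))"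
    unfolding sum_distrib_left
  proof (subst sum.swap, intro sum.cong refl)
    fix s m assume "s \<in> {s. 2 * s < k}"
    then have "x ^ k = x ^ (k - 2 * s) * x ^ (2 * s)" by (simp flip: power_add)
    then show "x ^ k * (x ^ (2 * m) / fact m) * (W m s * (\<i> ^ (k - 2 * s) / fact (k - 2 * s)))
       = (\<i> * x) ^ (k - 2 * s) / fact (k - 2 * s) * (x ^ (2 * s) * (x ^ (2 * m) / fact m * W m s))"
      by (simp add: power_mult_distrib mult_ac)
  qed
  also have "\<dots> = (\<Sum>s | 2 * s < k. (\<i> * x) ^ (k - 2 * s) / fact (k - 2 * s) *
       ((if s = 0 then 1 else 0) + poly (map_poly complex_of_real
        (monom (d_coeff N a J s) (2 * s) + P_poly N a s + Q_poly N a J s)) x))"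
    unfolding W_def by (intro sum.cong refl arg_cong2[where f = "(*)"] expansion_coefficient[OF N]) (use k in auto)
  finally show ?thesis .
qed

text \<open>Both sides are Gaussian transforms, so it suffices to compare polynomials pointwise:
  with k = n + 1 the index j is n + 1 - 2 * s, s = 0 gives the term with
  \<open>h_fun N a J 0\<close>, and 0 < s < N gives nothing.\<close>

lemma g_fun_eq:
  assumes N: "N \<ge> 1" and n: "n < M"
  shows "g_fun N a J n y = gauss_transform (expansion_poly N a J M (n + 1)) y"
proof -
  define R where "R = (\<lambda>s. map_poly complex_of_real (R_poly N a J s))"
  define A where "A = {(s, j). N \<le> s \<and> 1 \<le> j \<and> 2 * s + j - 1 = n}"
  have A: "A = (\<lambda>s. (s, n + 1 - 2 * s)) ` {s. N \<le> s \<and> 2 * s < n + 1}" by (auto simp: A_def image_iff)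
  have h0: "h_fun N a J 0 = nth_deriv (2 * J) h" by (simp add: h_fun_def)
  have hs: "h_fun N a J s = gauss_transform (R s)" if "s \<ge> N" for s
    using that N by (simp add: h_fun_def poly_diff_op_h R_def)
  have "g_fun N a J n y = 1 / fact (n + 1) * gauss_transform ([:0, \<i>:] ^ (n + 1 + 2 * J)) y
     + (\<Sum>(s, j)\<in>A. 1 / fact j * nth_deriv j (h_fun N a J s) y)"
    by (simp only: g_fun_def A_def h0 nth_deriv_add) (simp only: nth_deriv_h)
  also have "(\<Sum>(s, j)\<in>A. 1 / fact j * nth_deriv j (h_fun N a J s) y)
     = (\<Sum>s | N \<le> s \<and> 2 * s < n + 1. 1 / fact (n + 1 - 2 * s) * nth_deriv (n + 1 - 2 * s) (h_fun N a J s) y)"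
    unfolding A by (subst sum.reindex) (auto simp: inj_on_def)
  also have "\<dots> = (\<Sum>s | N \<le> s \<and> 2 * s < n + 1. 1 / fact (n + 1 - 2 * s) * gauss_transform ([:0, \<i>:] ^ (n + 1 - 2 * s) * R s) y)"
    by (intro sum.cong) (auto simp: hs nth_deriv_gauss_transform)
  finally have g: "g_fun N a J n y = gauss_transform (smult (1 / fact (n + 1)) ([:0, \<i>:] ^ (n + 1 + 2 * J))
     + (\<Sum>s | N \<le> s \<and> 2 * s < n + 1. smult (1 / fact (n + 1 - 2 * s)) ([:0, \<i>:] ^ (n + 1 - 2 * s) * R s))) y"
    by (simp only: gauss_transform_add gauss_transform_sum gauss_transform_smult)
  have "poly (smult (1 / fact (n + 1)) ([:0, \<i>:] ^ (n + 1 + 2 * J))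
     + (\<Sum>s | N \<le> s \<and> 2 * s < n + 1. smult (1 / fact (n + 1 - 2 * s)) ([:0, \<i>:] ^ (n + 1 - 2 * s) * R s))) x
     = poly (expansion_poly N a J M (n + 1)) x" for x
  proof -
    define E where "E = (\<lambda>s. poly (map_poly complex_of_real (monom (d_coeff N a J s) (2 * s) + P_poly N a s + Q_poly N a J s)) x)"
    define F where "F = (\<lambda>j. (\<i> * x) ^ j / fact j)"
    have E0: "E s = 0" if "s < N" for s
      using that N by (simp add: E_def P_poly_eq_0 d_coeff_eq_0 Q_poly_def)
    have R: "poly (R s) x = (-1) ^ J * x ^ (2 * J) * E s" for s
      by (simp add: R_def R_poly_def E_def map_poly_of_real_mult map_poly_monom poly_monom)
    have fin: "finite {s. 2 * s < n + 1}" by (rule finite_subset[of _ "{..n}"]) auto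
    have "poly (expansion_poly N a J M (n + 1)) x = (-1) ^ J * x ^ (2 * J) *
       (\<Sum>s | 2 * s < n + 1. F (n + 1 - 2 * s) * ((if s = 0 then 1 else 0) + E s))"
      using n by (simp only: poly_expansion_poly[OF N, of "n + 1" M] E_def F_def)
    also have "(\<Sum>s | 2 * s < n + 1. F (n + 1 - 2 * s) * ((if s = 0 then 1 else 0) + E s))
       = (\<Sum>s | 2 * s < n + 1. if s = 0 then F (n + 1 - 2 * s) else 0) + (\<Sum>s | 2 * s < n + 1. F (n + 1 - 2 * s) * E s)"
      unfolding sum.distrib[symmetric] by (intro sum.cong) (auto simp: algebra_simps)
    also have "(\<Sum>s | 2 * s < n + 1. if s = 0 then F (n + 1 - 2 * s) else 0) = F (n + 1)"
      using fin by (simp add: sum.delta)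
    also have "(\<Sum>s | 2 * s < n + 1. F (n + 1 - 2 * s) * E s) = (\<Sum>s | N \<le> s \<and> 2 * s < n + 1. F (n + 1 - 2 * s) * E s)"
      by (rule sum.mono_neutral_right) (use fin E0 in \<open>auto intro: leI\<close>)
    finally have e: "poly (expansion_poly N a J M (n + 1)) x = (-1) ^ J * x ^ (2 * J) * F (n + 1)
       + (\<Sum>s | N \<le> s \<and> 2 * s < n + 1. F (n + 1 - 2 * s) * ((-1) ^ J * x ^ (2 * J) * E s))"
      by (simp add: distrib_left sum_distrib_left mult_ac)
    \<comment> \<open>The derivatives of order 2 * J in the leading term supply the same prefactor
      that \<open>R_poly\<close> carries explicitly.\<close>
    have ix: "(\<i> * x) ^ (2 * J) = (-1) ^ J * x ^ (2 * J)"
      by (simp only: power_mult_distrib power_mult power2_i)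
    have "poly (smult (1 / fact (n + 1)) ([:0, \<i>:] ^ (n + 1 + 2 * J))
     + (\<Sum>s | N \<le> s \<and> 2 * s < n + 1. smult (1 / fact (n + 1 - 2 * s)) ([:0, \<i>:] ^ (n + 1 - 2 * s) * R s))) x
     = (\<i> * x) ^ (2 * J) * F (n + 1) + (\<Sum>s | N \<le> s \<and> 2 * s < n + 1. F (n + 1 - 2 * s) * poly (R s) x)"
      unfolding F_def power_add[of "[:0, \<i>:]" "n + 1"] by (simp add: poly_sum mult_ac del: fact_Suc power_Suc)
    then show ?thesis unfolding e R ix .
  qed
  then have "smult (1 / fact (n + 1)) ([:0, \<i>:] ^ (n + 1 + 2 * J))
     + (\<Sum>s | N \<le> s \<and> 2 * s < n + 1. smult (1 / fact (n + 1 - 2 * s)) ([:0, \<i>:] ^ (n + 1 - 2 * s) * R s))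
     = expansion_poly N a J M (n + 1)"
    by (intro poly_eq_poly_eq_iff[THEN iffD1] ext)
  then show ?thesis using g by simp
qed

lemma expansion_poly_0: "expansion_poly N a J M 0 = 0"
proof -
  have "expansion_fps N a J m $ 0 = 0" for m by (simp add: expansion_fps_nth)
  then show ?thesis by (simp add: expansion_poly_def)
qed

text \<open>Since s \<ge> 1 and j \<ge> 1 force n \<ge> 2, the sum in \<open>g_fun\<close> is empty
  for n = 0 and n = 1. The two leading terms of the expansion are thus values of the same formula,
  and all orders can be treated alike.\<close>

lemma g_fun_0:
  assumes "N \<ge> 1" shows "g_fun N a J 0 y = nth_deriv (2 * J + 1) h y"
proof -
  have *: "{(s, j). N \<le> s \<and> 1 \<le> j \<and> 2 * s + j - 1 = (0::nat)} = {}" using assms by auto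
  show ?thesis unfolding g_fun_def * by (simp add: h_fun_def nth_deriv_add add.commute)
qed

lemma g_fun_1:
  assumes "N \<ge> 1" shows "g_fun N a J 1 y = 1 / 2 * nth_deriv (2 * J + 2) h y"
proof -
  have *: "{(s, j). N \<le> s \<and> 1 \<le> j \<and> 2 * s + j - 1 = (1::nat)} = {}" using assms by auto
  show ?thesis unfolding g_fun_def * by (simp add: h_fun_def nth_deriv_add add.commute)
qed

section \<open>Taylor expansion of the integrand\<close>

text \<open>Near 0 the remainder is z^M times the analytic function given by the shifted series,
  which is bounded there by continuity.\<close>

lemma has_fps_expansion_remainder:
  fixes f :: "complex \<Rightarrow> complex"
  assumes "f has_fps_expansion F"
  shows "\<exists>\<delta> C. \<delta> > 0 \<and> (\<forall>z. norm z < \<delta> \<longrightarrow> norm (f z - (\<Sum>k<M. F $ k * z ^ k)) \<le> C * norm z ^ M)"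
proof -
  define G where "G = fps_shift M F"
  have G: "fps_conv_radius G > 0" using assms by (simp add: G_def has_fps_expansion_def)
  define f' where "f' = (\<lambda>z. z ^ M * eval_fps G z + (\<Sum>k<M. F $ k * z ^ k))"
  have "f' has_fps_expansion fps_X ^ M * G + (\<Sum>k<M. fps_const (F $ k) * fps_X ^ k)"
    unfolding f'_def by (intro fps_expansion_intros eval_fps_has_fps_expansion G)
  also have "fps_X ^ M * G + (\<Sum>k<M. fps_const (F $ k) * fps_X ^ k) = F"
  proof (rule fps_ext)
    fix n
    have "(\<Sum>k<M. fps_const (F $ k) * fps_X ^ k) $ n = (\<Sum>k<M. if k = n then F $ k else 0)"
      unfolding fps_sum_nth by (intro sum.cong) (auto simp: fps_X_power_nth)
    then show "(fps_X ^ M * G + (\<Sum>k<M. fps_const (F $ k) * fps_X ^ k)) $ n = F $ n"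
      by (auto simp: fps_X_power_mult_nth G_def sum.delta)
  qed
  finally have "\<forall>\<^sub>F z in nhds 0. f z = f' z"
    using assms unfolding has_fps_expansion_def by (auto elim: eventually_elim2)
  moreover have "\<forall>\<^sub>F z in nhds 0. norm (eval_fps G z) < norm (eval_fps G 0) + 1"
  proof -
    have "isCont (eval_fps G) 0"
      using has_fps_expansion_imp_continuous[OF eval_fps_has_fps_expansion[OF G], of UNIV] by simp
    then have "(\<lambda>z. norm (eval_fps G z)) \<midarrow>0\<rightarrow> norm (eval_fps G 0)"
      by (intro tendsto_norm) (simp add: isCont_def)
    then have "\<forall>\<^sub>F z in at 0. norm (eval_fps G z) < norm (eval_fps G 0) + 1"
      by (rule order_tendstoD(2)) simp
    then show ?thesis by (simp add: eventually_nhds_conv_at)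
  qed
  ultimately have "\<forall>\<^sub>F z in nhds 0. norm (f z - (\<Sum>k<M. F $ k * z ^ k)) \<le> (norm (eval_fps G 0) + 1) * norm z ^ M"
  proof eventually_elim
    case (elim z)
    then have "f z - (\<Sum>k<M. F $ k * z ^ k) = eval_fps G z * z ^ M" by (simp add: f'_def)
    then show ?case using elim by (auto simp: norm_mult norm_power intro!: mult_right_mono)
  qed
  then obtain d where "d > 0" "\<forall>z. dist z 0 < d \<longrightarrow> norm (f z - (\<Sum>k<M. F $ k * z ^ k)) \<le> (norm (eval_fps G 0) + 1) * norm z ^ M"
    unfolding eventually_nhds_metric by blast
  then show ?thesis
    by (intro exI[of _ d] exI[of _ "norm (eval_fps G 0) + 1"]) simp
qed

definition complex_symbol :: "nat \<Rightarrow> (nat \<Rightarrow> real) \<Rightarrow> complex \<Rightarrow> complex" where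
  "complex_symbol N a z = (\<Sum>\<nu>=1..N. complex_of_real (2 * a \<nu>) * (1 - cos (of_nat \<nu> * z)))"

text \<open>The function B with its removable singularity filled in: A(z) / z^2 tends to 1 by the
  normalisation of the scheme, so B(0) = 0.\<close>

definition defect :: "nat \<Rightarrow> (nat \<Rightarrow> real) \<Rightarrow> complex \<Rightarrow> complex" where
  "defect N a z = 1 - (if z = 0 then 1 else complex_symbol N a z / z ^ 2)"

lemma complex_symbol_of_real: "complex_symbol N a (complex_of_real \<theta>) = complex_of_real (symbol N a \<theta>)"
proof -
  have "cos (of_nat \<nu> * complex_of_real \<theta>) = complex_of_real (cos (real \<nu> * \<theta>))" for \<nu>
    by (metis cos_of_real of_real_mult of_real_of_nat_eq)
  then show ?thesis by (simp add: complex_symbol_def symbol_def sum_distrib_left algebra_simps)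
qed

lemma complex_symbol_eq_defect: "complex_symbol N a z = z ^ 2 * (1 - defect N a z)"
  by (simp add: defect_def complex_symbol_def)

text \<open>The Taylor coefficients of A are moments of \<open>a\<close>: odd ones vanish, that of
  z^2 is 1, those of z^4, ..., z^(2N) vanish by the order conditions, and the later ones are -
  b_n.\<close>

lemma defect_has_fps_expansion:
  assumes sc: "scheme_coeffs N a" and N: "N \<ge> 1"
  shows "defect N a has_fps_expansion defect_fps N a"
proof -
  define F where "F = (\<Sum>\<nu>=1..N. fps_const (complex_of_real (2 * a \<nu>)) * (1 - fps_cos (of_nat \<nu>)))"
  have "complex_symbol N a has_fps_expansion F"
    unfolding complex_symbol_def F_def by (intro fps_expansion_intros)
  define \<mu> where "\<mu> = (\<lambda>k. \<Sum>\<nu>=1..N. a \<nu> * real \<nu> ^ (2 * k))"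
  have mu: "\<mu> 1 = 1" "\<And>k. 2 \<le> k \<Longrightarrow> k \<le> N \<Longrightarrow> \<mu> k = 0"
    using sc by (auto simp: \<mu>_def scheme_coeffs_def)
  have F_odd: "F $ n = 0" if "odd n" for n
    using that by (auto simp: F_def fps_sum_nth fps_cos_def odd_pos)
  have F0: "F $ 0 = 0" by (simp add: F_def fps_sum_nth fps_cos_def)
  have F_even: "F $ (2 * k) = complex_of_real (- 2 * (-1) ^ k / fact (2 * k) * \<mu> k)" if "k > 0" for k
    using that by (simp add: F_def fps_sum_nth fps_cos_def \<mu>_def sum_distrib_left sum_negf mult_ac)
  have F2: "F $ 2 = 1" using F_even[of 1] mu by (simp add: numeral_2_eq_2)
  have "2 \<le> subdegree F"
  proof (rule subdegree_geI)
    show "F \<noteq> 0" using F2 by auto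
    fix i :: nat assume "i < 2"
    then have "i = 0 \<or> i = 1" by auto
    then show "F $ i = 0" using F0 F_odd[of 1] by auto
  qed
  then have "(\<lambda>z. if z = 0 then 1 else complex_symbol N a z / z ^ 2) has_fps_expansion fps_shift 2 F"
    by (intro has_fps_expansion_shift \<open>complex_symbol N a has_fps_expansion F\<close>) (simp_all add: F2)
  then have "defect N a has_fps_expansion 1 - fps_shift 2 F"
    unfolding defect_def[abs_def] by (rule has_fps_expansion_diff[OF has_fps_expansion_1])
  also have "1 - fps_shift 2 F = defect_fps N a"
  proof (rule fps_ext)
    fix n
    show "(1 - fps_shift 2 F) $ n = defect_fps N a $ n"
    proof (cases "even n")
      case True
      then obtain s where n: "n = 2 * s" by (elim evenE)
      have "F $ (n + 2) = complex_of_real (2 * (-1) ^ s / fact (2 * (s + 1)) * \<mu> (s + 1))"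
        using F_even[of "s + 1"] by (simp add: n)
      moreover have "beta_fps N a $ s = (if N \<le> s then complex_of_real (- (2 * (-1) ^ s / fact (2 * (s + 1)) * \<mu> (s + 1))) else 0)"
        by (simp add: beta_fps_def b_coeff_def \<mu>_def)
      moreover have "\<mu> (s + 1) = (if s = 0 then 1 else 0)" if "s < N"
        using mu(1) mu(2)[of "s + 1"] that by auto
      ultimately show ?thesis
        using N by (auto simp: n defect_fps_def fps_compose_X_square_nth not_le)
    next
      case False
      then have "n \<noteq> 0" by (metis even_zero)
      then show ?thesis using False F_odd[of "n + 2"]
        by (simp add: defect_fps_def fps_compose_X_square_nth)
    qed
  qed
  finally show ?thesis .
qed

lemma has_fps_expansion_power [fps_expansion_intros]:
  fixes f :: "complex \<Rightarrow> complex"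
  assumes "f has_fps_expansion F"
  shows "(\<lambda>z. f z ^ n) has_fps_expansion F ^ n"
  by (induction n) (auto intro!: fps_expansion_intros assms)

lemma expansion_fps_expansion:
  assumes "scheme_coeffs N a" "N \<ge> 1"
  shows "(\<lambda>z. defect N a z ^ m * (1 - defect N a z) ^ J * (exp (\<i> * z) - 1)) has_fps_expansion expansion_fps N a J m"
  unfolding expansion_fps_def by (intro fps_expansion_intros defect_has_fps_expansion assms)

text \<open>Two truncations: the exponential series at m = M, then the Taylor series in \<theta> of
  each of the finitely many factors. The bound must hold for all w \<ge> 0 at once, since w =
  \<xi>^2 is unbounded as t grows; exp (w / 2) is weak enough to be absorbed by exp (- w).\<close>

lemma small_angle_expansion:
  assumes sc: "scheme_coeffs N a" and N: "N \<ge> 1"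
  obtains \<delta> C where "\<delta> > 0" "C \<ge> 0"
    "\<And>\<theta> w. \<bar>\<theta>\<bar> < \<delta> \<Longrightarrow> w \<ge> 0 \<Longrightarrow>
       norm (exp (complex_of_real w * defect N a \<theta>) * ((1 - defect N a \<theta>) ^ J * (iexp \<theta> - 1))
         - (\<Sum>m\<le>M. complex_of_real w ^ m / fact m * (\<Sum>k<Suc M. expansion_fps N a J m $ k * complex_of_real \<theta> ^ k)))
       \<le> C * \<bar>\<theta>\<bar> ^ Suc M * (1 + w) ^ Suc M * exp (w / 2)"
proof -
  \<comment> \<open>Linear vanishing of B is all that is used here: each power of w B then brings a
    factor |\<theta>|, enough for the tail of the exponential series.\<close>
  have B0: "defect_fps N a $ 0 = 0"
    using N by (simp add: defect_fps_def fps_compose_X_square_nth beta_fps_def)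
  have "\<exists>\<delta> C. \<delta> > 0 \<and> (\<forall>z. norm z < \<delta> \<longrightarrow> norm (defect N a z - (\<Sum>k<1. defect_fps N a $ k * z ^ k)) \<le> C * norm z ^ 1)"
    by (rule has_fps_expansion_remainder[OF defect_has_fps_expansion[OF sc N]])
  then obtain \<delta>1 C1 where d1: "\<delta>1 > 0" "\<And>z. norm z < \<delta>1 \<Longrightarrow> norm (defect N a z) \<le> C1 * norm z"
    by (auto simp: B0)
  define Q where "Q = (\<lambda>m \<delta> C. \<delta> > 0 \<and> (\<forall>z. norm z < \<delta> \<longrightarrow> norm (defect N a z ^ m * (1 - defect N a z) ^ J * (exp (\<i> * z) - 1)
      - (\<Sum>k<Suc M. expansion_fps N a J m $ k * z ^ k)) \<le> C * norm z ^ Suc M))"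
  have "\<exists>\<delta> C. Q m \<delta> C" for m
    unfolding Q_def by (rule has_fps_expansion_remainder[OF expansion_fps_expansion[OF sc N]])
  then obtain \<delta>2 C2 where "\<And>m. Q m (\<delta>2 m) (C2 m)" by metis
  then have d2: "\<And>m. \<delta>2 m > 0" "\<And>m z. norm z < \<delta>2 m \<Longrightarrow> norm (defect N a z ^ m * (1 - defect N a z) ^ J * (exp (\<i> * z) - 1)
      - (\<Sum>k<Suc M. expansion_fps N a J m $ k * z ^ k)) \<le> C2 m * norm z ^ Suc M"
    unfolding Q_def by simp_all
  define D1 where "D1 = \<bar>C1\<bar> + 1"
  have D1: "D1 > 0" by (simp add: D1_def)
  \<comment> \<open>The bound 1 / (2 * D1) ensures |B| \<le> 1/2; the minimum over m \<le> M makes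
    all the Taylor estimates valid at once.\<close>
  define \<delta> where "\<delta> = min (min \<delta>1 (1 / (2 * D1))) (Min (\<delta>2 ` {..M}))"
  have \<delta>: "\<delta> > 0" "\<delta> \<le> \<delta>1" "\<delta> \<le> 1 / (2 * D1)"
    using d1 d2(1) D1 by (auto simp: \<delta>_def)
  have \<delta>2: "\<delta> \<le> \<delta>2 m" if "m \<le> M" for m
  proof -
    have "Min (\<delta>2 ` {..M}) \<le> \<delta>2 m" using that by (intro Min_le) auto
    then show ?thesis by (simp add: \<delta>_def)
  qed
  define C where "C = D1 ^ Suc M * (2 ^ J * 2) + (\<Sum>m\<le>M. \<bar>C2 m\<bar>)"
  have C0: "C \<ge> 0" unfolding C_def using D1 by (intro add_nonneg_nonneg sum_nonneg) auto
  have "norm (exp (complex_of_real w * defect N a \<theta>) * ((1 - defect N a \<theta>) ^ J * (iexp \<theta> - 1))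
         - (\<Sum>m\<le>M. complex_of_real w ^ m / fact m * (\<Sum>k<Suc M. expansion_fps N a J m $ k * complex_of_real \<theta> ^ k)))
       \<le> C * \<bar>\<theta>\<bar> ^ Suc M * (1 + w) ^ Suc M * exp (w / 2)" if th: "\<bar>\<theta>\<bar> < \<delta>" and w: "w \<ge> 0" for \<theta> w
  proof -
    define B where "B = defect N a \<theta>"
    define Y where "Y = (1 - B) ^ J * (iexp \<theta> - 1)"
    define T where "T = (\<lambda>m. \<Sum>k<Suc M. expansion_fps N a J m $ k * complex_of_real \<theta> ^ k)"
    define W where "W = complex_of_real w"
    have B1: "norm B \<le> D1 * \<bar>\<theta>\<bar>"
    proof -
      have "norm B \<le> C1 * \<bar>\<theta>\<bar>" using d1(2)[of "complex_of_real \<theta>"] th \<delta>(2) by (simp add: B_def)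
      also have "\<dots> \<le> D1 * \<bar>\<theta>\<bar>" by (intro mult_right_mono) (auto simp: D1_def)
      finally show ?thesis .
    qed
    also have "D1 * \<bar>\<theta>\<bar> \<le> D1 * (1 / (2 * D1))" using th \<delta>(3) D1 by (intro mult_left_mono) auto
    also have "\<dots> = 1 / 2" using D1 by simp
    finally have B2: "norm B \<le> 1 / 2" .
    have Y: "norm Y \<le> 2 ^ J * 2"
    proof -
      have "norm (1 - B) \<le> 2" using norm_triangle_ineq4[of 1 B] B2 by simp
      moreover have "norm (iexp \<theta> - 1) \<le> 2" using norm_triangle_ineq4[of "iexp \<theta>" 1] by simp
      ultimately show ?thesis unfolding Y_def norm_mult norm_power by (intro mult_mono power_mono) auto
    qed
    have expr: "norm (exp (W * B) - (\<Sum>m\<le>M. (W * B) ^ m / fact m)) \<le> exp (w / 2) * (w ^ Suc M * (D1 ^ Suc M * \<bar>\<theta>\<bar> ^ Suc M))"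
    proof -
      have "norm (exp (W * B) - (\<Sum>m\<le>M. (W * B) ^ m / fact m)) \<le> exp (norm (W * B)) * norm (W * B) ^ Suc M / fact M"
        by (rule Taylor_exp_field)
      also have "\<dots> \<le> exp (norm (W * B)) * norm (W * B) ^ Suc M / 1"
        by (intro divide_left_mono) (auto simp: fact_ge_1)
      also have "\<dots> \<le> exp (w / 2) * (w * (D1 * \<bar>\<theta>\<bar>)) ^ Suc M"
      proof -
        have "norm (W * B) \<le> w * (1 / 2)" unfolding norm_mult using B2 w by (intro mult_mono) (auto simp: W_def)
        moreover have "norm (W * B) \<le> w * (D1 * \<bar>\<theta>\<bar>)" unfolding norm_mult using B1 w by (intro mult_mono) (auto simp: W_def)
        ultimately show ?thesis unfolding div_by_1 by (intro mult_mono power_mono) auto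
      qed
      finally show ?thesis by (simp only: power_mult_distrib)
    qed
    \<comment> \<open>The first term is the tail of the exponential series, the second collects the
      Taylor remainders of B^m Y.\<close>
    have "exp (W * B) * Y - (\<Sum>m\<le>M. W ^ m / fact m * T m)
      = (exp (W * B) - (\<Sum>m\<le>M. (W * B) ^ m / fact m)) * Y + (\<Sum>m\<le>M. W ^ m / fact m * (B ^ m * Y - T m))"
      by (simp add: left_diff_distrib right_diff_distrib sum_subtractf sum_distrib_left sum_distrib_right power_mult_distrib mult_ac)
    also have "norm \<dots> \<le> exp (w / 2) * (w ^ Suc M * (D1 ^ Suc M * \<bar>\<theta>\<bar> ^ Suc M)) * (2 ^ J * 2) + (\<Sum>m\<le>M. w ^ m * (\<bar>C2 m\<bar> * \<bar>\<theta>\<bar> ^ Suc M))"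
    proof (rule order_trans[OF norm_triangle_ineq], rule add_mono)
      show "norm ((exp (W * B) - (\<Sum>m\<le>M. (W * B) ^ m / fact m)) * Y) \<le> exp (w / 2) * (w ^ Suc M * (D1 ^ Suc M * \<bar>\<theta>\<bar> ^ Suc M)) * (2 ^ J * 2)"
        unfolding norm_mult using expr Y w D1 by (intro mult_mono) auto
      show "norm (\<Sum>m\<le>M. W ^ m / fact m * (B ^ m * Y - T m)) \<le> (\<Sum>m\<le>M. w ^ m * (\<bar>C2 m\<bar> * \<bar>\<theta>\<bar> ^ Suc M))"
      proof (rule order_trans[OF norm_sum], rule sum_mono)
        fix m assume "m \<in> {..M}"
        then have m: "m \<le> M" by simp
        have "norm (B ^ m * Y - T m) \<le> C2 m * \<bar>\<theta>\<bar> ^ Suc M"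
          using d2(2)[of "complex_of_real \<theta>" m] th \<delta>2[OF m] by (simp add: B_def Y_def T_def mult.assoc)
        also have "\<dots> \<le> \<bar>C2 m\<bar> * \<bar>\<theta>\<bar> ^ Suc M" by (intro mult_right_mono) auto
        finally have 1: "norm (B ^ m * Y - T m) \<le> \<bar>C2 m\<bar> * \<bar>\<theta>\<bar> ^ Suc M" .
        have "norm (W ^ m / fact m) = w ^ m / fact m" using w by (simp add: norm_divide norm_power W_def)
        also have "\<dots> \<le> w ^ m / 1" using w by (intro divide_left_mono) (auto simp: fact_ge_1)
        finally have 2: "norm (W ^ m / fact m) \<le> w ^ m" by simp
        show "norm (W ^ m / fact m * (B ^ m * Y - T m)) \<le> w ^ m * (\<bar>C2 m\<bar> * \<bar>\<theta>\<bar> ^ Suc M)"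
          unfolding norm_mult[of "W ^ m / fact m"] using 1 2 w by (intro mult_mono) auto
      qed
    qed
    also have "\<dots> \<le> C * \<bar>\<theta>\<bar> ^ Suc M * (1 + w) ^ Suc M * exp (w / 2)"
    proof -
      define E where "E = \<bar>\<theta>\<bar> ^ Suc M * (1 + w) ^ Suc M * exp (w / 2)"
      have e1: "exp (w / 2) \<ge> 1" using w by simp
      have "w ^ Suc M \<le> (1 + w) ^ Suc M" using w by (intro power_mono) auto
      then have "exp (w / 2) * (w ^ Suc M * (D1 ^ Suc M * \<bar>\<theta>\<bar> ^ Suc M)) * (2 ^ J * 2)
          \<le> exp (w / 2) * ((1 + w) ^ Suc M * (D1 ^ Suc M * \<bar>\<theta>\<bar> ^ Suc M)) * (2 ^ J * 2)"
        using D1 by (intro mult_right_mono mult_left_mono) auto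
      also have "\<dots> = D1 ^ Suc M * (2 ^ J * 2) * E" by (simp add: E_def mult_ac)
      finally have 1: "exp (w / 2) * (w ^ Suc M * (D1 ^ Suc M * \<bar>\<theta>\<bar> ^ Suc M)) * (2 ^ J * 2) \<le> D1 ^ Suc M * (2 ^ J * 2) * E" .
      have "(\<Sum>m\<le>M. w ^ m * (\<bar>C2 m\<bar> * \<bar>\<theta>\<bar> ^ Suc M)) \<le> (\<Sum>m\<le>M. \<bar>C2 m\<bar> * E)"
      proof (rule sum_mono)
        fix m assume "m \<in> {..M}"
        then have "w ^ m \<le> (1 + w) ^ m" "(1 + w) ^ m \<le> (1 + w) ^ Suc M"
          using w by (intro power_mono power_increasing; simp)+
        then have "w ^ m * 1 \<le> (1 + w) ^ Suc M * exp (w / 2)"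
          using w e1 by (intro mult_mono) auto
        then have "w ^ m * (\<bar>C2 m\<bar> * \<bar>\<theta>\<bar> ^ Suc M) \<le> ((1 + w) ^ Suc M * exp (w / 2)) * (\<bar>C2 m\<bar> * \<bar>\<theta>\<bar> ^ Suc M)"
          by (intro mult_right_mono) auto
        also have "\<dots> = \<bar>C2 m\<bar> * E" by (simp add: E_def mult_ac)
        finally show "w ^ m * (\<bar>C2 m\<bar> * \<bar>\<theta>\<bar> ^ Suc M) \<le> \<bar>C2 m\<bar> * E" .
      qed
      also have "\<dots> = (\<Sum>m\<le>M. \<bar>C2 m\<bar>) * E" by (simp add: sum_distrib_right)
      finally have "exp (w / 2) * (w ^ Suc M * (D1 ^ Suc M * \<bar>\<theta>\<bar> ^ Suc M)) * (2 ^ J * 2) + (\<Sum>m\<le>M. w ^ m * (\<bar>C2 m\<bar> * \<bar>\<theta>\<bar> ^ Suc M)) \<le> C * E"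
        using 1 by (simp only: C_def distrib_right)
      then show ?thesis by (simp only: E_def mult.assoc)
    qed
    finally show ?thesis by (simp only: B_def Y_def T_def W_def)
  qed
  then show ?thesis by (rule that[OF \<delta>(1) C0])
qed

section \<open>Dominating the remainder\<close>

text \<open>\<open>t\<^sup>J\<close> times the Fourier integrand of the \<open>J\<close>-th time derivative of the gradient at \<open>t = \<tau>\<^sup>-\<^sup>2\<close>,
  in the variable \<open>\<xi> = \<theta> / \<tau>\<close>.\<close>

definition scaled_integrand :: "nat \<Rightarrow> (nat \<Rightarrow> real) \<Rightarrow> nat \<Rightarrow> real \<Rightarrow> real \<Rightarrow> complex" where
  "scaled_integrand N a J \<tau> \<xi> =
     complex_of_real ((- (symbol N a (\<tau> * \<xi>) / \<tau>\<^sup>2)) ^ J * exp (- (symbol N a (\<tau> * \<xi>) / \<tau>\<^sup>2))) * (iexp (\<tau> * \<xi>) - 1)"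

definition approx_integrand :: "nat \<Rightarrow> (nat \<Rightarrow> real) \<Rightarrow> nat \<Rightarrow> nat \<Rightarrow> real \<Rightarrow> real \<Rightarrow> complex" where
  "approx_integrand N a J M \<tau> \<xi> =
     (\<Sum>k<M. complex_of_real (\<tau> ^ k) * (complex_of_real (exp (- \<xi>\<^sup>2)) * poly (expansion_poly N a J M k) (complex_of_real \<xi>)))"

lemma scaled_integrand_eq_defect:
  assumes "\<tau> > 0"
  shows "scaled_integrand N a J \<tau> \<xi> = complex_of_real ((-1) ^ J * \<xi> ^ (2 * J) * exp (- \<xi>\<^sup>2)) *
    (exp (complex_of_real (\<xi>\<^sup>2) * defect N a (complex_of_real (\<tau> * \<xi>))) *
      ((1 - defect N a (complex_of_real (\<tau> * \<xi>))) ^ J * (iexp (\<tau> * \<xi>) - 1)))"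
proof -
  define B where "B = defect N a (complex_of_real (\<tau> * \<xi>))"
  have "complex_of_real (symbol N a (\<tau> * \<xi>)) = complex_of_real (\<tau> * \<xi>) ^ 2 * (1 - B)"
    by (simp only: complex_symbol_of_real[symmetric] complex_symbol_eq_defect B_def)
  then have s: "complex_of_real (symbol N a (\<tau> * \<xi>) / \<tau>\<^sup>2) = complex_of_real (\<xi>\<^sup>2) * (1 - B)"
    using assms by (simp add: power_mult_distrib)
  have "complex_of_real ((- (symbol N a (\<tau> * \<xi>) / \<tau>\<^sup>2)) ^ J) = (-1) ^ J * complex_of_real (\<xi> ^ (2 * J)) * (1 - B) ^ J"
  proof -
    have "complex_of_real ((- (symbol N a (\<tau> * \<xi>) / \<tau>\<^sup>2)) ^ J) = ((-1) * (complex_of_real (\<xi>\<^sup>2) * (1 - B))) ^ J"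
      by (simp only: of_real_power of_real_minus s mult_minus_left mult_1_left)
    then show ?thesis by (simp only: power_mult_distrib power_mult of_real_power) (simp add: mult_ac)
  qed
  moreover have "complex_of_real (exp (- (symbol N a (\<tau> * \<xi>) / \<tau>\<^sup>2))) = complex_of_real (exp (- \<xi>\<^sup>2)) * exp (complex_of_real (\<xi>\<^sup>2) * B)"
  proof -
    have "complex_of_real (exp (- (symbol N a (\<tau> * \<xi>) / \<tau>\<^sup>2))) = exp (- (complex_of_real (\<xi>\<^sup>2) * (1 - B)))"
      by (simp only: exp_of_real[symmetric] of_real_minus s)
    also have "- (complex_of_real (\<xi>\<^sup>2) * (1 - B)) = complex_of_real (- \<xi>\<^sup>2) + complex_of_real (\<xi>\<^sup>2) * B"
      by (simp add: algebra_simps)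
    finally show ?thesis by (simp only: exp_add exp_of_real)
  qed
  ultimately show ?thesis
    unfolding scaled_integrand_def B_def[symmetric] by (simp only: of_real_mult) (simp add: mult_ac)
qed

text \<open>Exchanging the two finite sums shows that grouping by powers of \<tau> gives the double
  truncation of \<open>small_angle_expansion\<close>.\<close>

lemma approx_integrand_eq:
  "approx_integrand N a J (Suc M) \<tau> \<xi> = complex_of_real ((-1) ^ J * \<xi> ^ (2 * J) * exp (- \<xi>\<^sup>2)) *
    (\<Sum>m\<le>M. complex_of_real (\<xi>\<^sup>2) ^ m / fact m * (\<Sum>k<Suc M. expansion_fps N a J m $ k * complex_of_real (\<tau> * \<xi>) ^ k))"
proof -
  have "approx_integrand N a J (Suc M) \<tau> \<xi> = (\<Sum>k<Suc M. \<Sum>m\<le>M. complex_of_real ((-1) ^ J * \<xi> ^ (2 * J) * exp (- \<xi>\<^sup>2)) *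
    (complex_of_real (\<xi>\<^sup>2) ^ m / fact m * (expansion_fps N a J m $ k * complex_of_real (\<tau> * \<xi>) ^ k)))"
    unfolding approx_integrand_def expansion_poly_def lessThan_Suc_atMost
    by (simp add: poly_sum poly_monom sum_distrib_left power_mult_distrib power_add mult_ac flip: power_mult)
  also have "\<dots> = (\<Sum>m\<le>M. \<Sum>k<Suc M. complex_of_real ((-1) ^ J * \<xi> ^ (2 * J) * exp (- \<xi>\<^sup>2)) *
    (complex_of_real (\<xi>\<^sup>2) ^ m / fact m * (expansion_fps N a J m $ k * complex_of_real (\<tau> * \<xi>) ^ k)))"
    by (rule sum.swap)
  finally show ?thesis by (simp only: sum_distrib_left)
qed

lemma scaled_integrand_near:
  assumes sc: "scheme_coeffs N a" and N: "N \<ge> 1"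
  obtains \<delta> g where "\<delta> > 0" "integrable lborel g"
    "\<And>\<tau> \<xi>. \<tau> > 0 \<Longrightarrow> \<bar>\<tau> * \<xi>\<bar> < \<delta> \<Longrightarrow>
       norm (scaled_integrand N a J \<tau> \<xi> - approx_integrand N a J (Suc M) \<tau> \<xi>) \<le> \<tau> ^ Suc M * g \<xi>"
    "\<And>\<xi>. g \<xi> \<ge> 0"
proof -
  obtain \<delta> C where d: "\<delta> > 0" "C \<ge> 0"
    "\<And>\<theta> w. \<bar>\<theta>\<bar> < \<delta> \<Longrightarrow> w \<ge> 0 \<Longrightarrow>
       norm (exp (complex_of_real w * defect N a \<theta>) * ((1 - defect N a \<theta>) ^ J * (iexp \<theta> - 1))
         - (\<Sum>m\<le>M. complex_of_real w ^ m / fact m * (\<Sum>k<Suc M. expansion_fps N a J m $ k * complex_of_real \<theta> ^ k)))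
       \<le> C * \<bar>\<theta>\<bar> ^ Suc M * (1 + w) ^ Suc M * exp (w / 2)"
    by (rule small_angle_expansion[OF sc N, of J M]) (rule that; (assumption | simp only: ))
  \<comment> \<open>Packs C |\<xi>|^(2J+M+1) (1 + \<xi>^2)^(M+1) as the norm of a polynomial, so
    that its product with exp (- \<xi>^2 / 2) is integrable by
    \<open>integrable_norm_poly_gaussian\<close>.\<close>
  define p where "p = monom (complex_of_real C) (2 * J + Suc M) * [:1, 0, 1:] ^ Suc M"
  define g where "g = (\<lambda>\<xi>. norm (poly p (complex_of_real \<xi>)) * exp (- (1 / 2 * \<xi>\<^sup>2)))"
  have g: "g \<xi> = C * \<bar>\<xi>\<bar> ^ (2 * J + Suc M) * (1 + \<xi>\<^sup>2) ^ Suc M * exp (- (1 / 2 * \<xi>\<^sup>2))" for \<xi>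
  proof -
    have "poly [:1, 0, 1:] (complex_of_real \<xi>) = complex_of_real (1 + \<xi>\<^sup>2)" by (simp add: power2_eq_square)
    moreover have "norm (complex_of_real (1 + \<xi>\<^sup>2)) = 1 + \<xi>\<^sup>2" by (simp only: norm_of_real) simp
    ultimately show ?thesis
      using d(2) by (simp only: g_def p_def poly_mult poly_power poly_monom norm_mult norm_power norm_of_real abs_of_nonneg)
  qed
  have "norm (scaled_integrand N a J \<tau> \<xi> - approx_integrand N a J (Suc M) \<tau> \<xi>) \<le> \<tau> ^ Suc M * g \<xi>"
    if t: "\<tau> > 0" and x: "\<bar>\<tau> * \<xi>\<bar> < \<delta>" for \<tau> \<xi>
  proof -
    define X where "X = exp (complex_of_real (\<xi>\<^sup>2) * defect N a (complex_of_real (\<tau> * \<xi>))) * ((1 - defect N a (complex_of_real (\<tau> * \<xi>))) ^ J * (iexp (\<tau> * \<xi>) - 1))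
         - (\<Sum>m\<le>M. complex_of_real (\<xi>\<^sup>2) ^ m / fact m * (\<Sum>k<Suc M. expansion_fps N a J m $ k * complex_of_real (\<tau> * \<xi>) ^ k))"
    have X: "norm X \<le> C * \<bar>\<tau> * \<xi>\<bar> ^ Suc M * (1 + \<xi>\<^sup>2) ^ Suc M * exp (\<xi>\<^sup>2 / 2)"
      unfolding X_def by (rule d(3)[OF x]) simp
    have "scaled_integrand N a J \<tau> \<xi> - approx_integrand N a J (Suc M) \<tau> \<xi>
        = complex_of_real ((-1) ^ J * \<xi> ^ (2 * J) * exp (- \<xi>\<^sup>2)) * X"
      by (simp only: scaled_integrand_eq_defect[OF t] approx_integrand_eq X_def right_diff_distrib)
    also have "norm \<dots> = \<bar>\<xi>\<bar> ^ (2 * J) * exp (- \<xi>\<^sup>2) * norm X"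
      by (simp only: norm_mult norm_of_real abs_mult power_abs abs_exp_cancel) (simp add: power_abs)
    also have "\<dots> \<le> \<bar>\<xi>\<bar> ^ (2 * J) * exp (- \<xi>\<^sup>2) * (C * \<bar>\<tau> * \<xi>\<bar> ^ Suc M * (1 + \<xi>\<^sup>2) ^ Suc M * exp (\<xi>\<^sup>2 / 2))"
      by (intro mult_left_mono X) auto
    also have "\<dots> = \<tau> ^ Suc M * g \<xi>"
    proof -
      have e: "exp (- \<xi>\<^sup>2) * exp (\<xi>\<^sup>2 / 2) = exp (- (1 / 2 * \<xi>\<^sup>2))" by (simp flip: exp_add)
      have "\<bar>\<tau> * \<xi>\<bar> ^ Suc M = \<tau> ^ Suc M * \<bar>\<xi>\<bar> ^ Suc M"
        using t by (simp only: abs_mult power_mult_distrib abs_of_pos)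
      then show ?thesis unfolding g e[symmetric] power_add[of "\<bar>\<xi>\<bar>" "2 * J"] by (simp only: mult_ac)
    qed
    finally show ?thesis .
  qed
  moreover have "integrable lborel g" unfolding g_def by (rule integrable_norm_poly_gaussian) simp
  moreover have "g \<xi> \<ge> 0" for \<xi> by (simp add: g_def)
  ultimately show ?thesis using d(1) by (intro that[of \<delta> g])
qed

lemma scaled_integrand_far:
  assumes sc: "scheme_coeffs N a" and N: "N \<ge> 1" and \<delta>: "\<delta> > 0"
  obtains g where "integrable lborel g"
    "\<And>\<tau> \<xi>. \<tau> > 0 \<Longrightarrow> \<bar>\<tau> * \<xi>\<bar> \<ge> \<delta> \<Longrightarrow> \<bar>\<tau> * \<xi>\<bar> \<le> pi \<Longrightarrow> norm (scaled_integrand N a J \<tau> \<xi>) \<le> \<tau> ^ M * g \<xi>"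
    "\<And>\<xi>. g \<xi> \<ge> 0"
proof -
  obtain c where c: "c > 0" "\<And>\<theta>. \<bar>\<theta>\<bar> \<le> pi \<Longrightarrow> c * \<theta>\<^sup>2 \<le> symbol N a \<theta>"
    by (rule symbol_lower_bound[OF sc N]) (rule that; (assumption | simp only: ))
  define S where "S = 2 * (\<Sum>\<nu>=1..N. \<bar>a \<nu>\<bar> * 2)"
  have S: "\<bar>symbol N a \<theta>\<bar> \<le> S" for \<theta>
  proof -
    have "\<bar>symbol N a \<theta>\<bar> = 2 * \<bar>\<Sum>\<nu>=1..N. a \<nu> * (1 - cos (real \<nu> * \<theta>))\<bar>" by (simp add: symbol_def abs_mult)
    also have "\<dots> \<le> 2 * (\<Sum>\<nu>=1..N. \<bar>a \<nu> * (1 - cos (real \<nu> * \<theta>))\<bar>)" by (intro mult_left_mono sum_abs) simp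
    also have "\<dots> \<le> S"
      unfolding S_def abs_mult
    proof (intro mult_left_mono sum_mono)
      fix \<nu> show "\<bar>1 - cos (real \<nu> * \<theta>)\<bar> \<le> 2"
        using cos_le_one[of "real \<nu> * \<theta>"] cos_ge_minus_one[of "real \<nu> * \<theta>"] by linarith
    qed auto
    finally show ?thesis .
  qed
  \<comment> \<open>The J-th power bounds the algebraic factor, 2 bounds |exp (i \<theta>) - 1|, and
    \<delta>^M comes from 1 \<le> (\<tau> |\<xi>| / \<delta>)^M.\<close>
  define D where "D = (S / \<delta>\<^sup>2) ^ J * 2 / \<delta> ^ M"
  have S0: "S \<ge> 0" unfolding S_def by (intro mult_nonneg_nonneg sum_nonneg) auto
  have D: "D \<ge> 0" using S0 \<delta> by (simp add: D_def)
  define p where "p = monom (complex_of_real D) (2 * J + M)"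
  define g where "g = (\<lambda>\<xi>. norm (poly p (complex_of_real \<xi>)) * exp (- (c * \<xi>\<^sup>2)))"
  have g: "g \<xi> = D * \<bar>\<xi>\<bar> ^ (2 * J + M) * exp (- (c * \<xi>\<^sup>2))" for \<xi>
    using D by (simp add: g_def p_def poly_monom norm_mult norm_power)
  have "norm (scaled_integrand N a J \<tau> \<xi>) \<le> \<tau> ^ M * g \<xi>"
    if t: "\<tau> > 0" and lo: "\<bar>\<tau> * \<xi>\<bar> \<ge> \<delta>" and hi: "\<bar>\<tau> * \<xi>\<bar> \<le> pi" for \<tau> \<xi>
  proof -
    define s where "s = symbol N a (\<tau> * \<xi>) / \<tau>\<^sup>2"
    have lo': "\<delta> \<le> \<tau> * \<bar>\<xi>\<bar>" using lo t by (simp add: abs_mult)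
    have s1: "c * \<xi>\<^sup>2 \<le> s"
      using c(2)[OF hi] t by (simp add: s_def power_mult_distrib field_simps)
    \<comment> \<open>Away from 0 one has 1 / \<tau>^2 \<le> \<xi>^2 / \<delta>^2, which trades the
      division by \<tau>^2 for growth in \<xi>, uniformly in \<tau>.\<close>
    have s2: "\<bar>s\<bar> \<le> \<xi>\<^sup>2 * (S / \<delta>\<^sup>2)"
    proof -
      have "\<delta>\<^sup>2 \<le> (\<tau> * \<bar>\<xi>\<bar>)\<^sup>2" using lo' \<delta> by (intro power_mono) auto
      then have "S * \<delta>\<^sup>2 \<le> S * (\<tau>\<^sup>2 * \<xi>\<^sup>2)" using S0 by (intro mult_left_mono) (auto simp: power_mult_distrib)
      then have "S * \<delta>\<^sup>2 / (\<tau>\<^sup>2 * \<delta>\<^sup>2) \<le> S * (\<tau>\<^sup>2 * \<xi>\<^sup>2) / (\<tau>\<^sup>2 * \<delta>\<^sup>2)"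
        by (intro divide_right_mono) auto
      moreover have "S * \<delta>\<^sup>2 / (\<tau>\<^sup>2 * \<delta>\<^sup>2) = S / \<tau>\<^sup>2" using \<delta> by simp
      moreover have "S * (\<tau>\<^sup>2 * \<xi>\<^sup>2) / (\<tau>\<^sup>2 * \<delta>\<^sup>2) = \<xi>\<^sup>2 * (S / \<delta>\<^sup>2)" using t by simp
      moreover have "\<bar>s\<bar> \<le> S / \<tau>\<^sup>2" unfolding s_def abs_divide using S t by (simp add: divide_right_mono)
      ultimately show ?thesis by linarith
    qed
    have "norm (scaled_integrand N a J \<tau> \<xi>) = \<bar>s\<bar> ^ J * exp (- s) * norm (iexp (\<tau> * \<xi>) - 1)"
      by (simp only: scaled_integrand_def s_def[symmetric] norm_mult norm_of_real abs_mult power_abs abs_minus_cancel abs_exp_cancel)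
    also have "\<dots> \<le> (\<xi>\<^sup>2 * (S / \<delta>\<^sup>2)) ^ J * exp (- (c * \<xi>\<^sup>2)) * 2"
    proof -
      have "norm (iexp (\<tau> * \<xi>) - 1) \<le> 2" using norm_triangle_ineq4[of "iexp (\<tau> * \<xi>)" 1] by simp
      then show ?thesis using s1 s2 S0 by (intro mult_mono power_mono) auto
    qed
    also have "\<dots> = ((S / \<delta>\<^sup>2) ^ J * 2 * \<bar>\<xi>\<bar> ^ (2 * J) * exp (- (c * \<xi>\<^sup>2))) * 1"
    proof -
      have "(\<xi>\<^sup>2 * (S / \<delta>\<^sup>2)) ^ J = (S / \<delta>\<^sup>2) ^ J * \<bar>\<xi>\<bar> ^ (2 * J)"
        by (simp only: power_mult_distrib[of "\<xi>\<^sup>2"] power_mult power2_abs) (rule mult.commute)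
      then show ?thesis by simp
    qed
    also have "\<dots> \<le> ((S / \<delta>\<^sup>2) ^ J * 2 * \<bar>\<xi>\<bar> ^ (2 * J) * exp (- (c * \<xi>\<^sup>2))) * ((\<tau> * \<bar>\<xi>\<bar>) / \<delta>) ^ M"
      using lo' \<delta> S0 by (intro mult_left_mono one_le_power) (auto simp: field_simps)
    also have "\<dots> = \<tau> ^ M * g \<xi>"
      by (simp add: g D_def power_add power_mult_distrib power_divide mult_ac)
    finally show ?thesis .
  qed
  moreover have "integrable lborel g" unfolding g_def by (rule integrable_norm_poly_gaussian[OF c(1)])
  moreover have "g \<xi> \<ge> 0" for \<xi> by (simp add: g_def)
  ultimately show ?thesis by (intro that[of g])
qed

text \<open>The Gaussian transforms integrate over the whole line, the Green function only over
  |\<tau> \<xi>| \<le> pi, so the tails of the approximating terms have to be small as well. The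
  term of order k lacks a factor \<tau>^(M-k), supplied by (\<tau> |\<xi>| / \<delta>)^(M-k) \<ge>
  1.\<close>

lemma approx_integrand_far:
  assumes \<delta>: "\<delta> > 0"
  obtains g where "integrable lborel g"
    "\<And>\<tau> \<xi>. \<tau> > 0 \<Longrightarrow> \<bar>\<tau> * \<xi>\<bar> \<ge> \<delta> \<Longrightarrow> norm (approx_integrand N a J M \<tau> \<xi>) \<le> \<tau> ^ M * g \<xi>"
    "\<And>\<xi>. g \<xi> \<ge> 0"
proof -
  define q where "q = (\<lambda>k. monom (complex_of_real (1 / \<delta> ^ (M - k))) (M - k) * expansion_poly N a J M k)"
  define g where "g = (\<lambda>\<xi>. \<Sum>k<M. norm (poly (q k) (complex_of_real \<xi>)) * exp (- (1 * \<xi>\<^sup>2)))"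
  have "norm (approx_integrand N a J M \<tau> \<xi>) \<le> \<tau> ^ M * g \<xi>" if t: "\<tau> > 0" and lo: "\<bar>\<tau> * \<xi>\<bar> \<ge> \<delta>" for \<tau> \<xi>
  proof -
    have lo': "\<delta> \<le> \<tau> * \<bar>\<xi>\<bar>" using lo t by (simp add: abs_mult)
    have "norm (approx_integrand N a J M \<tau> \<xi>)
      \<le> (\<Sum>k<M. \<tau> ^ k * (exp (- \<xi>\<^sup>2) * norm (poly (expansion_poly N a J M k) (complex_of_real \<xi>))))"
      unfolding approx_integrand_def by (rule order_trans[OF norm_sum]) (use t in \<open>simp add: norm_mult norm_power\<close>)
    also have "\<dots> \<le> (\<Sum>k<M. \<tau> ^ M * (norm (poly (q k) (complex_of_real \<xi>)) * exp (- (1 * \<xi>\<^sup>2))))"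
    proof (rule sum_mono)
      fix k assume "k \<in> {..<M}"
      then have k: "\<tau> ^ M = \<tau> ^ k * \<tau> ^ (M - k)" by (simp flip: power_add)
      define E where "E = exp (- \<xi>\<^sup>2) * norm (poly (expansion_poly N a J M k) (complex_of_real \<xi>))"
      have "\<tau> ^ k * E * 1 \<le> \<tau> ^ k * E * ((\<tau> * \<bar>\<xi>\<bar>) / \<delta>) ^ (M - k)"
        using lo' \<delta> t by (intro mult_left_mono one_le_power) (auto simp: field_simps E_def)
      also have "\<dots> = \<tau> ^ M * (norm (poly (q k) (complex_of_real \<xi>)) * exp (- (1 * \<xi>\<^sup>2)))"
        using \<delta> by (simp add: k E_def q_def poly_monom norm_mult norm_power norm_divide power_mult_distrib power_divide mult_ac)
      finally show "\<tau> ^ k * (exp (- \<xi>\<^sup>2) * norm (poly (expansion_poly N a J M k) (complex_of_real \<xi>)))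
         \<le> \<tau> ^ M * (norm (poly (q k) (complex_of_real \<xi>)) * exp (- (1 * \<xi>\<^sup>2)))"
        by (simp add: E_def)
    qed
    finally show ?thesis by (simp only: g_def sum_distrib_left)
  qed
  moreover have "integrable lborel g"
    unfolding g_def by (intro Bochner_Integration.integrable_sum integrable_norm_poly_gaussian) simp
  moreover have "g \<xi> \<ge> 0" for \<xi> unfolding g_def by (intro sum_nonneg) simp
  ultimately show ?thesis by (intro that[of g])
qed

lemma scaled_integrand_approx:
  assumes sc: "scheme_coeffs N a" and N: "N \<ge> 1"
  obtains g where "integrable lborel g"
    "\<And>\<tau> \<xi>. \<tau> > 0 \<Longrightarrow> norm (indicator {-pi..pi} (\<tau> * \<xi>) *\<^sub>R scaled_integrand N a J \<tau> \<xi> - approx_integrand N a J (Suc M) \<tau> \<xi>) \<le> \<tau> ^ Suc M * g \<xi>"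
    "\<And>\<xi>. g \<xi> \<ge> 0"
proof -
  obtain \<delta>' g1 where 1: "\<delta>' > 0" "integrable lborel g1"
    "\<And>\<tau> \<xi>. \<tau> > 0 \<Longrightarrow> \<bar>\<tau> * \<xi>\<bar> < \<delta>' \<Longrightarrow>
       norm (scaled_integrand N a J \<tau> \<xi> - approx_integrand N a J (Suc M) \<tau> \<xi>) \<le> \<tau> ^ Suc M * g1 \<xi>"
    "\<And>\<xi>. g1 \<xi> \<ge> 0"
    by (rule scaled_integrand_near[OF sc N, of J M]) (rule that; (assumption | simp only: ))
  \<comment> \<open>Keeps the near region inside the integration interval, where the indicator is
    1.\<close>
  define \<delta> where "\<delta> = min \<delta>' pi"
  have \<delta>: "\<delta> > 0" using 1(1) by (simp add: \<delta>_def)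
  obtain g2 where 2: "integrable lborel g2"
    "\<And>\<tau> \<xi>. \<tau> > 0 \<Longrightarrow> \<bar>\<tau> * \<xi>\<bar> \<ge> \<delta> \<Longrightarrow> \<bar>\<tau> * \<xi>\<bar> \<le> pi \<Longrightarrow> norm (scaled_integrand N a J \<tau> \<xi>) \<le> \<tau> ^ Suc M * g2 \<xi>"
    "\<And>\<xi>. g2 \<xi> \<ge> 0"
    by (rule scaled_integrand_far[OF sc N \<delta>, of J "Suc M"]) (rule that; (assumption | simp only: ))
  obtain g3 where 3: "integrable lborel g3"
    "\<And>\<tau> \<xi>. \<tau> > 0 \<Longrightarrow> \<bar>\<tau> * \<xi>\<bar> \<ge> \<delta> \<Longrightarrow> norm (approx_integrand N a J (Suc M) \<tau> \<xi>) \<le> \<tau> ^ Suc M * g3 \<xi>"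
    "\<And>\<xi>. g3 \<xi> \<ge> 0"
    by (rule approx_integrand_far[where N = N and a = a and J = J and M = "Suc M", OF \<delta>]) (rule that; (assumption | simp only: ))
  have "norm (indicator {-pi..pi} (\<tau> * \<xi>) *\<^sub>R scaled_integrand N a J \<tau> \<xi> - approx_integrand N a J (Suc M) \<tau> \<xi>)
     \<le> \<tau> ^ Suc M * (g1 \<xi> + g2 \<xi> + g3 \<xi>)" if t: "\<tau> > 0" for \<tau> \<xi>
  proof (cases "\<bar>\<tau> * \<xi>\<bar> < \<delta>")
    case True
    then have "\<bar>\<tau> * \<xi>\<bar> < pi" by (simp add: \<delta>_def)
    then have "\<tau> * \<xi> \<in> {-pi..pi}" unfolding atLeastAtMost_iff by linarith
    then have "indicator {-pi..pi} (\<tau> * \<xi>) = (1 :: real)" by (rule indicator_simps)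
    moreover have "\<tau> ^ Suc M * g1 \<xi> \<le> \<tau> ^ Suc M * (g1 \<xi> + g2 \<xi> + g3 \<xi>)"
      using t 2(3)[of \<xi>] 3(3)[of \<xi>] by (intro mult_left_mono) auto
    ultimately show ?thesis using 1(3)[OF t, of \<xi>] True by (simp add: \<delta>_def)
  next
    case False
    then have far: "\<bar>\<tau> * \<xi>\<bar> \<ge> \<delta>" by simp
    have "norm (indicator {-pi..pi} (\<tau> * \<xi>) *\<^sub>R scaled_integrand N a J \<tau> \<xi>) \<le> \<tau> ^ Suc M * g2 \<xi>"
    proof (cases "\<bar>\<tau> * \<xi>\<bar> \<le> pi")
      case True
      then have "\<tau> * \<xi> \<in> {-pi..pi}" unfolding atLeastAtMost_iff by linarith
      then have "indicator {-pi..pi} (\<tau> * \<xi>) = (1 :: real)" by (rule indicator_simps)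
      then show ?thesis using 2(2)[OF t far True] by simp
    next
      case False
      then have "\<tau> * \<xi> \<notin> {-pi..pi}" unfolding atLeastAtMost_iff by linarith
      then have "indicator {-pi..pi} (\<tau> * \<xi>) = (0 :: real)" by (rule indicator_simps)
      then show ?thesis using t 2(3)[of \<xi>] by simp
    qed
    moreover have "0 \<le> \<tau> ^ Suc M * g1 \<xi>" using t 1(4)[of \<xi>] by simp
    ultimately show ?thesis
      using norm_triangle_ineq4[of "indicator {-pi..pi} (\<tau> * \<xi>) *\<^sub>R scaled_integrand N a J \<tau> \<xi>" "approx_integrand N a J (Suc M) \<tau> \<xi>"]
        3(2)[OF t far] by (simp only: distrib_left)
  qed
  moreover have "integrable lborel (\<lambda>\<xi>. g1 \<xi> + g2 \<xi> + g3 \<xi>)"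
    using 1(2) 2(1) 3(1) by (intro Bochner_Integration.integrable_add)
  moreover have "g1 \<xi> + g2 \<xi> + g3 \<xi> \<ge> 0" for \<xi> using 1(4)[of \<xi>] 2(3)[of \<xi>] 3(3)[of \<xi>] by simp
  ultimately show ?thesis by (intro that[of "\<lambda>\<xi>. g1 \<xi> + g2 \<xi> + g3 \<xi>"])
qed

text \<open>Of the exponent 2 * J + 1, the part 2 * J comes from the rescaling of A^J by \<tau>^2
  and the remaining 1 from d\<theta> = \<tau> d\<xi>.\<close>

lemma green_difference_eq:
  assumes t: "\<tau> > 0"
  shows "green N a J (x + 1) (1 / \<tau>\<^sup>2) - green N a J x (1 / \<tau>\<^sup>2) = complex_of_real (1 / (2 * pi) * \<tau> ^ (2 * J + 1)) *
    (LINT \<xi>|lborel. (indicator {-pi..pi} (\<tau> * \<xi>) *\<^sub>R scaled_integrand N a J \<tau> \<xi>) * iexp (real_of_int x * \<tau> * \<xi>))"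
    and "integrable lborel (\<lambda>\<xi>. (indicator {-pi..pi} (\<tau> * \<xi>) *\<^sub>R scaled_integrand N a J \<tau> \<xi>) * iexp (real_of_int x * \<tau> * \<xi>))"
proof -
  define f where "f = (\<lambda>\<theta>. green_integrand N a J (x + 1) (1 / \<tau>\<^sup>2) \<theta> - green_integrand N a J x (1 / \<tau>\<^sup>2) \<theta>)"
  define F where "F = (\<lambda>\<theta>. indicator {-pi..pi} \<theta> *\<^sub>R f \<theta>)"
  have cont: "continuous_on {-pi..pi} f" unfolding f_def by (intro continuous_on_diff continuous_green_integrand)
  have si: "set_integrable lborel {-pi..pi} f" by (rule borel_integrable_atLeastAtMost'[OF cont])
  then have F_int: "integrable lborel F" by (simp add: F_def set_integrable_def)
  have "green N a J (x + 1) (1 / \<tau>\<^sup>2) - green N a J x (1 / \<tau>\<^sup>2) = complex_of_real (1 / (2 * pi)) * integral {-pi..pi} f"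
    unfolding green_def f_def
    by (subst integral_diff) (auto intro: green_integrand_integrable simp: algebra_simps)
  also have "integral {-pi..pi} f = (LINT \<theta>|lborel. F \<theta>)"
    using set_borel_integral_eq_integral(2)[OF si] by (simp add: set_lebesgue_integral_def F_def)
  also have "\<dots> = \<bar>\<tau>\<bar> *\<^sub>R (LINT \<xi>|lborel. F (0 + \<tau> * \<xi>))"
    by (rule lborel_integral_real_affine) (use t in simp)
  finally have 1: "green N a J (x + 1) (1 / \<tau>\<^sup>2) - green N a J x (1 / \<tau>\<^sup>2)
     = complex_of_real (1 / (2 * pi)) * (\<bar>\<tau>\<bar> *\<^sub>R (LINT \<xi>|lborel. F (0 + \<tau> * \<xi>)))" .
  define G where "G = (\<lambda>\<xi>. (indicator {-pi..pi} (\<tau> * \<xi>) *\<^sub>R scaled_integrand N a J \<tau> \<xi>) * iexp (real_of_int x * \<tau> * \<xi>))"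
  have F: "F (0 + \<tau> * \<xi>) = complex_of_real (\<tau> ^ (2 * J)) * G \<xi>" for \<xi>
  proof -
    have sc: "(- symbol N a (\<tau> * \<xi>)) ^ J = \<tau> ^ (2 * J) * (- (symbol N a (\<tau> * \<xi>) / \<tau>\<^sup>2)) ^ J"
      using t by (simp add: power_mult flip: power_mult_distrib)
    have e: "iexp (real_of_int (x + 1) * (\<tau> * \<xi>)) = iexp (real_of_int x * \<tau> * \<xi>) * iexp (\<tau> * \<xi>)"
      by (simp add: exp_add[symmetric] algebra_simps)
    have "f (\<tau> * \<xi>) = complex_of_real (\<tau> ^ (2 * J)) * (scaled_integrand N a J \<tau> \<xi> * iexp (real_of_int x * \<tau> * \<xi>))"
      unfolding f_def green_integrand_def scaled_integrand_def sc e by (simp add: algebra_simps)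
    then show ?thesis by (simp add: F_def G_def scaleR_conv_of_real mult_ac)
  qed
  show "green N a J (x + 1) (1 / \<tau>\<^sup>2) - green N a J x (1 / \<tau>\<^sup>2) = complex_of_real (1 / (2 * pi) * \<tau> ^ (2 * J + 1)) *
    (LINT \<xi>|lborel. (indicator {-pi..pi} (\<tau> * \<xi>) *\<^sub>R scaled_integrand N a J \<tau> \<xi>) * iexp (real_of_int x * \<tau> * \<xi>))"
    unfolding 1 F integral_mult_right_zero G_def[symmetric] using t by (simp add: scaleR_conv_of_real)
  have "integrable lborel (\<lambda>\<xi>. F (0 + \<tau> * \<xi>))"
    by (rule lborel_integrable_real_affine[OF F_int]) (use t in simp)
  then have "integrable lborel (\<lambda>\<xi>. complex_of_real (1 / \<tau> ^ (2 * J)) * F (0 + \<tau> * \<xi>))" by simp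
  then show "integrable lborel (\<lambda>\<xi>. (indicator {-pi..pi} (\<tau> * \<xi>) *\<^sub>R scaled_integrand N a J \<tau> \<xi>) * iexp (real_of_int x * \<tau> * \<xi>))"
    unfolding F G_def[symmetric] using t by simp
qed

lemma green_difference_expansion:
  assumes sc: "scheme_coeffs N a" and N: "N \<ge> 1"
  obtains R where "R \<ge> 0"
    "\<And>\<tau> x. \<tau> > 0 \<Longrightarrow> norm (green N a J (x + 1) (1 / \<tau>\<^sup>2) - green N a J x (1 / \<tau>\<^sup>2)
       - (\<Sum>n\<le>K. complex_of_real (\<tau> ^ (2 * J + 2 + n)) * g_fun N a J n (real_of_int x * \<tau>))) \<le> R * \<tau> ^ (2 * J + 3 + K)"
proof -
  \<comment> \<open>The approximation keeps the orders k = 0, ..., K + 1, that is g_0, ..., g_K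
    after the shift k = n + 1. Its error \<tau>^(K+2) times the prefactor \<tau>^(2J+1) gives
    \<tau>^(2J+3+K).\<close>
  define M where "M = K + 1"
  obtain g where g: "integrable lborel g"
    "\<And>\<tau> \<xi>. \<tau> > 0 \<Longrightarrow> norm (indicator {-pi..pi} (\<tau> * \<xi>) *\<^sub>R scaled_integrand N a J \<tau> \<xi> - approx_integrand N a J (Suc M) \<tau> \<xi>) \<le> \<tau> ^ Suc M * g \<xi>"
    "\<And>\<xi>. g \<xi> \<ge> 0"
    by (rule scaled_integrand_approx[OF sc N, of J M]) (rule that; (assumption | simp only: ))
  define R where "R = 1 / (2 * pi) * (LINT \<xi>|lborel. g \<xi>)"
  have R: "R \<ge> 0" unfolding R_def by (intro mult_nonneg_nonneg integral_nonneg_AE) (auto simp: g(3))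
  have "norm (green N a J (x + 1) (1 / \<tau>\<^sup>2) - green N a J x (1 / \<tau>\<^sup>2)
       - (\<Sum>n\<le>K. complex_of_real (\<tau> ^ (2 * J + 2 + n)) * g_fun N a J n (real_of_int x * \<tau>))) \<le> R * \<tau> ^ (2 * J + 3 + K)"
    if t: "\<tau> > 0" for \<tau> x
  proof -
    define y where "y = real_of_int x * \<tau>"
    define H where "H = (\<lambda>\<xi>. (indicator {-pi..pi} (\<tau> * \<xi>) *\<^sub>R scaled_integrand N a J \<tau> \<xi>) * iexp (y * \<xi>))"
    define A where "A = (\<lambda>\<xi>. approx_integrand N a J (Suc M) \<tau> \<xi> * iexp (y * \<xi>))"
    define c where "c = complex_of_real (1 / (2 * pi) * \<tau> ^ (2 * J + 1))"
    have H: "green N a J (x + 1) (1 / \<tau>\<^sup>2) - green N a J x (1 / \<tau>\<^sup>2) = c * (LINT \<xi>|lborel. H \<xi>)" "integrable lborel H"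
      using green_difference_eq[OF t, of N a J x] by (simp_all only: H_def c_def y_def)
    have A': "A \<xi> = (\<Sum>k<Suc M. complex_of_real (\<tau> ^ k) * gauss_integrand (expansion_poly N a J (Suc M) k) y \<xi>)" for \<xi>
      by (simp add: A_def approx_integrand_def gauss_integrand_def sum_distrib_right mult.assoc del: sum.lessThan_Suc)
    have A_int: "integrable lborel A"
      unfolding A'[abs_def] by (intro Bochner_Integration.integrable_sum integrable_mult_right integrable_gauss_integrand)
    have "(\<Sum>n\<le>K. complex_of_real (\<tau> ^ (2 * J + 2 + n)) * g_fun N a J n y)
       = (\<Sum>n\<le>K. complex_of_real (\<tau> ^ (2 * J + 1)) * (complex_of_real (\<tau> ^ Suc n) * gauss_transform (expansion_poly N a J (Suc M) (Suc n)) y))"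
    proof (intro sum.cong refl)
      fix n assume "n \<in> {..K}"
      then have "g_fun N a J n y = gauss_transform (expansion_poly N a J (Suc M) (Suc n)) y"
        using g_fun_eq[OF N, of n "Suc M" a J y] by (simp add: M_def)
      then show "complex_of_real (\<tau> ^ (2 * J + 2 + n)) * g_fun N a J n y
         = complex_of_real (\<tau> ^ (2 * J + 1)) * (complex_of_real (\<tau> ^ Suc n) * gauss_transform (expansion_poly N a J (Suc M) (Suc n)) y)"
        by (simp add: power_add power2_eq_square)
    qed
    also have "\<dots> = complex_of_real (\<tau> ^ (2 * J + 1)) * (\<Sum>k<Suc M. complex_of_real (\<tau> ^ k) * gauss_transform (expansion_poly N a J (Suc M) k) y)"
    proof -
      define f where "f = (\<lambda>k. complex_of_real (\<tau> ^ k) * gauss_transform (expansion_poly N a J (Suc M) k) y)"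
      \<comment> \<open>The order 0 drops out because exp (i \<theta>) - 1 vanishes at 0; this
        permits the shift of the summation index.\<close>
      have "f 0 = 0" by (simp add: f_def expansion_poly_0)
      moreover have "{..<M} = {..K}" by (auto simp: M_def)
      ultimately have "(\<Sum>k<Suc M. f k) = (\<Sum>n\<le>K. f (Suc n))" by (simp only: sum.lessThan_Suc_shift add_0)
      then show ?thesis by (simp only: f_def sum_distrib_left)
    qed
    also have "(\<Sum>k<Suc M. complex_of_real (\<tau> ^ k) * gauss_transform (expansion_poly N a J (Suc M) k) y)
       = complex_of_real (1 / (2 * pi)) * (LINT \<xi>|lborel. A \<xi>)"
    proof -
      have "(LINT \<xi>|lborel. A \<xi>) = (\<Sum>k<Suc M. complex_of_real (\<tau> ^ k) * (LINT \<xi>|lborel. gauss_integrand (expansion_poly N a J (Suc M) k) y \<xi>))"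
        unfolding A' by (subst Bochner_Integration.integral_sum)
          (auto intro!: integrable_mult_right integrable_gauss_integrand)
      then show ?thesis by (simp only: gauss_transform_def sum_distrib_left mult.left_commute)
    qed
    finally have 2: "(\<Sum>n\<le>K. complex_of_real (\<tau> ^ (2 * J + 2 + n)) * g_fun N a J n y) = c * (LINT \<xi>|lborel. A \<xi>)"
      by (simp add: c_def)
    have "norm (c * (LINT \<xi>|lborel. H \<xi>) - c * (LINT \<xi>|lborel. A \<xi>)) = norm c * norm (LINT \<xi>|lborel. H \<xi> - A \<xi>)"
      using H(2) A_int by (simp add: norm_mult flip: right_diff_distrib)
    also have "\<dots> \<le> norm c * (LINT \<xi>|lborel. \<tau> ^ Suc M * g \<xi>)"
    proof (intro mult_left_mono norm_ge_zero order_trans[OF integral_norm_bound integral_mono])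
      show "integrable lborel (\<lambda>\<xi>. norm (H \<xi> - A \<xi>))" using H(2) A_int by simp
      show "integrable lborel (\<lambda>\<xi>. \<tau> ^ Suc M * g \<xi>)" using g(1) by simp
      fix \<xi>
      have "norm (H \<xi> - A \<xi>) = norm (indicator {-pi..pi} (\<tau> * \<xi>) *\<^sub>R scaled_integrand N a J \<tau> \<xi> - approx_integrand N a J (Suc M) \<tau> \<xi>) * norm (iexp (y * \<xi>))"
        by (simp only: H_def A_def norm_mult left_diff_distrib[symmetric])
      then show "norm (H \<xi> - A \<xi>) \<le> \<tau> ^ Suc M * g \<xi>" using g(2)[OF t, of \<xi>] by simp
    qed
    also have "\<dots> = R * \<tau> ^ (2 * J + 3 + K)"
    proof -
      have "2 * J + 3 + K = (2 * J + 1) + Suc M" by (simp add: M_def)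
      then have "\<tau> ^ (2 * J + 3 + K) = \<tau> ^ (2 * J + 1) * \<tau> ^ Suc M" by (simp only: power_add)
      moreover have "norm c = 1 / (2 * pi) * \<tau> ^ (2 * J + 1)" using t unfolding c_def norm_of_real by simp
      ultimately show ?thesis by (simp add: R_def)
    qed
    finally show ?thesis unfolding y_def[symmetric] H(1) 2 .
  qed
  then show ?thesis using R by (intro that[of R])
qed

section \<open>Return from \<tau> = 1 / sqrt t to the variable t\<close>

lemma inverse_sqrt_power:
  assumes "t > 0"
  shows "(1 / sqrt t) ^ k = 1 / t powr (real k / 2)"
proof -
  have "sqrt t ^ k = t powr (real k / 2)"
    using assms by (simp add: powr_half_sqrt[symmetric] powr_power)
  then show ?thesis by (simp add: power_divide)
qed

theorem theorem6p4:
  fixes N J K\<^sub>1 :: nat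
    and a :: "nat \<Rightarrow> real"
    and u :: "int \<Rightarrow> real \<Rightarrow> complex"
    and t\<^sub>0 :: real
  assumes "N \<ge> 1"
    and "scheme_coeffs N a"
    and "first_discrete_Green N a u"
    and "t\<^sub>0 > 0"
    and "K\<^sub>1 \<ge> 2"
  shows "\<exists>R\<ge>0. \<exists>r :: int \<Rightarrow> real \<Rightarrow> complex.
    (\<forall>x. \<forall>t\<ge>t\<^sub>0. times_differentiable_at J (grad u x) t) \<and>
    (\<forall>x\<ge>0. \<forall>t\<ge>t\<^sub>0.
       nth_deriv J (grad u x) t =
         1 / t ^ (J + 1) * nth_deriv (2 * J + 1) h (real_of_int x / sqrt t)
         + 1 / (2 * t ^ (J + 1) * sqrt t) * nth_deriv (2 * J + 2) h (real_of_int x / sqrt t)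
         + (\<Sum>n=2..K\<^sub>1. 1 / (t powr (real J + 1 + real n / 2)) * g_fun N a J n (real_of_int x / sqrt t))
         + r x t) \<and>
    (\<forall>x<0. \<forall>t\<ge>t\<^sub>0. nth_deriv J (grad u x) t = - nth_deriv J (grad u (- (x + 1))) t) \<and>
    (\<forall>x\<ge>0. \<forall>t\<ge>t\<^sub>0. norm (r x t) \<le> R / t powr (real J + 1 + (real K\<^sub>1 + 1) / 2))"
proof -
  note N = \<open>N \<ge> 1\<close> and sc = \<open>scheme_coeffs N a\<close> and u = \<open>first_discrete_Green N a u\<close>
  obtain R where R: "R \<ge> 0"
    "\<And>\<tau> x. \<tau> > 0 \<Longrightarrow> norm (green N a J (x + 1) (1 / \<tau>\<^sup>2) - green N a J x (1 / \<tau>\<^sup>2)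
       - (\<Sum>n\<le>K\<^sub>1. complex_of_real (\<tau> ^ (2 * J + 2 + n)) * g_fun N a J n (real_of_int x * \<tau>))) \<le> R * \<tau> ^ (2 * J + 3 + K\<^sub>1)"
    by (rule green_difference_expansion[OF sc N, of J K\<^sub>1]) (rule that; (assumption | simp only: ))
  define main where "main = (\<lambda>x t. 1 / t ^ (J + 1) * nth_deriv (2 * J + 1) h (real_of_int x / sqrt t)
         + 1 / (2 * t ^ (J + 1) * sqrt t) * nth_deriv (2 * J + 2) h (real_of_int x / sqrt t)
         + (\<Sum>n=2..K\<^sub>1. 1 / (t powr (real J + 1 + real n / 2)) * g_fun N a J n (real_of_int x / sqrt t)))"
  \<comment> \<open>With the remainder defined as the exact difference, the expansion holds by
    definition and only the bound has content.\<close>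
  define r where "r = (\<lambda>x t. nth_deriv J (grad u x) t - main x t)"
  have main: "main x t = (\<Sum>n\<le>K\<^sub>1. complex_of_real ((1 / sqrt t) ^ (2 * J + 2 + n)) * g_fun N a J n (real_of_int x * (1 / sqrt t)))"
    if t: "t > 0" for x t
  proof -
    define f where "f = (\<lambda>n. complex_of_real ((1 / sqrt t) ^ (2 * J + 2 + n)) * g_fun N a J n (real_of_int x * (1 / sqrt t)))"
    have sq: "(1 / sqrt t) ^ (2 * J + 2) = 1 / t ^ (J + 1)"
    proof -
      have "(1 / sqrt t) ^ (2 * (J + 1)) = ((1 / sqrt t)\<^sup>2) ^ (J + 1)" by (rule power_mult)
      also have "(1 / sqrt t)\<^sup>2 = 1 / t" using t by (simp add: power_divide)
      finally show ?thesis by (simp add: power_divide)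
    qed
    have f0: "f 0 = 1 / t ^ (J + 1) * nth_deriv (2 * J + 1) h (real_of_int x / sqrt t)"
      unfolding f_def g_fun_0[OF N] add_0_right sq by simp
    have f1: "f 1 = 1 / (2 * t ^ (J + 1) * sqrt t) * nth_deriv (2 * J + 2) h (real_of_int x / sqrt t)"
      unfolding f_def g_fun_1[OF N] power_add[of _ "2 * J + 2"] sq by simp
    have fn: "f n = 1 / (t powr (real J + 1 + real n / 2)) * g_fun N a J n (real_of_int x / sqrt t)" for n
    proof -
      have e: "real (2 * J + 2 + n) / 2 = real J + 1 + real n / 2" by simp
      show ?thesis unfolding f_def inverse_sqrt_power[OF t] e by (simp only: times_divide_eq_right mult_1_right)
    qed
    \<comment> \<open>Separates the two leading terms, which the theorem writes with derivatives of
      \<open>h\<close> instead of \<open>g_fun\<close>.\<close>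
    have "{..K\<^sub>1} = insert 0 (insert 1 {2..K\<^sub>1})" using \<open>K\<^sub>1 \<ge> 2\<close> by auto
    then have "(\<Sum>n\<le>K\<^sub>1. f n) = f 0 + f 1 + (\<Sum>n=2..K\<^sub>1. f n)" by simp
    also have "\<dots> = main x t" unfolding f0 f1 main_def
      by (simp only: fn of_real_divide of_real_mult of_real_power of_real_1 of_real_numeral)
    finally show ?thesis by (simp only: f_def)
  qed
  have diff: "times_differentiable_at J (grad u x) t" if "t \<ge> t\<^sub>0" for x t
    unfolding times_differentiable_at_def
  proof (intro allI impI)
    fix k assume "k < J"
    show "nth_deriv k (grad u x) differentiable at t"
      by (rule differentiableI_vector[OF nth_deriv_grad_Green(2)[OF u]]) (use that \<open>t\<^sub>0 > 0\<close> in simp)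
  qed
  have odd: "nth_deriv J (grad u x) t = - nth_deriv J (grad u (- (x + 1))) t" if "t \<ge> t\<^sub>0" for x t
  proof -
    have t: "t > 0" using that \<open>t\<^sub>0 > 0\<close> by simp
    \<comment> \<open>The reflected gradient is the difference of the Fourier integrals at - x and -
      (x + 1); by evenness in x these are the values at x and x + 1 in reversed order.\<close>
    have "- (x + 1) + 1 = - x" by simp
    then show ?thesis by (simp only: nth_deriv_grad_Green(1)[OF u t] green_minus minus_diff_eq)
  qed
  have bound: "norm (r x t) \<le> R / t powr (real J + 1 + (real K\<^sub>1 + 1) / 2)" if "t \<ge> t\<^sub>0" for x t
  proof -
    have t: "t > 0" using that \<open>t\<^sub>0 > 0\<close> by simp
    have \<tau>: "1 / sqrt t > 0" "1 / (1 / sqrt t)\<^sup>2 = t" using t by (simp_all add: power_divide)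
    have "norm (r x t) \<le> R * (1 / sqrt t) ^ (2 * J + 3 + K\<^sub>1)"
      using R(2)[OF \<tau>(1), of x] unfolding r_def main[OF t] nth_deriv_grad_Green(1)[OF u t] \<tau>(2) .
    moreover have e: "real (2 * J + 3 + K\<^sub>1) / 2 = real J + 1 + (real K\<^sub>1 + 1) / 2" by (simp add: field_simps)
    ultimately show ?thesis unfolding inverse_sqrt_power[OF t] e by (simp only: times_divide_eq_right mult_1_right)
  qed
  have eq: "nth_deriv J (grad u x) t = main x t + r x t" for x t by (simp add: r_def)
  show ?thesis
    by (intro exI[of _ R] exI[of _ r] conjI allI impI R(1) diff odd bound eq[unfolded main_def])
qed

end
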